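(* Let $X_1$ and $X_2$ be complex Banach spaces and let $J$ be an operator ideal between $X_2$ and $X_1$. Let $S=(S_1,\ldots,S_n)$ and $T=(T_1,\ldots,T_m)$ be tuples of commuting bounded linear operators on $X_1$ and $X_2$ respectively, and let $(L_S,R_T)=(L_{S_1},\ldots,L_{S_n},R_{T_1},\ldots,R_{T_m})$ be the $(n+m)$-tuple of left and right multiplication operators on $J$, $L_{S_i}(A)=S_iA$, $R_{T_j}(A)=AT_j$ for $A\in J$. Then: (i) $\sigma_{\Phi_-}(S)\times\sigma_\pi(T)\cup\sigma_\delta(S)\times\sigma_{\Phi_+}(T)\subseteq\sigma_{\Phi_-}(L_S,R_T)\subseteq sp_{\delta e}(L_S,R_T)\subseteq sp_{\delta e}(S)\times sp_\pi(T)\cup sp_\delta(S)\times sp_{\pi e}(T)$; (ii) $\sigma_{\Phi_+}(S)\times\sigma_\delta(T)\cup\sigma_\pi(S)\times\sigma_{\Phi_-}(T)\subseteq\sigma_{\Phi_+}(L_S,R_T)\subseteq sp_{\pi e}(L_S,R_T)\subseteq sp_{\pi e}(S)\times sp_\delta(T)\cup sp_\pi(S)\times sp_{\delta e}(T)$. In addition, if $X_1$ and $X_2$ are Hilbert spaces, all the inclusions in (i) and (ii) are equalities.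
   Context: Joint spectra. Let $X$ be a complex Banach space and $T=(T_1,\ldots,T_n)$ an $n$-tuple of commuting bounded linear operators on $X$. $R(\cdot)$ and $N(\cdot)$ denote range and null space. For $\lambda\in\mathbb{C}^n$, $T-\lambda=(T_1-\lambda_1I,\ldots,T_n-\lambda_nI)$. Define $\hat{T}\colon X^n\to X$, $\hat{T}(x_1,\ldots,x_n)=T_1x_1+\cdots+T_nx_n$, and $\tilde{T}\colon X\to X^n$, $\tilde{T}(x)=(T_1x,\ldots,T_nx)$. A subspace of a Banach space has a direct complement if there is a closed subspace such that the whole space is the direct sum of the two. - $\sigma_{\Phi_-}(T)=\{\lambda\in\mathbb{C}^n:\operatorname{codim}R(\widehat{T-\lambda})=\infty\}$ (lower semi-Fredholm spectrum). - $\sigma_{\Phi_+}(T)=\{\lambda\in\mathbb{C}^n:\dim N(\widetilde{T-\lambda})=\infty$ or $R(\widetilde{T-\lambda})$ is not closed$\}$ (upper semi-Fredholm spectrum). - $\sigma_\delta(T)=\{\lambda\in\mathbb{C}^n: R(\widehat{T-\lambda})\ne X\}$ (defect spectrum). - $\sigma_\pi(T)=\{\lambda\in\mathbb{C}^n: N(\widetilde{T-\lambda})\ne0$ or $R(\widetilde{T-\lambda})$ is not closed$\}$ (approximate point spectrum). - $\mathcal{C}_-(T)=\{\lambda\in\mathbb{C}^n: N(\widehat{T-\lambda})$ has no direct complement in $X^n\}$ and $\mathcal{C}_+(T)=\{\lambda\in\mathbb{C}^n: R(\widetilde{T-\lambda})$ has no direct complement in $X^n\}$. - $sp_\delta(T)=\sigma_\delta(T)\cup\mathcal{C}_-(T)$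 and $sp_{\delta e}(T)=\sigma_{\Phi_-}(T)\cup\mathcal{C}_-(T)$ (split defect and essential split defect spectra). - $sp_\pi(T)=\sigma_\pi(T)\cup\mathcal{C}_+(T)$ and $sp_{\pi e}(T)=\sigma_{\Phi_+}(T)\cup\mathcal{C}_+(T)$ (split approximate point and essential split approximate point spectra). Operator ideal (in the sense of Eschmeier). $\mathrm{L}(X_2,X_1)$ is the space of bounded linear operators $X_2\to X_1$, $\mathrm{L}(X)=\mathrm{L}(X,X)$, and $X'$ is the dual of $X$. An operator ideal $J$ between $X_2$ and $X_1$ is a linear subspace of $\mathrm{L}(X_2,X_1)$ equipped with a norm $\alpha$ making it a Banach space such that (i) $x_1\otimes x_2'\in J$ and $\alpha(x_1\otimes x_2')=\|x_1\|\,\|x_2'\|$, (ii) $SAT\in J$ and $\alpha(SAT)\le\|S\|\,\alpha(A)\,\|T\|$, for all $x_1\in X_1$, $x_2'\in X_2'$, $A\in J$, $S\in\mathrm{L}(X_1)$, $T\in\mathrm{L}(X_2)$, where $x_1\otimes x_2'$ is the rank one operator $X_2\to X_1$, $x_2\mapsto x_2'(x_2)\,x_1$. The spectra of $(L_S,R_T)$ are those of a tuple of commuting bounded operators on the Banach space $(J,\alpha)$. *)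

theory Defs
  imports "HOL-Analysis.Analysis"
begin

section \<open>Complex Banach spaces\<close>

text \<open>The type-class hierarchy of the library is real; these classes add a complex scalar
  multiplication that extends the real one.\<close>

class complex_vector = real_vector +
  fixes scaleC :: "complex \<Rightarrow> 'a \<Rightarrow> 'a" (infixr "*\<^sub>C" 75)
  assumes scaleC_add_right: "c *\<^sub>C (x + y) = c *\<^sub>C x + c *\<^sub>C y"
    and scaleC_add_left: "(c + d) *\<^sub>C x = c *\<^sub>C x + d *\<^sub>C x"
    and scaleC_scaleC: "c *\<^sub>C d *\<^sub>C x = (c * d) *\<^sub>C x"
    and scaleC_of_real: "complex_of_real r *\<^sub>C x = r *\<^sub>R x"

class complex_normed_vector = complex_vector + real_normed_vector +
  assumes norm_scaleC: "norm (c *\<^sub>C x) = cmod c * norm x"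

class complex_banach = complex_normed_vector + complete_space

subclass (in complex_banach) banach ..

interpretation cvec: vector_space "scaleC :: complex \<Rightarrow> 'a \<Rightarrow> 'a::complex_vector"
proof
  fix x :: 'a
  show "1 *\<^sub>C x = x"
    using scaleC_of_real[of 1 x] by simp
qed (simp_all add: scaleC_add_right scaleC_add_left scaleC_scaleC)

instantiation complex :: complex_banach
begin
definition scaleC_complex :: "complex \<Rightarrow> complex \<Rightarrow> complex"
  where "scaleC_complex c z = c * z"
instance
  by standard (simp_all add: scaleC_complex_def algebra_simps scaleR_conv_of_real norm_mult)
end

instantiation vec :: (complex_vector, finite) complex_vector
begin
definition scaleC_vec :: "complex \<Rightarrow> 'a ^ 'b \<Rightarrow> 'a ^ 'b"
  where "scaleC_vec c v = (\<chi> i. c *\<^sub>C v $ i)"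
instance
  by standard (simp_all add: scaleC_vec_def vec_eq_iff scaleC_add_right scaleC_add_left
      scaleC_scaleC scaleC_of_real)
end

lemma bounded_linear_scaleC: "bounded_linear (\<lambda>x::'a::complex_normed_vector. c *\<^sub>C x)"
proof (rule bounded_linear_intro[where K = "cmod c"])
  fix r :: real and x y :: 'a
  show "c *\<^sub>C (x + y) = c *\<^sub>C x + c *\<^sub>C y"
    by (rule scaleC_add_right)
  show "c *\<^sub>C (r *\<^sub>R x) = r *\<^sub>R (c *\<^sub>C x)"
    unfolding scaleC_of_real[symmetric] scaleC_scaleC by (simp add: mult.commute)
  show "norm (c *\<^sub>C x) \<le> norm x * cmod c"
    by (simp add: norm_scaleC)
qed

lemma bounded_linear_scaleC_left: "bounded_linear (\<lambda>c. c *\<^sub>C (x::'a::complex_normed_vector))"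
proof (rule bounded_linear_intro[where K = "norm x"])
  fix r :: real and c d :: complex
  show "(c + d) *\<^sub>C x = c *\<^sub>C x + d *\<^sub>C x"
    by (rule scaleC_add_left)
  show "(r *\<^sub>R c) *\<^sub>C x = r *\<^sub>R (c *\<^sub>C x)"
    unfolding scaleC_of_real[symmetric] scaleC_scaleC by (simp add: scaleC_complex_def)
  show "norm (c *\<^sub>C x) \<le> norm c * norm x"
    by (simp add: norm_scaleC)
qed

instantiation blinfun :: (real_normed_vector, complex_normed_vector) complex_vector
begin
lift_definition scaleC_blinfun :: "complex \<Rightarrow> ('a \<Rightarrow>\<^sub>L 'b) \<Rightarrow> ('a \<Rightarrow>\<^sub>L 'b)"
  is "\<lambda>c f x. c *\<^sub>C f x"
  by (rule bounded_linear_compose[OF bounded_linear_scaleC])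
instance
  by standard (transfer; simp add: fun_eq_iff scaleC_add_right scaleC_add_left
      scaleC_scaleC scaleC_of_real)+
end

text \<open>The space \<open>L(X, Y)\<close> of bounded complex-linear operators. The norm it inherits from the
  real-linear operators is the usual operator norm.\<close>

definition complex_ops :: "('a::complex_normed_vector \<Rightarrow>\<^sub>L 'b::complex_normed_vector) set"
  where "complex_ops = {A. \<forall>c x. blinfun_apply A (c *\<^sub>C x) = c *\<^sub>C blinfun_apply A x}"

lift_definition rank_one ::
  "'a::complex_normed_vector \<Rightarrow> ('b::complex_normed_vector \<Rightarrow>\<^sub>L complex) \<Rightarrow> ('b \<Rightarrow>\<^sub>L 'a)"
  is "\<lambda>x f y. f y *\<^sub>C x"
  by (rule bounded_linear_compose[OF bounded_linear_scaleC_left])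

definition hilbert_space :: "'a::complex_banach itself \<Rightarrow> bool"
  where "hilbert_space _ \<longleftrightarrow> (\<exists>ip :: 'a \<Rightarrow> 'a \<Rightarrow> complex.
    (\<forall>x y z. ip (x + y) z = ip x z + ip y z) \<and>
    (\<forall>c x y. ip (c *\<^sub>C x) y = c * ip x y) \<and>
    (\<forall>x y. ip y x = cnj (ip x y)) \<and>
    (\<forall>x. ip x x = complex_of_real ((norm x)\<^sup>2)))"

section \<open>Subspaces carrying their own norm\<close>

text \<open>An operator ideal is a subspace whose norm is not the one of the ambient type. Therefore
  normed spaces are given below as a carrier \<open>V\<close> together with a norm \<open>N\<close> of which only the
  values on \<open>V\<close> matter; a Banach space that is a type is \<open>UNIV\<close> with \<open>norm\<close>.\<close>

text \<open>\<open>Metric_space\<close> requires nonnegativity and symmetry also outside the carrier, hence the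
  case distinction.\<close>

definition norm_dist :: "'a::complex_vector set \<Rightarrow> ('a \<Rightarrow> real) \<Rightarrow> 'a \<Rightarrow> 'a \<Rightarrow> real"
  where "norm_dist V N x y = (if x \<in> V \<and> y \<in> V then N (x - y) else 0)"

abbreviation norm_topology :: "'a::complex_vector set \<Rightarrow> ('a \<Rightarrow> real) \<Rightarrow> 'a topology"
  where "norm_topology V N \<equiv> Metric_space.mtopology V (norm_dist V N)"

definition banach_on :: "'a::complex_vector set \<Rightarrow> ('a \<Rightarrow> real) \<Rightarrow> bool"
  where "banach_on V N \<longleftrightarrow> cvec.subspace V \<and>
    (\<forall>x\<in>V. 0 \<le> N x) \<and> (\<forall>x\<in>V. N x = 0 \<longleftrightarrow> x = 0) \<and>
    (\<forall>x\<in>V. \<forall>y\<in>V. N (x + y) \<le> N x + N y) \<and> (\<forall>c. \<forall>x\<in>V. N (c *\<^sub>C x) = cmod c * N x) \<and>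
    Metric_space.mcomplete V (norm_dist V N)"

lemma norm_dist_UNIV: "norm_dist UNIV norm = (dist :: 'a \<Rightarrow> 'a::complex_normed_vector \<Rightarrow> real)"
  by (simp add: fun_eq_iff norm_dist_def dist_norm)

lemma closedin_norm_topology_UNIV:
  "closedin (norm_topology UNIV norm) W \<longleftrightarrow> closed (W :: 'a::complex_normed_vector set)"
  by (simp add: norm_dist_UNIV)

lemma banach_on_UNIV: "banach_on UNIV (norm :: 'a::complex_banach \<Rightarrow> real)"
proof -
  have "Met_TC.mcomplete TYPE('a)"
    by (simp add: complete_UNIV)
  then show ?thesis
    by (simp add: banach_on_def norm_dist_UNIV norm_scaleC norm_triangle_ineq)
qed

text \<open>The power \<open>V\<^sup>n\<close>, with the Euclidean combination of the norms (the norm of \<open>vec\<close>); any other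
  product norm yields the same topology.\<close>

definition power_space :: "'a set \<Rightarrow> ('a ^ 'n) set"
  where "power_space V = {v. \<forall>i. v $ i \<in> V}"

definition power_norm :: "('a \<Rightarrow> real) \<Rightarrow> 'a ^ 'n \<Rightarrow> real"
  where "power_norm N v = L2_set (\<lambda>i. N (v $ i)) UNIV"

definition finite_dim :: "'a::complex_vector set \<Rightarrow> bool"
  where "finite_dim W \<longleftrightarrow> (\<exists>B. finite B \<and> W \<subseteq> cvec.span B)"

text \<open>\<open>dim (V / W) < \<infinity>\<close>, for a subspace \<open>W\<close> of \<open>V\<close>.\<close>

definition finite_codim :: "'a::complex_vector set \<Rightarrow> 'a set \<Rightarrow> bool"
  where "finite_codim V W \<longleftrightarrow> (\<exists>B. finite B \<and> B \<subseteq> V \<and> V \<subseteq> cvec.span (W \<union> B))"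

definition has_direct_complement ::
  "'a::complex_vector set \<Rightarrow> ('a \<Rightarrow> real) \<Rightarrow> 'a set \<Rightarrow> bool"
  where "has_direct_complement V N W \<longleftrightarrow>
    (\<exists>M. cvec.subspace M \<and> M \<subseteq> V \<and> closedin (norm_topology V N) M \<and>
      W \<inter> M = {0} \<and> V = {w + m | w m. w \<in> W \<and> m \<in> M})"

section \<open>Joint spectra\<close>

text \<open>A tuple of operators on \<open>V\<close> is a family of maps indexed by a finite type; its values
  outside \<open>V\<close> are irrelevant.\<close>

definition shift :: "('n \<Rightarrow> 'a \<Rightarrow> 'a::complex_vector) \<Rightarrow> complex ^ 'n \<Rightarrow> 'n \<Rightarrow> 'a \<Rightarrow> 'a"
  where "shift T l i x = T i x - (l $ i) *\<^sub>C x"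

definition hat :: "('n::finite \<Rightarrow> 'a \<Rightarrow> 'a::complex_vector) \<Rightarrow> 'a ^ 'n \<Rightarrow> 'a"
  where "hat T v = (\<Sum>i\<in>UNIV. T i (v $ i))"

definition tilde :: "('n::finite \<Rightarrow> 'a \<Rightarrow> 'a::complex_vector) \<Rightarrow> 'a \<Rightarrow> 'a ^ 'n"
  where "tilde T x = (\<chi> i. T i x)"

definition hat_range :: "'a::complex_vector set \<Rightarrow> ('n::finite \<Rightarrow> 'a \<Rightarrow> 'a) \<Rightarrow> 'a set"
  where "hat_range V T = hat T ` power_space V"

definition hat_kernel :: "'a::complex_vector set \<Rightarrow> ('n::finite \<Rightarrow> 'a \<Rightarrow> 'a) \<Rightarrow> ('a ^ 'n) set"
  where "hat_kernel V T = {v \<in> power_space V. hat T v = 0}"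

definition tilde_range :: "'a::complex_vector set \<Rightarrow> ('n::finite \<Rightarrow> 'a \<Rightarrow> 'a) \<Rightarrow> ('a ^ 'n) set"
  where "tilde_range V T = tilde T ` V"

definition tilde_kernel :: "'a::complex_vector set \<Rightarrow> ('n::finite \<Rightarrow> 'a \<Rightarrow> 'a) \<Rightarrow> 'a set"
  where "tilde_kernel V T = {x \<in> V. tilde T x = 0}"

context
  fixes V :: "'a::complex_vector set" and N :: "'a \<Rightarrow> real" and T :: "'n::finite \<Rightarrow> 'a \<Rightarrow> 'a"
begin

definition sigma_Phi_minus :: "(complex ^ 'n) set"
  where "sigma_Phi_minus = {l. \<not> finite_codim V (hat_range V (shift T l))}"

definition sigma_Phi_plus :: "(complex ^ 'n) set"
  where "sigma_Phi_plus = {l. \<not> finite_dim (tilde_kernel V (shift T l)) \<or>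
    \<not> closedin (norm_topology (power_space V) (power_norm N)) (tilde_range V (shift T l))}"

definition sigma_delta :: "(complex ^ 'n) set"
  where "sigma_delta = {l. hat_range V (shift T l) \<noteq> V}"

definition sigma_pi :: "(complex ^ 'n) set"
  where "sigma_pi = {l. tilde_kernel V (shift T l) \<noteq> {0} \<or>
    \<not> closedin (norm_topology (power_space V) (power_norm N)) (tilde_range V (shift T l))}"

definition C_minus :: "(complex ^ 'n) set"
  where "C_minus = {l. \<not> has_direct_complement (power_space V) (power_norm N)
    (hat_kernel V (shift T l))}"

definition C_plus :: "(complex ^ 'n) set"
  where "C_plus = {l. \<not> has_direct_complement (power_space V) (power_norm N)
    (tilde_range V (shift T l))}"

definition sp_delta :: "(complex ^ 'n) set"
  where "sp_delta = sigma_delta \<union> C_minus"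

definition sp_delta_e :: "(complex ^ 'n) set"
  where "sp_delta_e = sigma_Phi_minus \<union> C_minus"

definition sp_pi :: "(complex ^ 'n) set"
  where "sp_pi = sigma_pi \<union> C_plus"

definition sp_pi_e :: "(complex ^ 'n) set"
  where "sp_pi_e = sigma_Phi_plus \<union> C_plus"

end

text \<open>The identification of \<open>\<complex>\<^sup>n \<times> \<complex>\<^sup>m\<close> with \<open>\<complex>\<^sup>n\<^sup>+\<^sup>m\<close>, the first \<open>n\<close> coordinates being those
  with index in \<open>Inl\<close>.\<close>

definition append_vec :: "'c ^ 'n \<Rightarrow> 'c ^ 'm \<Rightarrow> 'c ^ ('n + 'm)"
  where "append_vec a b = (\<chi> k. case k of Inl i \<Rightarrow> a $ i | Inr j \<Rightarrow> b $ j)"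

definition vec_Times :: "('c ^ 'n) set \<Rightarrow> ('c ^ 'm) set \<Rightarrow> ('c ^ ('n + 'm)) set"
    (infixr "\<times>\<^sub>v" 80)
  where "A \<times>\<^sub>v B = {append_vec a b | a b. a \<in> A \<and> b \<in> B}"

section \<open>Operator ideals and multiplication operators\<close>

definition operator_ideal ::
  "('b::complex_banach \<Rightarrow>\<^sub>L 'a::complex_banach) set \<Rightarrow> (('b \<Rightarrow>\<^sub>L 'a) \<Rightarrow> real) \<Rightarrow> bool"
  where "operator_ideal J \<alpha> \<longleftrightarrow> J \<subseteq> complex_ops \<and> banach_on J \<alpha> \<and>
    (\<forall>x. \<forall>f\<in>complex_ops. rank_one x f \<in> J \<and> \<alpha> (rank_one x f) = norm x * norm f) \<and>
    (\<forall>A\<in>J. \<forall>S\<in>complex_ops. \<forall>T\<in>complex_ops.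
      S o\<^sub>L A o\<^sub>L T \<in> J \<and> \<alpha> (S o\<^sub>L A o\<^sub>L T) \<le> norm S * \<alpha> A * norm T)"

definition commuting_tuple :: "('n::finite \<Rightarrow> ('a::complex_banach \<Rightarrow>\<^sub>L 'a)) \<Rightarrow> bool"
  where "commuting_tuple S \<longleftrightarrow> (\<forall>i. S i \<in> complex_ops) \<and> (\<forall>i j. S i o\<^sub>L S j = S j o\<^sub>L S i)"

definition mult_tuple ::
  "('n \<Rightarrow> ('a::complex_banach \<Rightarrow>\<^sub>L 'a)) \<Rightarrow> ('m \<Rightarrow> ('b::complex_banach \<Rightarrow>\<^sub>L 'b)) \<Rightarrow>
    'n + 'm \<Rightarrow> ('b \<Rightarrow>\<^sub>L 'a) \<Rightarrow> ('b \<Rightarrow>\<^sub>L 'a)"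
  where "mult_tuple S T k A = (case k of Inl i \<Rightarrow> S i o\<^sub>L A | Inr j \<Rightarrow> A o\<^sub>L T j)"

abbreviation op_tuple ::
  "('n \<Rightarrow> ('a::complex_banach \<Rightarrow>\<^sub>L 'a)) \<Rightarrow> 'n \<Rightarrow> 'a \<Rightarrow> 'a"
  where "op_tuple S \<equiv> \<lambda>i. blinfun_apply (S i)"

end

theory Submission
  imports Defs
begin

text \<open>Replacing \<open>S\<close>, \<open>T\<close> by \<open>S - a\<close>, \<open>T - b\<close> reduces every inclusion to the point \<open>0\<close>.

  Upper bounds: let \<open>\<Sum> S\<^sub>i P\<^sub>i = I - K\<close> and \<open>\<Sum> Q\<^sub>j T\<^sub>j = I - K'\<close> with \<open>K\<close>, \<open>K'\<close> of finite rank,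
  \<open>K S\<^sub>i = 0\<close>, \<open>T\<^sub>j K' = 0\<close>. Then \<open>G A = (P\<^sub>i A, K A Q\<^sub>j)\<close> and \<open>F(A, B) = \<Sum> S\<^sub>i A\<^sub>i + \<Sum> B\<^sub>j T\<^sub>j\<close> satisfy
  \<open>F G A = A - K A K'\<close> and \<open>F G F = F\<close>, so \<open>R(F)\<close> has finite codimension and \<open>N(F)\<close> is
  complemented. Part (ii) is dual.

  Lower bounds in (i): if \<open>R(F)\<close> has finite codimension, the open mapping theorem solves
  \<open>y \<otimes> g = F(A, B)\<close> with control modulo finitely many dimensions; evaluate at a unit vector \<open>x\<close>
  that all \<open>T\<^sub>j\<close> nearly annihilate and apply a functional that all \<open>S\<^sub>i\<close> nearly annihilate.
  In (ii): operators \<open>x\<^sub>k \<otimes> f\<^sub>k\<close> with \<open>S\<^sub>i x\<^sub>k \<rightarrow> 0\<close>, \<open>f\<^sub>k T\<^sub>j \<rightarrow> 0\<close> that stay separated in operator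
  norm contradict finite kernel and closed range. In Hilbert spaces the bounds agree, because
  closed subspaces are complemented.\<close>

section \<open>Normed spaces given by a carrier\<close>

text \<open>The mixed products come from negating the upper bounds: a point lies outside the upper
  set of (i) exactly if \<open>S\<close> is split onto there, or \<open>T\<close> is split bounded
  below, or both are split semi-Fredholm. In the first two cases one remainder is 0 and the other
  tuple is arbitrary: its coefficients are taken as 0 and its remainder as the identity.

  For the lower bounds the obstacle is the finite-dimensional defect, which is removed by the order
  of choice. If \<open>T\<close> merely fails to be bounded below, x is fixed first, and infinite
  codimension for \<open>S\<close> leaves room for a functional vanishing on the finitely many
  vectors b x. If \<open>S\<close> merely fails to be onto, the functional f comes first, and
  \<open>T\<close> not being semi-Fredholm leaves room for x in the kernels of the finitely many f
  b. In (ii) the tuple with the essential failure supplies a sequence chosen inductively against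
  finitely many earlier data.

  Since J is assumed complete for \<alpha>, Baire's theorem, open mapping and closedness are
  developed for subspaces with their own norm; \<alpha> dominates the operator norm, which carries
  estimates back to vectors.\<close>

lemma cvec_scale_minus1: "(- 1) *\<^sub>C x = - (x::'a::complex_vector)"
  using cvec.scale_minus_left[of 1 x] by simp

abbreviation norm_lim :: "('a::minus \<Rightarrow> real) \<Rightarrow> (nat \<Rightarrow> 'a) \<Rightarrow> 'a \<Rightarrow> bool"
  where "norm_lim N \<sigma> l \<equiv> (\<lambda>k. N (\<sigma> k - l)) \<longlonglongrightarrow> 0"

text \<open>\<open>banach_on\<close> without completeness. It is split off because sequential
  closedness, kernels and direct complements need only the norm axioms. All facts carry membership
  assumptions, as \<open>N\<close> is arbitrary off \<open>V\<close>.\<close>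

definition normed_on :: "'a::complex_vector set \<Rightarrow> ('a \<Rightarrow> real) \<Rightarrow> bool"
  where "normed_on V N \<longleftrightarrow> cvec.subspace V \<and>
    (\<forall>x\<in>V. 0 \<le> N x) \<and> (\<forall>x\<in>V. N x = 0 \<longleftrightarrow> x = 0) \<and>
    (\<forall>x\<in>V. \<forall>y\<in>V. N (x + y) \<le> N x + N y) \<and> (\<forall>c. \<forall>x\<in>V. N (c *\<^sub>C x) = cmod c * N x)"

lemma banach_on_normed: "banach_on V N \<Longrightarrow> normed_on V N"
  by (auto simp: banach_on_def normed_on_def)

lemma normed_on_subspace: "normed_on V N \<Longrightarrow> cvec.subspace V"
  by (simp add: normed_on_def)

context
  fixes V :: "'a::complex_vector set" and N :: "'a \<Rightarrow> real"
  assumes V: "normed_on V N"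
begin

lemma normed_on_0 [simp]: "0 \<in> V" "N 0 = 0"
  using V by (auto simp: normed_on_def cvec.subspace_0)

lemma normed_on_add: "x \<in> V \<Longrightarrow> y \<in> V \<Longrightarrow> x + y \<in> V"
  using V by (auto simp: normed_on_def cvec.subspace_add)

lemma normed_on_scale: "x \<in> V \<Longrightarrow> c *\<^sub>C x \<in> V"
  using V by (auto simp: normed_on_def cvec.subspace_scale)

lemma normed_on_diff: "x \<in> V \<Longrightarrow> y \<in> V \<Longrightarrow> x - y \<in> V"
  using V by (auto simp: normed_on_def cvec.subspace_diff)

lemma normed_on_sum: "(\<And>i. i \<in> I \<Longrightarrow> f i \<in> V) \<Longrightarrow> sum f I \<in> V"
  using V by (auto simp: normed_on_def cvec.subspace_sum)

lemma normed_on_nonneg: "x \<in> V \<Longrightarrow> 0 \<le> N x"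
  using V by (auto simp: normed_on_def)

lemma normed_on_eq_0: "x \<in> V \<Longrightarrow> N x = 0 \<longleftrightarrow> x = 0"
  using V by (auto simp: normed_on_def)

lemma normed_on_triangle: "x \<in> V \<Longrightarrow> y \<in> V \<Longrightarrow> N (x + y) \<le> N x + N y"
  using V by (auto simp: normed_on_def)

lemma normed_on_scale_eq: "x \<in> V \<Longrightarrow> N (c *\<^sub>C x) = cmod c * N x"
  using V by (auto simp: normed_on_def)

lemma normed_on_minus: "x \<in> V \<Longrightarrow> N (- x) = N x"
  using normed_on_scale_eq[of x "- 1"] by (simp add: cvec_scale_minus1)

lemma normed_on_minus_commute: "x \<in> V \<Longrightarrow> y \<in> V \<Longrightarrow> N (x - y) = N (y - x)"
  using normed_on_minus[of "x - y"] by (simp add: normed_on_diff)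

lemma normed_on_triangle_diff: "x \<in> V \<Longrightarrow> y \<in> V \<Longrightarrow> N (x - y) \<le> N x + N y"
  using normed_on_triangle[of x "- y"] normed_on_diff[of 0 y] normed_on_minus[of y] by simp

lemma normed_on_triangle_3:
  "x \<in> V \<Longrightarrow> y \<in> V \<Longrightarrow> z \<in> V \<Longrightarrow> N (x - z) \<le> N (x - y) + N (y - z)"
  using normed_on_triangle[of "x - y" "y - z"] by (simp add: normed_on_diff)

lemma normed_on_sum_le: "(\<And>i. i \<in> I \<Longrightarrow> f i \<in> V) \<Longrightarrow> N (sum f I) \<le> (\<Sum>i\<in>I. N (f i))"
proof (induction I rule: infinite_finite_induct)
  case (insert i I)
  then have "N (f i + sum f I) \<le> N (f i) + N (sum f I)"
    by (intro normed_on_triangle normed_on_sum) auto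
  with insert show ?case by fastforce
qed auto

lemma Metric_space_norm_dist: "Metric_space V (norm_dist V N)"
proof
  fix x y z
  show "0 \<le> norm_dist V N x y" "norm_dist V N x y = norm_dist V N y x"
    by (auto simp: norm_dist_def normed_on_nonneg normed_on_diff normed_on_minus_commute)
  assume "x \<in> V" "y \<in> V"
  then show "norm_dist V N x y = 0 \<longleftrightarrow> x = y"
    by (simp add: norm_dist_def normed_on_eq_0 normed_on_diff)
  assume "z \<in> V"
  with \<open>x \<in> V\<close> \<open>y \<in> V\<close> show "norm_dist V N x z \<le> norm_dist V N x y + norm_dist V N y z"
    by (simp add: norm_dist_def normed_on_triangle_3)
qed

lemma norm_tendsto_iff:
  assumes "l \<in> V" "\<And>k. \<sigma> k \<in> V"
  shows "norm_lim N \<sigma> l \<longleftrightarrow> (\<forall>\<epsilon>>0. \<exists>K. \<forall>k\<ge>K. N (\<sigma> k - l) < \<epsilon>)"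
  using assms by (simp add: LIMSEQ_iff normed_on_nonneg normed_on_diff)

lemma limitin_norm_topology_iff:
  assumes "\<And>k. \<sigma> k \<in> V"
  shows "limitin (norm_topology V N) \<sigma> l sequentially \<longleftrightarrow> l \<in> V \<and> norm_lim N \<sigma> l"
  using assms Metric_space.limit_metric_sequentially[OF Metric_space_norm_dist, of \<sigma> l]
  by (auto simp: norm_dist_def norm_tendsto_iff)

text \<open>Turns closedness in the carrier topology into a statement about norms of sequences, the
  form in which nearly all later arguments use it.\<close>

lemma closedin_norm_iff:
  "closedin (norm_topology V N) S \<longleftrightarrow>
    S \<subseteq> V \<and> (\<forall>\<sigma> l. (\<forall>k. \<sigma> k \<in> S) \<and> l \<in> V \<and> norm_lim N \<sigma> l \<longrightarrow> l \<in> S)"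
proof (cases "S \<subseteq> V")
  case True
  have "range \<sigma> \<subseteq> S \<and> limitin (norm_topology V N) \<sigma> l sequentially \<longleftrightarrow>
      (\<forall>k. \<sigma> k \<in> S) \<and> l \<in> V \<and> norm_lim N \<sigma> l" for \<sigma> l
    using True limitin_norm_topology_iff[of \<sigma> l] by (auto simp: image_subset_iff subset_iff)
  then show ?thesis
    unfolding Metric_space.metric_closedin_iff_sequentially_closed[OF Metric_space_norm_dist]
    by simp
next
  case False
  then show ?thesis
    by (simp add: Metric_space.metric_closedin_iff_sequentially_closed[OF Metric_space_norm_dist])
qed

lemma mcomplete_norm_dist_iff:
  "Metric_space.mcomplete V (norm_dist V N) \<longleftrightarrow>
    (\<forall>\<sigma>. (\<forall>k. \<sigma> k \<in> V) \<and> (\<forall>\<epsilon>>0. \<exists>K. \<forall>i\<ge>K. \<forall>j\<ge>K. N (\<sigma> i - \<sigma> j) < \<epsilon>) \<longrightarrow>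
      (\<exists>l\<in>V. norm_lim N \<sigma> l))"
proof -
  have "Metric_space.MCauchy V (norm_dist V N) \<sigma> \<longleftrightarrow>
      (\<forall>k. \<sigma> k \<in> V) \<and> (\<forall>\<epsilon>>0. \<exists>K. \<forall>i\<ge>K. \<forall>j\<ge>K. N (\<sigma> i - \<sigma> j) < \<epsilon>)" for \<sigma>
    unfolding Metric_space.MCauchy_def[OF Metric_space_norm_dist]
    by (simp add: image_subset_iff norm_dist_def cong: conj_cong)
  then show ?thesis
    unfolding Metric_space.mcomplete_def[OF Metric_space_norm_dist]
    using limitin_norm_topology_iff by (simp add: Bex_def cong: conj_cong)
qed

end

lemma banach_on_iff:
  "banach_on V N \<longleftrightarrow> normed_on V N \<and>
    (\<forall>\<sigma>. (\<forall>k. \<sigma> k \<in> V) \<and> (\<forall>\<epsilon>>0. \<exists>K. \<forall>i\<ge>K. \<forall>j\<ge>K. N (\<sigma> i - \<sigma> j) < \<epsilon>) \<longrightarrow>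
      (\<exists>l\<in>V. norm_lim N \<sigma> l))"
  using mcomplete_norm_dist_iff[of V N] by (auto simp: banach_on_def normed_on_def)

lemma banach_on_completeE:
  assumes "banach_on V N" "\<And>k. \<sigma> k \<in> V"
    and "\<And>\<epsilon>. \<epsilon> > 0 \<Longrightarrow> \<exists>K. \<forall>i\<ge>K. \<forall>j\<ge>K. N (\<sigma> i - \<sigma> j) < \<epsilon>"
  obtains l where "l \<in> V" "norm_lim N \<sigma> l"
  using assms unfolding banach_on_iff by blast

lemma closedin_normD:
  assumes "closedin (norm_topology V N) S" "normed_on V N"
    and "\<And>k. \<sigma> k \<in> S" "l \<in> V" "norm_lim N \<sigma> l"
  shows "l \<in> S"
  using assms closedin_norm_iff[of V N S] by blast

lemma banach_on_closed_subspace: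
  fixes V :: "'a::complex_vector set"
  assumes V: "banach_on V N" and W: "closedin (norm_topology V N) W" "cvec.subspace W"
  shows "banach_on W N"
  unfolding banach_on_iff
proof (intro conjI allI impI)
  note nV = banach_on_normed[OF V]
  have WV: "W \<subseteq> V"
    using W nV closedin_norm_iff[of V N W] by simp
  then show "normed_on W N"
    using nV W(2) by (auto simp: normed_on_def subset_iff)
  fix \<sigma> :: "nat \<Rightarrow> 'a"
  assume \<sigma>: "(\<forall>k. \<sigma> k \<in> W) \<and> (\<forall>\<epsilon>>0. \<exists>K. \<forall>i\<ge>K. \<forall>j\<ge>K. N (\<sigma> i - \<sigma> j) < \<epsilon>)"
  obtain l where "l \<in> V" "norm_lim N \<sigma> l"
    using banach_on_completeE[OF V, of \<sigma>] \<sigma> WV by blast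
  then show "\<exists>l\<in>W. norm_lim N \<sigma> l"
    using closedin_normD[OF W(1) nV] \<sigma> by blast
qed

section \<open>Finite powers of a normed carrier\<close>

lemma power_spaceD: "v \<in> power_space V \<Longrightarrow> v $ i \<in> V"
  by (simp add: power_space_def)

lemma power_space_UNIV [simp]: "power_space UNIV = UNIV"
  by (simp add: power_space_def)

lemma power_norm_norm: "power_norm norm = norm"
  by (simp add: fun_eq_iff power_norm_def norm_vec_def)

lemma scaleC_vec_nth [simp]: "(c *\<^sub>C v) $ i = c *\<^sub>C (v $ i)"
  by (simp add: scaleC_vec_def)

lemma component_le_power_norm: "N (v $ i) \<le> power_norm N (v :: 'a ^ 'n)"
  unfolding power_norm_def by (rule member_le_L2_set) auto

lemma power_norm_le_sum:
  assumes "normed_on V N" "v \<in> power_space V"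
  shows "power_norm N v \<le> (\<Sum>i\<in>UNIV. N (v $ i))"
  unfolding power_norm_def
  using assms by (intro L2_set_le_sum) (auto simp: power_space_def normed_on_nonneg)

lemma normed_on_power:
  assumes V: "normed_on V N"
  shows "normed_on (power_space V :: ('a::complex_vector ^ 'n) set) (power_norm N)"
  unfolding normed_on_def
proof (intro conjI ballI allI)
  show "cvec.subspace (power_space V :: ('a ^ 'n) set)"
    by (auto simp: cvec.subspace_def power_space_def normed_on_0[OF V] normed_on_add[OF V]
        normed_on_scale[OF V])
next
  fix x :: "'a ^ 'n"
  assume x: "x \<in> power_space V"
  show "0 \<le> power_norm N x"
    by (simp add: power_norm_def L2_set_nonneg)
  show "power_norm N x = 0 \<longleftrightarrow> x = 0"
    using x by (auto simp: power_norm_def L2_set_eq_0_iff vec_eq_iff normed_on_eq_0[OF V] power_spaceD)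
  show "power_norm N (c *\<^sub>C x) = cmod c * power_norm N x" for c
    using x by (simp add: power_norm_def L2_set_right_distrib normed_on_scale_eq[OF V] power_spaceD)
  fix y :: "'a ^ 'n"
  assume y: "y \<in> power_space V"
  have "power_norm N (x + y) \<le> L2_set (\<lambda>i. N (x $ i) + N (y $ i)) UNIV"
    unfolding power_norm_def
    using x y by (intro L2_set_mono)
      (simp_all add: normed_on_triangle[OF V] normed_on_nonneg[OF V] normed_on_add[OF V] power_spaceD)
  also have "\<dots> \<le> power_norm N x + power_norm N y"
    unfolding power_norm_def by (rule L2_set_triangle_ineq)
  finally show "power_norm N (x + y) \<le> power_norm N x + power_norm N y" .
qed

text \<open>A Cauchy sequence is Cauchy in each coordinate, since the power norm dominates the
  coordinate norms. The coordinate limits form the limit because the finite sum of the coordinate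
  norms dominates the power norm.\<close>

lemma banach_on_power:
  assumes V: "banach_on V N"
  shows "banach_on (power_space V :: ('a::complex_vector ^ 'n) set) (power_norm N)"
  unfolding banach_on_iff
proof (intro conjI allI impI)
  note nV = banach_on_normed[OF V]
  show nP: "normed_on (power_space V :: ('a ^ 'n) set) (power_norm N)"
    by (rule normed_on_power[OF nV])
  fix \<sigma> :: "nat \<Rightarrow> 'a ^ 'n"
  assume \<sigma>: "(\<forall>k. \<sigma> k \<in> power_space V) \<and>
    (\<forall>\<epsilon>>0. \<exists>K. \<forall>i\<ge>K. \<forall>j\<ge>K. power_norm N (\<sigma> i - \<sigma> j) < \<epsilon>)"
  have "\<exists>l. l \<in> V \<and> (\<lambda>k. N (\<sigma> k $ i - l)) \<longlonglongrightarrow> 0" for i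
  proof (rule banach_on_completeE[OF V, of "\<lambda>k. \<sigma> k $ i"])
    show "\<sigma> k $ i \<in> V" for k
      using \<sigma> by (simp add: power_spaceD)
    show "\<exists>K. \<forall>k\<ge>K. \<forall>j\<ge>K. N (\<sigma> k $ i - \<sigma> j $ i) < \<epsilon>" if \<epsilon>: "\<epsilon> > 0" for \<epsilon>
    proof -
      obtain K where "\<forall>k\<ge>K. \<forall>j\<ge>K. power_norm N (\<sigma> k - \<sigma> j) < \<epsilon>"
        using \<sigma> \<epsilon> by blast
      moreover have "N (\<sigma> k $ i - \<sigma> j $ i) \<le> power_norm N (\<sigma> k - \<sigma> j)" for k j
        using component_le_power_norm[of N "\<sigma> k - \<sigma> j" i] by simp
      ultimately show ?thesis
        by (meson le_less_trans)
    qed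
  qed blast
  then obtain l where l: "\<And>i. l i \<in> V" "\<And>i. (\<lambda>k. N (\<sigma> k $ i - l i)) \<longlonglongrightarrow> 0"
    by metis
  have "(\<lambda>k. power_norm N (\<sigma> k - (\<chi> i. l i))) \<longlonglongrightarrow> 0"
  proof (rule tendsto_sandwich[of "\<lambda>_. 0" _ _ "\<lambda>k. \<Sum>i\<in>UNIV. N (\<sigma> k $ i - l i)"])
    show "(\<lambda>k. \<Sum>i\<in>UNIV. N (\<sigma> k $ i - l i)) \<longlonglongrightarrow> 0"
      using tendsto_sum[of UNIV "\<lambda>i k. N (\<sigma> k $ i - l i)" "\<lambda>_. 0" sequentially] l(2) by simp
    show "\<forall>\<^sub>F k in sequentially. power_norm N (\<sigma> k - (\<chi> i. l i)) \<le> (\<Sum>i\<in>UNIV. N (\<sigma> k $ i - l i))"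
      using power_norm_le_sum[OF nV, of "\<sigma> _ - (\<chi> i. l i)"] \<sigma> l(1)
      by (simp add: power_space_def normed_on_diff[OF nV])
    show "\<forall>\<^sub>F k in sequentially. 0 \<le> power_norm N (\<sigma> k - (\<chi> i. l i))"
      by (simp add: power_norm_def L2_set_nonneg)
  qed auto
  moreover have "(\<chi> i. l i) \<in> power_space V"
    by (simp add: power_space_def l(1))
  ultimately show "\<exists>l\<in>power_space V. norm_lim (power_norm N) \<sigma> l"
    by blast
qed

text \<open>\<open>'a ^ 'n\<close> is made an instance of \<open>complex_vector\<close> only, so
  with its norm it is handled as the carrier \<open>UNIV\<close> rather than through
  \<open>complex_banach\<close>.\<close>

lemma banach_on_powerI:
  "banach_on (UNIV :: ('a::complex_banach ^ 'n) set) norm"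
  using banach_on_power[OF banach_on_UNIV, where 'n='n] by (simp add: power_norm_norm)

section \<open>Bounded operators between carriers\<close>

definition linear_on :: "'a::complex_vector set \<Rightarrow> 'b::complex_vector set \<Rightarrow> ('a \<Rightarrow> 'b) \<Rightarrow> bool"
  where "linear_on V W F \<longleftrightarrow> (\<forall>x\<in>V. F x \<in> W) \<and>
    (\<forall>x\<in>V. \<forall>y\<in>V. F (x + y) = F x + F y) \<and> (\<forall>c. \<forall>x\<in>V. F (c *\<^sub>C x) = c *\<^sub>C F x)"

definition bounded_op ::
  "'a::complex_vector set \<Rightarrow> ('a \<Rightarrow> real) \<Rightarrow> 'b::complex_vector set \<Rightarrow> ('b \<Rightarrow> real) \<Rightarrow> ('a \<Rightarrow> 'b) \<Rightarrow> bool"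
  where "bounded_op V N W M F \<longleftrightarrow> linear_on V W F \<and> (\<exists>K\<ge>0. \<forall>x\<in>V. M (F x) \<le> K * N x)"

lemma linear_onD:
  assumes "linear_on V W F"
  shows "x \<in> V \<Longrightarrow> F x \<in> W" "x \<in> V \<Longrightarrow> y \<in> V \<Longrightarrow> F (x + y) = F x + F y"
    "x \<in> V \<Longrightarrow> F (c *\<^sub>C x) = c *\<^sub>C F x"
  using assms by (auto simp: linear_on_def)

lemma linear_on_0: "linear_on V W F \<Longrightarrow> cvec.subspace V \<Longrightarrow> F 0 = 0"
  using linear_onD(3)[of V W F 0 0] by (simp add: cvec.subspace_0)

lemma linear_on_diff:
  assumes F: "linear_on V W F" and V: "cvec.subspace V" and x: "x \<in> V" and y: "y \<in> V"
  shows "F (x - y) = F x - F y"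
  using linear_onD(2)[OF F, of "x - y" y] cvec.subspace_diff[OF V x y] y by (simp add: algebra_simps)

lemma linear_on_sum:
  assumes F: "linear_on V W F" and V: "cvec.subspace V" and f: "\<And>i. i \<in> I \<Longrightarrow> f i \<in> V"
  shows "F (sum f I) = (\<Sum>i\<in>I. F (f i))"
  using f
proof (induction I rule: infinite_finite_induct)
  case (insert i I)
  then show ?case
    using linear_onD(2)[OF F, of "f i" "sum f I"] cvec.subspace_sum[OF V, of I f] by simp
qed (simp_all add: linear_on_0[OF F V])

lemma linear_on_image:
  assumes F: "linear_on V W F" and V: "cvec.subspace V"
  shows "cvec.subspace (F ` V)"
  unfolding cvec.subspace_def
proof (intro conjI ballI allI)
  show "0 \<in> F ` V"
    using linear_on_0[OF F V] cvec.subspace_0[OF V] by (metis imageI)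
  fix x y c
  assume "x \<in> F ` V"
  then obtain u where u: "u \<in> V" "x = F u" by blast
  show "c *\<^sub>C x \<in> F ` V"
    using u linear_onD(3)[OF F u(1), of c] cvec.subspace_scale[OF V u(1)] by (metis imageI)
  assume "y \<in> F ` V"
  then obtain v where v: "v \<in> V" "y = F v" by blast
  show "x + y \<in> F ` V"
    using u v linear_onD(2)[OF F u(1) v(1)] cvec.subspace_add[OF V u(1) v(1)] by (metis imageI)
qed

lemma linear_on_kernel:
  assumes F: "linear_on V W F" and V: "cvec.subspace V"
  shows "cvec.subspace {v \<in> V. F v = 0}"
  using linear_on_0[OF F V] V
  by (auto simp: cvec.subspace_def linear_onD[OF F])

lemma bounded_op_linear: "bounded_op V N W M F \<Longrightarrow> linear_on V W F"
  by (simp add: bounded_op_def)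

lemma bounded_op_tendsto:
  assumes F: "bounded_op V N W M F" and V: "normed_on V N" and W: "normed_on W M"
    and \<sigma>: "\<And>k. \<sigma> k \<in> V" "l \<in> V" "norm_lim N \<sigma> l"
  shows "(\<lambda>k. M (F (\<sigma> k) - F l)) \<longlonglongrightarrow> 0"
proof -
  obtain K where K: "K \<ge> 0" "\<And>x. x \<in> V \<Longrightarrow> M (F x) \<le> K * N x"
    using F by (auto simp: bounded_op_def)
  note L = bounded_op_linear[OF F]
  have *: "M (F (\<sigma> k) - F l) \<le> K * N (\<sigma> k - l)" "0 \<le> M (F (\<sigma> k) - F l)" for k
    using K(2)[of "\<sigma> k - l"] \<sigma> linear_on_diff[OF L normed_on_subspace[OF V], of "\<sigma> k" l]
      normed_on_nonneg[OF W, of "F (\<sigma> k) - F l"] linear_onD(1)[OF L]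
    by (simp_all add: normed_on_diff[OF V] normed_on_diff[OF W])
  show ?thesis
    by (rule tendsto_sandwich[of "\<lambda>_. 0" _ _ "\<lambda>k. K * N (\<sigma> k - l)"])
      (use * tendsto_mult_right_zero[OF \<sigma>(3), of K] in auto)
qed

section \<open>The open mapping theorem modulo a closed subspace\<close>

lemma geometric_series_converges:
  fixes V :: "'a::complex_vector set"
  assumes V: "banach_on V N" and v: "\<And>k. v k \<in> V" "\<And>k. N (v k) \<le> c / 2 ^ k"
  obtains l where "l \<in> V" "(\<lambda>k. N ((\<Sum>i<k. v i) - l)) \<longlonglongrightarrow> 0" "N l \<le> 2 * c"
proof -
  note nV = banach_on_normed[OF V]
  define s where "s k = (\<Sum>i<k. v i)" for k
  have s: "s k \<in> V" for k
    unfolding s_def using v by (intro normed_on_sum[OF nV])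
  have c: "c \<ge> 0"
    using v(2)[of 0] normed_on_nonneg[OF nV v(1)[of 0]] by simp
  \<comment> \<open>Geometric tail: the terms c / 2^(m + i) add up to at most 2c / 2^m. The case m =
    0 later bounds the limit.\<close>
  have tail: "N (s (m + n) - s m) \<le> 2 * c / 2 ^ m" for m n
  proof -
    have "s (m + n) - s m = (\<Sum>i<n. v (m + i))"
      unfolding s_def by (induction n) (simp_all add: algebra_simps)
    also have "N \<dots> \<le> (\<Sum>i<n. N (v (m + i)))"
      using v by (intro normed_on_sum_le[OF nV])
    also have "\<dots> \<le> (\<Sum>i<n. c / 2 ^ m * (1/2) ^ i)"
    proof (rule sum_mono)
      show "N (v (m + i)) \<le> c / 2 ^ m * (1/2) ^ i" for i
        using v(2)[of "m + i"] by (simp add: power_add power_divide)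
    qed
    also have "\<dots> = c / 2 ^ m * (\<Sum>i<n. (1/2) ^ i)"
      by (simp add: sum_distrib_left)
    also have "\<dots> \<le> c / 2 ^ m * 2"
      using c by (intro mult_left_mono) (simp_all add: geometric_sum)
    finally show ?thesis by (simp add: mult.commute)
  qed
  have "\<exists>K. \<forall>i\<ge>K. \<forall>j\<ge>K. N (s i - s j) < \<epsilon>" if \<epsilon>: "\<epsilon> > 0" for \<epsilon>
  proof -
    have "(\<lambda>m. 4 * c / 2 ^ m) \<longlonglongrightarrow> 0"
      using tendsto_mult_right_zero[OF LIMSEQ_power_zero[of "1/2::real"], of "4 * c"]
      by (simp add: power_one_over field_simps)
    then obtain K where "4 * c / 2 ^ K < \<epsilon>"
      using \<epsilon> c by (metis eventually_happens order_tendstoD(2) sequentially_bot)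
    moreover have "N (s i - s j) \<le> 4 * c / 2 ^ K" if "i \<ge> K" "j \<ge> K" for i j
    proof -
      have "N (s i - s j) \<le> N (s i - s K) + N (s j - s K)"
        using normed_on_triangle_3[OF nV, of "s i" "s K" "s j"]
          normed_on_minus_commute[OF nV, of "s K" "s j"] s by simp
      also have "\<dots> \<le> 2 * c / 2 ^ K + 2 * c / 2 ^ K"
        using tail[of K "i - K"] tail[of K "j - K"] that by (intro add_mono) auto
      finally show ?thesis by (simp add: field_simps)
    qed
    ultimately show ?thesis by (meson le_less_trans)
  qed
  then obtain l where l: "l \<in> V" "norm_lim N s l"
    using banach_on_completeE[OF V, of s] s by blast
  have "N l \<le> N (s k - l) + 2 * c" for k
  proof -
    have "N l \<le> N (l - s k) + N (s k)"
      using normed_on_triangle[OF nV, of "l - s k" "s k"] l s by (simp add: normed_on_diff[OF nV])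
    moreover have "N (s k) \<le> 2 * c"
      using tail[of 0 k] by (simp add: s_def)
    ultimately show ?thesis
      using normed_on_minus_commute[OF nV, of l "s k"] l s by simp
  qed
  moreover have "(\<lambda>k. N (s k - l) + 2 * c) \<longlonglongrightarrow> 0 + 2 * c"
    by (intro tendsto_intros l)
  ultimately have "N l \<le> 2 * c"
    using LIMSEQ_le_const[of "\<lambda>k. N (s k - l) + 2 * c" "2 * c" "N l"] by auto
  with l show thesis
    by (intro that[of l]) (simp_all add: s_def)
qed

text \<open>Successive approximation: applying \<open>step\<close> to each residual at least halves
  it, so the corrections \<open>f (ws k)\<close> decay geometrically and their sum converges.
  Working modulo \<open>E\<close> covers maps that are onto only up to a given closed
  subspace.\<close>

lemma approximate_surjection:
  fixes V :: "'a::complex_vector set" and W :: "'b::complex_vector set"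
  assumes V: "banach_on V N" and W: "banach_on W M" and F: "bounded_op V N W M F"
    and E: "cvec.subspace E" "closedin (norm_topology W M) E"
    and step: "\<And>w. w \<in> W \<Longrightarrow> \<exists>v\<in>V. \<exists>e\<in>E. N v \<le> C * M w \<and> M (w - F v - e) \<le> M w / 2"
    and C: "C \<ge> 0" and w: "w \<in> W"
  shows "\<exists>v\<in>V. N v \<le> 2 * C * M w \<and> w - F v \<in> E"
proof -
  note nV = banach_on_normed[OF V] and nW = banach_on_normed[OF W]
  note L = bounded_op_linear[OF F]
  have EW: "E \<subseteq> W"
    using E(2) closedin_norm_iff[OF nW] by blast
  obtain f g where fg: "\<And>w. w \<in> W \<Longrightarrow> f w \<in> V" "\<And>w. w \<in> W \<Longrightarrow> g w \<in> E"
      "\<And>w. w \<in> W \<Longrightarrow> N (f w) \<le> C * M w"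
      "\<And>w. w \<in> W \<Longrightarrow> M (w - F (f w) - g w) \<le> M w / 2"
    using step by metis
  define ws where "ws k = ((\<lambda>w. w - F (f w) - g w) ^^ k) w" for k
  have ws_Suc: "ws (Suc k) = ws k - F (f (ws k)) - g (ws k)" for k
    by (simp add: ws_def)
  have ws: "ws k \<in> W" for k
  proof (induction k)
    case (Suc k)
    then show ?case
      using fg EW L by (simp add: ws_Suc normed_on_diff[OF nW] linear_onD subset_iff)
  qed (simp add: ws_def w)
  have Mws: "M (ws k) \<le> M w / 2 ^ k" for k
  proof (induction k)
    case (Suc k)
    then show ?case
      using fg(4)[OF ws[of k]] by (simp add: ws_Suc)
  qed (simp add: ws_def)
  have Nf: "N (f (ws k)) \<le> (C * M w) / 2 ^ k" for k
    using fg(3)[OF ws[of k]] mult_left_mono[OF Mws[of k] C] by simp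
  obtain v where v: "v \<in> V" "(\<lambda>k. N ((\<Sum>i<k. f (ws i)) - v)) \<longlonglongrightarrow> 0" "N v \<le> 2 * (C * M w)"
    using geometric_series_converges[OF V, of "\<lambda>k. f (ws k)"] fg(1) ws Nf by blast
  define s where "s k = (\<Sum>i<k. f (ws i))" for k
  define t where "t k = (\<Sum>i<k. g (ws i))" for k
  have sV: "s k \<in> V" for k
    unfolding s_def using fg(1)[OF ws] by (intro normed_on_sum[OF nV])
  have tE: "t k \<in> E" for k
    unfolding t_def using fg(2)[OF ws] by (intro cvec.subspace_sum[OF E(1)])
  have "w - F (s k) - t k = ws k" for k
  proof (induction k)
    case 0
    then show ?case
      by (simp add: s_def t_def ws_def linear_on_0[OF L normed_on_subspace[OF nV]])
  next
    case (Suc k)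
    have "F (s (Suc k)) = F (s k) + F (f (ws k))"
      using linear_onD(2)[OF L sV[of k] fg(1)[OF ws[of k]]] by (simp add: s_def)
    with Suc show ?case
      by (simp add: ws_Suc t_def algebra_simps)
  qed
  \<comment> \<open>The \<open>E\<close>-corrections come without a norm bound. Their partial sums
    converge because they equal \<open>w - F (s k)\<close> minus a residual that tends to 0, and
    closedness of \<open>E\<close> places the limit in \<open>E\<close>.\<close>
  then have t_eq: "t k - (w - F v) = - (F (s k) - F v) - ws k" for k
    by (simp add: algebra_simps)
  have Fs: "(\<lambda>k. M (F (s k) - F v)) \<longlonglongrightarrow> 0"
    using v by (intro bounded_op_tendsto[OF F nV nW sV]) (simp_all add: s_def)
  have "(\<lambda>k. M w / 2 ^ k) \<longlonglongrightarrow> 0"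
    using tendsto_mult_right_zero[OF LIMSEQ_power_zero[of "1/2::real"], of "M w"]
    by (simp add: power_one_over field_simps)
  from tendsto_add[OF Fs this] have lim: "(\<lambda>k. M (F (s k) - F v) + M w / 2 ^ k) \<longlonglongrightarrow> 0"
    by simp
  have FW: "F (s k) - F v \<in> W" for k
    using L v sV by (simp add: normed_on_diff[OF nW] linear_onD)
  have le: "M (t k - (w - F v)) \<le> M (F (s k) - F v) + M w / 2 ^ k" for k
  proof -
    have "- (F (s k) - F v) \<in> W"
      using normed_on_diff[OF nW normed_on_0(1)[OF nW] FW[of k]] by simp
    then have "M (- (F (s k) - F v) - ws k) \<le> M (- (F (s k) - F v)) + M (ws k)"
      using ws by (intro normed_on_triangle_diff[OF nW])
    then show ?thesis
      using Mws[of k] unfolding t_eq normed_on_minus[OF nW FW] by linarith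
  qed
  have wF: "w - F v \<in> W"
    using w v L by (simp add: normed_on_diff[OF nW] linear_onD)
  have "(\<lambda>k. M (t k - (w - F v))) \<longlonglongrightarrow> 0"
  proof (rule tendsto_sandwich[OF _ _ tendsto_const lim])
    have "t k - (w - F v) \<in> W" for k
      using normed_on_diff[OF nW _ wF] tE EW by blast
    then show "\<forall>\<^sub>F k in sequentially. 0 \<le> M (t k - (w - F v))"
      using normed_on_nonneg[OF nW] by simp
  qed (use le in simp)
  then have "w - F v \<in> E"
    by (rule closedin_normD[OF E(2) nW tE wF])
  with v show ?thesis
    by (intro bexI[of _ v]) (simp_all add: mult.assoc)
qed

text \<open>Baire's theorem provides the hypothesis \<open>step\<close> of the preceding lemma. The
  version modulo \<open>E\<close> serves three situations: \<open>E\<close> zero, \<open>E\<close>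
  spanned by finitely many vectors, and \<open>E\<close> a direct complement of the range.\<close>

theorem open_mapping_modulo:
  fixes V :: "'a::complex_vector set" and W :: "'b::complex_vector set"
  assumes V: "banach_on V N" and W: "banach_on W M" and F: "bounded_op V N W M F"
    and E: "cvec.subspace E" "closedin (norm_topology W M) E"
    and surj: "\<And>w. w \<in> W \<Longrightarrow> \<exists>v\<in>V. w - F v \<in> E"
  obtains C where "C \<ge> 0" "\<And>w. w \<in> W \<Longrightarrow> \<exists>v\<in>V. N v \<le> C * M w \<and> w - F v \<in> E"
proof -
  note nV = banach_on_normed[OF V] and nW = banach_on_normed[OF W]
  note L = bounded_op_linear[OF F]
  interpret W: Metric_space W "norm_dist W M"
    by (rule Metric_space_norm_dist[OF nW])
  have EW: "E \<subseteq> W"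
    using E(2) closedin_norm_iff[OF nW] by blast
  \<comment> \<open>Every \<open>w\<close> has some preimage modulo \<open>E\<close>, so the
    closures of these sets exhaust \<open>W\<close> and one of them has interior points.\<close>
  define D where "D n = {w \<in> W. \<exists>v\<in>V. N v \<le> real n \<and> w - F v \<in> E}" for n
  have DW: "D n \<subseteq> W" for n by (auto simp: D_def)
  have "\<exists>n. w \<in> D n" if w: "w \<in> W" for w
  proof -
    obtain v where "v \<in> V" "w - F v \<in> E"
      using surj[OF w] by blast
    moreover obtain n where "N v \<le> real n"
      using real_arch_simple by blast
    ultimately show ?thesis
      using w by (auto simp: D_def)
  qed
  then have cover: "W = (\<Union>n. W.mtopology closure_of D n)"
    using closure_of_subset[of "D _" W.mtopology] closure_of_subset_topspace[of W.mtopology "D _"] DW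
    by fastforce
  have "W.mcomplete"
    using W by (simp add: banach_on_def)
  have "\<not> (\<forall>n. W.mtopology interior_of (W.mtopology closure_of D n) = {})"
  proof
    assume "\<forall>n. W.mtopology interior_of (W.mtopology closure_of D n) = {}"
    then have "W.mtopology interior_of \<Union>(range (\<lambda>n. W.mtopology closure_of D n)) = {}"
      by (intro W.metric_Baire_category_alt[OF \<open>W.mcomplete\<close>]) auto
    then have "W.mtopology interior_of W = {}"
      using cover by simp
    then show False
      using interior_of_topspace[of W.mtopology] normed_on_0(1)[OF nW] by simp
  qed
  then obtain n w0 where "w0 \<in> W.mtopology interior_of (W.mtopology closure_of D n)"
    by blast
  then obtain r where r: "r > 0" "W.mball w0 r \<subseteq> W.mtopology closure_of D n" and w0: "w0 \<in> W"
    using W.metric_interior_of[of "W.mtopology closure_of D n"] by blast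
  have approx: "\<exists>d\<in>D n. M (x - d) < \<epsilon>" if "x \<in> W" "M (w0 - x) < r" "\<epsilon> > 0" for x \<epsilon>
  proof -
    have "x \<in> W.mtopology closure_of D n"
      using r that w0 by (auto simp: norm_dist_def)
    then show ?thesis
      using \<open>\<epsilon> > 0\<close> DW[of n] unfolding W.metric_closure_of by (force simp: norm_dist_def)
  qed
  \<comment> \<open>A vector \<open>w\<close> is scaled by r / (2 M w) to length r / 2 and written
    as a difference of two points of the ball. Approximating both from \<open>D n\<close> gives
    preimages of norm at most n each. Scaling the difference back by 2 M w / r yields the factor 4 n
    / r, and the errors r / 8 + r / 8 become M w / 2.\<close>
  define C where "C = 4 * real n / r"
  have C: "C \<ge> 0"
    using r by (simp add: C_def)
  have step: "\<exists>v\<in>V. \<exists>e\<in>E. N v \<le> C * M w \<and> M (w - F v - e) \<le> M w / 2" if w: "w \<in> W" for w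
  proof (cases "w = 0")
    case True
    then show ?thesis
      using normed_on_0[OF nV] normed_on_0[OF nW] cvec.subspace_0[OF E(1)]
        linear_on_0[OF L normed_on_subspace[OF nV]] by force
  next
    case False
    then have Mw: "M w > 0"
      using normed_on_eq_0[OF nW w] normed_on_nonneg[OF nW w] by linarith
    define a where "a = r / (2 * M w)"
    have a: "a > 0" "a * M w = r / 2"
      using r Mw by (simp_all add: a_def)
    let ?x = "complex_of_real a *\<^sub>C w"
    have x: "?x \<in> W" "M ?x = r / 2"
      using w a by (simp_all add: normed_on_scale[OF nW] normed_on_scale_eq[OF nW])
    have "M (w0 - (w0 + ?x)) < r"
      using x r normed_on_minus[OF nW x(1)] by simp
    then obtain d1 where d1: "d1 \<in> D n" "M (w0 + ?x - d1) < r / 8"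
      using approx[of "w0 + ?x" "r/8"] r x w0 by (auto simp: normed_on_add[OF nW])
    obtain d2 where d2: "d2 \<in> D n" "M (w0 - d2) < r / 8"
      using approx[of w0 "r/8"] r w0 normed_on_0[OF nW] by auto
    obtain v1 where v1: "v1 \<in> V" "N v1 \<le> n" "d1 - F v1 \<in> E" "d1 \<in> W"
      using d1(1) by (auto simp: D_def)
    obtain v2 where v2: "v2 \<in> V" "N v2 \<le> n" "d2 - F v2 \<in> E" "d2 \<in> W"
      using d2(1) by (auto simp: D_def)
    define b where "b = complex_of_real (1 / a)"
    define v where "v = b *\<^sub>C (v1 - v2)"
    define e where "e = b *\<^sub>C ((d1 - F v1) - (d2 - F v2))"
    have wx: "w = b *\<^sub>C ?x"
      using a by (simp add: b_def cvec.scale_scale)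
    have vV: "v1 - v2 \<in> V" "v \<in> V"
      using v1 v2 by (simp_all add: v_def normed_on_diff[OF nV] normed_on_scale[OF nV])
    have eE: "e \<in> E"
      unfolding e_def
      by (rule cvec.subspace_scale[OF E(1) cvec.subspace_diff[OF E(1) v1(3) v2(3)]])
    have "F v = b *\<^sub>C (F v1 - F v2)"
      using linear_onD(3)[OF L vV(1)] linear_on_diff[OF L normed_on_subspace[OF nV] v1(1) v2(1)]
      by (simp add: v_def)
    then have eq: "w - F v - e = b *\<^sub>C ((w0 + ?x - d1) - (w0 - d2))"
      by (subst wx) (simp add: e_def cvec.scale_right_diff_distrib cvec.scale_right_distrib)
    have pq: "w0 + ?x - d1 \<in> W" "w0 - d2 \<in> W"
      using w0 x v1 v2 by (simp_all add: normed_on_add[OF nW] normed_on_diff[OF nW])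
    have "M (w - F v - e) = cmod b * M ((w0 + ?x - d1) - (w0 - d2))"
      unfolding eq by (rule normed_on_scale_eq[OF nW normed_on_diff[OF nW pq]])
    also have "\<dots> \<le> cmod b * (M (w0 + ?x - d1) + M (w0 - d2))"
      by (intro mult_left_mono normed_on_triangle_diff[OF nW pq]) simp
    also have "\<dots> \<le> cmod b * (r / 4)"
      using d1 d2 by (intro mult_left_mono) auto
    also have "\<dots> = M w / 2"
      using a r Mw by (simp add: b_def a_def norm_divide field_simps)
    finally have 1: "M (w - F v - e) \<le> M w / 2" .
    have "N v \<le> cmod b * (N v1 + N v2)"
      using normed_on_triangle_diff[OF nV v1(1) v2(1)] vV
      by (simp add: v_def normed_on_scale_eq[OF nV] mult_left_mono)
    also have "\<dots> \<le> cmod b * (2 * real n)"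
      using v1 v2 by (intro mult_left_mono) auto
    also have "\<dots> = C * M w"
      using a r Mw by (simp add: b_def a_def C_def norm_divide field_simps)
    finally have "N v \<le> C * M w" .
    then show ?thesis
      using 1 vV eE by blast
  qed
  have "\<exists>v\<in>V. N v \<le> 2 * C * M w \<and> w - F v \<in> E" if "w \<in> W" for w
    by (rule approximate_surjection[OF V W F E step C that])
  with C show thesis
    by (intro that[of "2 * C"]) auto
qed

section \<open>Finite-dimensional subspaces\<close>

text \<open>\<open>finite_dim\<close> allows spanning vectors outside \<open>D\<close>; a maximal
  independent subset of \<open>D\<close> has at most as many elements as such a spanning
  set.\<close>

lemma finite_dimE:
  assumes "finite_dim D"
  obtains B where "finite B" "B \<subseteq> D" "D \<subseteq> cvec.span B" "cvec.independent B"
proof -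
  obtain B where B: "B \<subseteq> D" "cvec.independent B" "D \<subseteq> cvec.span B"
    using cvec.maximal_independent_subset by blast
  obtain A where "finite A" "D \<subseteq> cvec.span A"
    using assms by (auto simp: finite_dim_def)
  then have "finite B"
    using cvec.independent_span_bound[of A B] B by auto
  with B show thesis using that by blast
qed

lemma closed_subspace_dist_pos:
  fixes V :: "'a::complex_vector set"
  assumes V: "normed_on V N" and R: "closedin (norm_topology V N) R" and b: "b \<in> V" "b \<notin> R"
  obtains \<delta> where "\<delta> > 0" "\<And>r. r \<in> R \<Longrightarrow> \<delta> \<le> N (r - b)"
proof (rule ccontr)
  assume "\<not> thesis"
  with that have *: "\<exists>r\<in>R. N (r - b) < \<delta>" if "\<delta> > 0" for \<delta>
    using that by force
  have "\<forall>k. \<exists>r\<in>R. N (r - b) < 1 / real (Suc k)"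
    using * by simp
  then obtain \<sigma> where \<sigma>: "\<And>k. \<sigma> k \<in> R" "\<And>k. N (\<sigma> k - b) < 1 / real (Suc k)"
    by metis
  have "R \<subseteq> V"
    using R closedin_norm_iff[OF V] by blast
  then have nn: "0 \<le> N (\<sigma> k - b)" for k
    using \<sigma>(1) b by (intro normed_on_nonneg[OF V] normed_on_diff[OF V]) auto
  have "norm_lim N \<sigma> b"
    by (rule tendsto_sandwich[OF _ _ tendsto_const LIMSEQ_inverse_real_of_nat])
      (use nn \<sigma>(2) in \<open>auto simp: inverse_eq_divide intro!: always_eventually less_imp_le\<close>)
  from closedin_normD[OF R V \<sigma>(1) b(1) this] have "b \<in> R" .
  with b show False by simp
qed

text \<open>The distance from \<open>b\<close> to \<open>R\<close> is positive, and r + c b is -c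
  times (-r/c - b). So the coefficient of \<open>b\<close> is bounded by the norm of the vector,
  which makes finite spans closed and their bounded sequences tractable.\<close>

lemma closed_subspace_coefficient_bound:
  fixes V :: "'a::complex_vector set"
  assumes V: "normed_on V N" and R: "closedin (norm_topology V N) R" "cvec.subspace R"
    and b: "b \<in> V" "b \<notin> R"
  obtains \<delta> where "\<delta> > 0" "\<And>r c. r \<in> R \<Longrightarrow> \<delta> * cmod c \<le> N (r + c *\<^sub>C b)"
proof -
  obtain \<delta> where \<delta>: "\<delta> > 0" "\<And>r. r \<in> R \<Longrightarrow> \<delta> \<le> N (r - b)"
    using closed_subspace_dist_pos[OF V R(1) b] by blast
  have RV: "R \<subseteq> V"
    using R(1) closedin_norm_iff[OF V] by blast
  show thesis
  proof (rule that[OF \<delta>(1)])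
    fix r c
    assume r: "r \<in> R"
    have rV: "r \<in> V" using r RV by blast
    show "\<delta> * cmod c \<le> N (r + c *\<^sub>C b)"
    proof (cases "c = 0")
      case True
      then show ?thesis
        using normed_on_nonneg[OF V rV] by simp
    next
      case False
      have s: "(- 1 / c) *\<^sub>C r \<in> R"
        by (rule cvec.subspace_scale[OF R(2) r])
      have eq: "(- c) *\<^sub>C ((- 1 / c) *\<^sub>C r - b) = r + c *\<^sub>C b"
        using False by (simp add: cvec.scale_right_diff_distrib)
      have "N (r + c *\<^sub>C b) = cmod c * N ((- 1 / c) *\<^sub>C r - b)"
        unfolding eq[symmetric] using s RV b
        by (subst normed_on_scale_eq[OF V]) (auto intro: normed_on_diff[OF V])
      moreover have "cmod c * \<delta> \<le> cmod c * N ((- 1 / c) *\<^sub>C r - b)"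
        by (intro mult_left_mono \<delta> s) simp
      ultimately show ?thesis
        by (simp only: mult.commute[of \<delta>])
    qed
  qed
qed

lemma closedin_span_insert:
  fixes V :: "'a::complex_vector set"
  assumes V: "normed_on V N" and R: "closedin (norm_topology V N) R" "cvec.subspace R" and b: "b \<in> V"
  shows "closedin (norm_topology V N) (cvec.span (insert b R))"
proof (cases "b \<in> R")
  case True
  then show ?thesis
    using R by (simp add: insert_absorb cvec.span_eq_iff[THEN iffD2])
next
  case False
  have RV: "R \<subseteq> V"
    using R(1) closedin_norm_iff[OF V] by blast
  obtain \<delta> where \<delta>: "\<delta> > 0" "\<And>r c. r \<in> R \<Longrightarrow> \<delta> * cmod c \<le> N (r + c *\<^sub>C b)"
    using closed_subspace_coefficient_bound[OF V R b False] by blast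
  have mem: "x \<in> cvec.span (insert b R) \<longleftrightarrow> (\<exists>c. x - c *\<^sub>C b \<in> R)" for x
    using R(2) by (simp add: cvec.span_breakdown_eq cvec.span_eq_iff[THEN iffD2])
  show ?thesis
    unfolding closedin_norm_iff[OF V]
  proof (intro conjI allI impI)
    show "cvec.span (insert b R) \<subseteq> V"
      using RV b by (intro cvec.span_minimal normed_on_subspace[OF V]) auto
    fix \<sigma> :: "nat \<Rightarrow> 'a" and l
    assume \<sigma>: "(\<forall>k. \<sigma> k \<in> cvec.span (insert b R)) \<and> l \<in> V \<and> norm_lim N \<sigma> l"
    then obtain c where c: "\<And>k. \<sigma> k - c k *\<^sub>C b \<in> R"
      unfolding mem by metis
    have \<sigma>V: "\<sigma> k \<in> V" for k
      using \<sigma> \<open>cvec.span (insert b R) \<subseteq> V\<close> by blast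
    \<comment> \<open>The coefficient bound transfers the Cauchy property from \<sigma> to its
      coefficients. Subtracting the multiples of \<open>b\<close> then leaves a convergent sequence
      in the closed \<open>R\<close>.\<close>
    have "Cauchy c"
    proof (rule CauchyI)
      fix e :: real
      assume "e > 0"
      then have "\<delta> * e / 2 > 0" using \<delta> by simp
      then obtain K where K: "\<forall>k\<ge>K. N (\<sigma> k - l) < \<delta> * e / 2"
        using \<sigma> \<sigma>V norm_tendsto_iff[OF V, of l \<sigma>] by blast
      have "norm (c i - c j) < e" if "i \<ge> K" "j \<ge> K" for i j
      proof -
        have "\<delta> * cmod (c i - c j) \<le>
            N ((\<sigma> i - c i *\<^sub>C b) - (\<sigma> j - c j *\<^sub>C b) + (c i - c j) *\<^sub>C b)"
          by (intro \<delta> cvec.subspace_diff R c)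
        also have "\<dots> = N (\<sigma> i - \<sigma> j)"
          by (simp add: cvec.scale_left_diff_distrib)
        also have "\<dots> \<le> N (\<sigma> i - l) + N (\<sigma> j - l)"
          using normed_on_triangle_3[OF V, of "\<sigma> i" l "\<sigma> j"]
            normed_on_minus_commute[OF V, of l "\<sigma> j"] \<sigma> \<sigma>V by simp
        also have "\<dots> < \<delta> * e"
          using K[rule_format, OF that(1)] K[rule_format, OF that(2)] by linarith
        finally show ?thesis
          using \<delta> by simp
      qed
      then show "\<exists>K. \<forall>m\<ge>K. \<forall>n\<ge>K. norm (c m - c n) < e" by blast
    qed
    then obtain d where d: "c \<longlonglongrightarrow> d"
      using Cauchy_convergent_iff convergent_def by blast
    have le: "N ((\<sigma> k - c k *\<^sub>C b) - (l - d *\<^sub>C b)) \<le> N (\<sigma> k - l) + cmod (c k - d) * N b" for k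
    proof -
      have eq: "(\<sigma> k - c k *\<^sub>C b) - (l - d *\<^sub>C b) = (\<sigma> k - l) - (c k - d) *\<^sub>C b"
        by (simp add: cvec.scale_left_diff_distrib)
      show ?thesis
        unfolding eq
        using normed_on_triangle_diff[OF V, of "\<sigma> k - l" "(c k - d) *\<^sub>C b"] \<sigma> \<sigma>V b
        by (simp add: normed_on_diff[OF V] normed_on_scale[OF V] normed_on_scale_eq[OF V])
    qed
    have "(\<lambda>k. cmod (c k - d)) \<longlonglongrightarrow> 0"
      using d by (simp add: LIM_zero tendsto_norm_zero)
    from tendsto_add[OF conjunct2[OF conjunct2[OF \<sigma>]] tendsto_mult_left_zero[OF this, of "N b"]]
    have lim: "(\<lambda>k. N (\<sigma> k - l) + cmod (c k - d) * N b) \<longlonglongrightarrow> 0" by simp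
    have lV: "l - d *\<^sub>C b \<in> V"
      using \<sigma> b by (simp add: normed_on_diff[OF V] normed_on_scale[OF V])
    have "(\<lambda>k. N ((\<sigma> k - c k *\<^sub>C b) - (l - d *\<^sub>C b))) \<longlonglongrightarrow> 0"
    proof (rule tendsto_sandwich[OF _ _ tendsto_const lim])
      show "\<forall>\<^sub>F k in sequentially. 0 \<le> N ((\<sigma> k - c k *\<^sub>C b) - (l - d *\<^sub>C b))"
        by (intro always_eventually allI) (use normed_on_nonneg[OF V normed_on_diff[OF V _ lV]] c RV in blast)
    qed (use le in simp)
    then have "l - d *\<^sub>C b \<in> R"
      by (rule closedin_normD[OF R(1) V c lV])
    then show "l \<in> cvec.span (insert b R)"
      unfolding mem by blast
  qed
qed

lemma closedin_zero:
  assumes V: "normed_on V N"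
  shows "closedin (norm_topology V N) {0}"
  unfolding closedin_norm_iff[OF V]
proof (intro conjI allI impI)
  fix \<sigma> l
  assume *: "(\<forall>k. \<sigma> k \<in> {0}) \<and> l \<in> V \<and> norm_lim N \<sigma> l"
  then have "(\<lambda>k. N (\<sigma> k - l)) = (\<lambda>_. N l)"
    using normed_on_minus[OF V, of l] by simp
  with * have "N l = 0"
    by (simp add: LIMSEQ_const_iff)
  then show "l \<in> {0}"
    using * normed_on_eq_0[OF V] by blast
qed (simp add: normed_on_0[OF V])

lemma closedin_span_finite:
  assumes V: "normed_on V N" and B: "finite B" "B \<subseteq> V"
  shows "closedin (norm_topology V N) (cvec.span B)"
  using B
proof (induction B rule: finite_induct)
  case empty
  then show ?case
    using closedin_zero[OF V] by simp
next
  case (insert b B)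
  then have "closedin (norm_topology V N) (cvec.span (insert b (cvec.span B)))"
    by (intro closedin_span_insert[OF V]) auto
  moreover have "cvec.span (insert b (cvec.span B)) = cvec.span (insert b B)"
    by (auto simp: cvec.span_breakdown_eq cvec.span_span)
  ultimately show ?case by simp
qed

text \<open>Bolzano--Weierstrass in finite dimension, by induction on the spanning set: along a
  subsequence the coefficients of \<open>b\<close> converge, and removing the \<open>b\<close>-part
  leaves a sequence in the smaller span that is still bounded and separated.\<close>

lemma span_finite_no_separated_sequence:
  fixes V :: "'a::complex_vector set" and \<sigma> :: "nat \<Rightarrow> 'a"
  assumes V: "normed_on V N" and B: "finite B" "B \<subseteq> V"
    and \<sigma>: "\<And>k. \<sigma> k \<in> cvec.span B" "\<And>k. N (\<sigma> k) \<le> C"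
    and \<eta>: "\<eta> > 0" "\<And>j k. j < k \<Longrightarrow> \<eta> \<le> N (\<sigma> k - \<sigma> j)"
  shows False
  using B \<sigma> \<eta>
proof (induction B arbitrary: \<sigma> C \<eta> rule: finite_induct)
  case empty
  then show ?case
    using empty.prems(5)[of 0 1] normed_on_0[OF V] by simp
next
  case (insert b B)
  have bV: "b \<in> V" and BV: "B \<subseteq> V" using insert.prems by auto
  have SV: "cvec.span B \<subseteq> V"
    using BV by (intro cvec.span_minimal normed_on_subspace[OF V])
  show ?case
  proof (cases "b \<in> cvec.span B")
    case True
    then have "\<sigma> k \<in> cvec.span B" for k
      using insert.prems(2) by (simp add: cvec.span_redundant)
    then show ?thesis
      by (rule insert.IH[OF BV _ insert.prems(3-5)])
  next
    case False
    obtain \<delta> where \<delta>: "\<delta> > 0" "\<And>r c. r \<in> cvec.span B \<Longrightarrow> \<delta> * cmod c \<le> N (r + c *\<^sub>C b)"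
      using closed_subspace_coefficient_bound[OF V closedin_span_finite[OF V insert.hyps(1) BV]
          cvec.subspace_span bV False] by blast
    obtain c where c: "\<And>k. \<sigma> k - c k *\<^sub>C b \<in> cvec.span B"
      using insert.prems(2) unfolding cvec.span_breakdown_eq by metis
    have cb: "cmod (c k) \<le> C / \<delta>" for k
      using \<delta>(2)[OF c[of k], of "c k"] insert.prems(3)[of k] \<delta>(1) by (simp add: field_simps)
    then have "bounded (range c)"
      by (auto simp: bounded_iff)
    then obtain d \<rho> where \<rho>: "strict_mono \<rho>" "(c \<circ> \<rho>) \<longlonglongrightarrow> d"
      using bounded_imp_convergent_subsequence by blast
    have Nb: "N b \<ge> 0" by (rule normed_on_nonneg[OF V bV])
    \<comment> \<open>Coefficients that differ by less than \<epsilon> cost at most half of the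
      separation \<eta> when the \<open>b\<close>-part is removed.\<close>
    define \<epsilon> where "\<epsilon> = \<eta> / 2 / (N b + 1)"
    have \<epsilon>: "\<epsilon> > 0" "\<epsilon> * N b \<le> \<eta> / 2"
      using insert.prems(4) Nb by (auto simp: \<epsilon>_def field_simps)
    obtain K where K: "\<forall>i\<ge>K. \<forall>j\<ge>K. cmod ((c \<circ> \<rho>) i - (c \<circ> \<rho>) j) < \<epsilon>"
      using CauchyD[OF LIMSEQ_imp_Cauchy[OF \<rho>(2)] \<epsilon>(1)] by blast
    define s where "s k = \<rho> (K + k)" for k
    define \<tau> where "\<tau> k = \<sigma> (s k) - c (s k) *\<^sub>C b" for k
    have \<tau>: "\<tau> k \<in> cvec.span B" for k
      by (simp add: \<tau>_def c)
    have \<sigma>V: "\<sigma> k \<in> V" for k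
      using insert.prems cvec.span_minimal[OF insert.prems(1) normed_on_subspace[OF V]] by blast
    show ?thesis
    proof (rule insert.IH[OF BV \<tau>])
      show "N (\<tau> k) \<le> C + C / \<delta> * N b" for k
      proof -
        have "N (\<tau> k) \<le> N (\<sigma> (s k)) + cmod (c (s k)) * N b"
          using normed_on_triangle_diff[OF V \<sigma>V, of "c (s k) *\<^sub>C b"] bV
          by (simp add: \<tau>_def normed_on_scale[OF V] normed_on_scale_eq[OF V])
        also have "\<dots> \<le> C + C / \<delta> * N b"
          using insert.prems(3) cb Nb by (intro add_mono mult_right_mono)
        finally show ?thesis .
      qed
      show "\<eta> / 2 > 0" using insert.prems(4) by simp
      show "\<eta> / 2 \<le> N (\<tau> k - \<tau> j)" if "j < k" for j k
      proof -
        have "cmod (c (s k) - c (s j)) \<le> \<epsilon>"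
          using K[rule_format, of "K + k" "K + j"] by (simp add: s_def)
        then have 1: "cmod (c (s k) - c (s j)) * N b \<le> \<eta> / 2"
          using \<epsilon>(2) mult_right_mono[OF _ Nb] by fastforce
        have \<tau>V: "\<tau> k \<in> V" for k using \<tau> SV by blast
        have eq: "\<sigma> (s k) - \<sigma> (s j) = (\<tau> k - \<tau> j) + (c (s k) - c (s j)) *\<^sub>C b"
          by (simp add: \<tau>_def cvec.scale_left_diff_distrib)
        have "N (\<sigma> (s k) - \<sigma> (s j)) \<le> N (\<tau> k - \<tau> j) + cmod (c (s k) - c (s j)) * N b"
          unfolding eq using normed_on_triangle[OF V normed_on_diff[OF V \<tau>V \<tau>V]
              normed_on_scale[OF V bV]] by (simp add: normed_on_scale_eq[OF V bV])
        moreover have "s j < s k"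
          using strict_monoD[OF \<rho>(1)] that by (simp add: s_def)
        ultimately show ?thesis
          using insert.prems(5)[of "s j" "s k"] 1 by linarith
      qed
    qed
  qed
qed

section \<open>The Hahn--Banach theorem\<close>

text \<open>Homogeneity is demanded as an inequality only, which passes easily to infima; equality
  follows by applying it to the inverse factor.\<close>

definition sublinear :: "('a::real_vector \<Rightarrow> real) \<Rightarrow> bool"
  where "sublinear p \<longleftrightarrow> (\<forall>x y. p (x + y) \<le> p x + p y) \<and> (\<forall>r\<ge>0. \<forall>x. p (r *\<^sub>R x) \<le> r * p x)"

lemma sublinear_add: "sublinear p \<Longrightarrow> p (x + y) \<le> p x + p y"
  by (simp add: sublinear_def)

lemma sublinear_scale_le: "sublinear p \<Longrightarrow> r \<ge> 0 \<Longrightarrow> p (r *\<^sub>R x) \<le> r * p x"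
  by (simp add: sublinear_def)

lemma sublinear_0: "sublinear p \<Longrightarrow> p 0 = 0"
  using sublinear_add[of p 0 0] sublinear_scale_le[of p 0 0] by simp

lemma sublinear_scale:
  assumes p: "sublinear p" and r: "r \<ge> 0"
  shows "p (r *\<^sub>R x) = r * p x"
proof (cases "r = 0")
  case False
  have "p x \<le> inverse r * p (r *\<^sub>R x)"
    using sublinear_scale_le[OF p, of "inverse r" "r *\<^sub>R x"] r False by simp
  then have "r * p x \<le> p (r *\<^sub>R x)"
    using r False by (simp add: field_simps)
  with sublinear_scale_le[OF p r, of x] show ?thesis by simp
qed (simp add: sublinear_0[OF p])

lemma sublinear_minus_ge: "sublinear p \<Longrightarrow> - p (- x) \<le> p x"
  using sublinear_add[of p x "- x"] sublinear_0[of p] by simp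

text \<open>Taking the infimum of p (x + t y) - t p y over t >= 0 lowers \<open>p\<close> along the
  ray of \<open>y\<close>; at -y the choice t = 1 gives the value -p y. A minimal functional cannot
  be lowered, so it turns out to be odd.\<close>

lemma sublinear_decrease:
  assumes p: "sublinear p"
  obtains q where "sublinear q" "\<And>x. q x \<le> p x" "q (- y) \<le> - p y"
proof -
  define S where "S x = (\<lambda>t. p (x + t *\<^sub>R y) - t * p y) ` {0..}" for x
  define q where "q x = Inf (S x)" for x
  have "- p (- x) \<le> p (x + t *\<^sub>R y) - t * p y" if "t \<ge> 0" for x t
    using sublinear_add[OF p, of "x + t *\<^sub>R y" "- x"] sublinear_scale[OF p that, of y] by simp
  then have bdd: "bdd_below (S x)" for x
    unfolding S_def by (intro bdd_belowI[of _ "- p (- x)"]) auto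
  have q_le: "q x \<le> p (x + t *\<^sub>R y) - t * p y" if "t \<ge> 0" for x t
    unfolding q_def using that by (intro cInf_lower bdd) (auto simp: S_def)
  have q_ge: "a \<le> q x" if "\<And>t. t \<ge> 0 \<Longrightarrow> a \<le> p (x + t *\<^sub>R y) - t * p y" for a x
    unfolding q_def using that by (intro cInf_greatest) (auto simp: S_def)
  have le: "q x \<le> p x" for x
    using q_le[of 0 x] by simp
  have "sublinear q"
    unfolding sublinear_def
  proof (intro conjI allI impI)
    fix x z
    have "q (x + z) - q z \<le> q x"
    proof (rule q_ge)
      fix t :: real assume t: "t \<ge> 0"
      have "q (x + z) - (p (x + t *\<^sub>R y) - t * p y) \<le> q z"
      proof (rule q_ge)
        fix s :: real assume s: "s \<ge> 0"
        have "q (x + z) \<le> p (x + z + (t + s) *\<^sub>R y) - (t + s) * p y"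
          using s t by (intro q_le) simp
        also have "x + z + (t + s) *\<^sub>R y = (x + t *\<^sub>R y) + (z + s *\<^sub>R y)"
          by (simp add: scaleR_add_left)
        also have "p \<dots> \<le> p (x + t *\<^sub>R y) + p (z + s *\<^sub>R y)"
          by (rule sublinear_add[OF p])
        finally show "q (x + z) - (p (x + t *\<^sub>R y) - t * p y) \<le> p (z + s *\<^sub>R y) - s * p y"
          by (simp add: algebra_simps)
      qed
      then show "q (x + z) - q z \<le> p (x + t *\<^sub>R y) - t * p y" by simp
    qed
    then show "q (x + z) \<le> q x + q z" by simp
  next
    fix r :: real and x
    assume r: "r \<ge> 0"
    show "q (r *\<^sub>R x) \<le> r * q x"
    proof (cases "r = 0")
      case True
      then show ?thesis
        using le[of 0] sublinear_0[OF p] by simp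
    next
      case False
      have "q (r *\<^sub>R x) / r \<le> q x"
      proof (rule q_ge)
        fix t :: real assume t: "t \<ge> 0"
        have "q (r *\<^sub>R x) \<le> p (r *\<^sub>R x + (r * t) *\<^sub>R y) - (r * t) * p y"
          using r t by (intro q_le) simp
        also have "r *\<^sub>R x + (r * t) *\<^sub>R y = r *\<^sub>R (x + t *\<^sub>R y)"
          by (simp add: scaleR_add_right)
        also have "p \<dots> = r * p (x + t *\<^sub>R y)"
          by (rule sublinear_scale[OF p r])
        finally show "q (r *\<^sub>R x) / r \<le> p (x + t *\<^sub>R y) - t * p y"
          using r False by (simp add: field_simps)
      qed
      then show ?thesis
        using r False by (simp add: field_simps)
    qed
  qed
  moreover have "q (- y) \<le> - p y"
    using q_le[of 1 "- y"] sublinear_0[OF p] by simp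
  ultimately show thesis
    using le that by blast
qed

lemma sublinear_minimal_below:
  assumes p: "sublinear p"
  obtains m where "sublinear m" "m \<le> p" "\<And>q. sublinear q \<Longrightarrow> q \<le> m \<Longrightarrow> q = m"
proof -
  define A where "A = {q. sublinear q \<and> q \<le> p}"
  \<comment> \<open>Zorn's lemma for the reversed pointwise order: a chain is bounded by its
    pointwise infimum.\<close>
  have "\<exists>m\<in>A. \<forall>a\<in>A. a \<le> m \<longrightarrow> a = m"
  proof (rule predicate_Zorn[where P = "\<lambda>a b. b \<le> a"])
    show "partial_order_on A (relation_of (\<lambda>a b. b \<le> a) A)"
      by (rule partial_order_on_relation_ofI) auto
    fix C
    assume "C \<in> Chains (relation_of (\<lambda>a b. b \<le> a) A)"
    then have C: "C \<subseteq> A" "\<And>a b. a \<in> C \<Longrightarrow> b \<in> C \<Longrightarrow> a \<le> b \<or> b \<le> a"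
      by (auto simp: Chains_def relation_of_def)
    show "\<exists>u\<in>A. \<forall>a\<in>C. u \<le> a"
    proof (cases "C = {}")
      case True
      then show ?thesis
        using p by (auto simp: A_def)
    next
      case False
      define u where "u x = (INF q\<in>C. q x)" for x
      \<comment> \<open>A lower bound common to the whole chain, so that the infimum is
        finite.\<close>
      have "- p (- x) \<le> q x" if "q \<in> C" for q x
      proof -
        have "q (- x) \<le> p (- x)" "- q (- x) \<le> q x"
          using that C(1) sublinear_minus_ge[of q x] by (auto simp: A_def le_fun_def)
        then show ?thesis by linarith
      qed
      then have bdd: "bdd_below ((\<lambda>q. q x) ` C)" for x
        by (intro bdd_belowI[of _ "- p (- x)"]) auto
      have u_le: "u x \<le> q x" if "q \<in> C" for q x
        unfolding u_def using that by (intro cINF_lower bdd)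
      have u_ge: "a \<le> u x" if "\<And>q. q \<in> C \<Longrightarrow> a \<le> q x" for a x
        unfolding u_def using that by (intro cINF_greatest False)
      have sub: "sublinear q" if "q \<in> C" for q
        using that C(1) by (auto simp: A_def)
      have "sublinear u"
        unfolding sublinear_def
      proof (intro conjI allI impI)
        fix x y
        have "u (x + y) - u y \<le> u x"
        proof (rule u_ge)
          fix q1 assume q1: "q1 \<in> C"
          have "u (x + y) - q1 x \<le> u y"
          proof (rule u_ge)
            fix q2 assume q2: "q2 \<in> C"
            \<comment> \<open>Two members of the chain are comparable, so the smaller one serves
              both points.\<close>
            obtain q where q: "q \<in> C" "q \<le> q1" "q \<le> q2"
              using C(2)[OF q1 q2] q1 q2 by auto
            then have "u (x + y) \<le> q1 x + q2 y"
              using u_le[of q "x + y"] sublinear_add[OF sub[of q], of x y]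
                le_funD[of q q1 x] le_funD[of q q2 y] by linarith
            then show "u (x + y) - q1 x \<le> q2 y" by simp
          qed
          then show "u (x + y) - u y \<le> q1 x" by simp
        qed
        then show "u (x + y) \<le> u x + u y" by simp
      next
        fix r :: real and x
        assume r: "r \<ge> 0"
        show "u (r *\<^sub>R x) \<le> r * u x"
        proof (cases "r = 0")
          case True
          obtain q where "q \<in> C" using False by blast
          then show ?thesis
            using u_le[of q 0] sublinear_0[OF sub[of q]] True by simp
        next
          case rn: False
          have "u (r *\<^sub>R x) / r \<le> u x"
          proof (rule u_ge)
            fix q assume q: "q \<in> C"
            show "u (r *\<^sub>R x) / r \<le> q x"
              using u_le[OF q, of "r *\<^sub>R x"] sublinear_scale_le[OF sub[OF q] r, of x] r rn
              by (simp add: field_simps)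
          qed
          then show ?thesis
            using r rn by (simp add: field_simps)
        qed
      qed
      moreover have "u \<le> p"
      proof (rule le_funI)
        fix x
        obtain q where q: "q \<in> C" using False by blast
        then have "q x \<le> p x"
          using C(1) by (auto simp: A_def le_fun_def)
        with u_le[OF q] show "u x \<le> p x" by (rule order_trans)
      qed
      ultimately show ?thesis
        using u_le by (auto simp: A_def le_fun_def)
    qed
  qed
  then obtain m where "m \<in> A" "\<And>a. a \<in> A \<Longrightarrow> a \<le> m \<Longrightarrow> a = m" by blast
  then show thesis
    by (intro that[of m]) (auto simp: A_def intro: order_trans)
qed

text \<open>Linear functionals are exactly the minimal sublinear ones.\<close>

theorem Hahn_Banach_sublinear:
  assumes p: "sublinear p"
  obtains f where "linear f" "\<And>x. f x \<le> p x" "f y = p y"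
proof -
  \<comment> \<open>Lowering along \<open>y\<close> before minimising forces f (-y) <= -p y, and for
    a linear \<open>f\<close> below \<open>p\<close> this means that \<open>f\<close> attains
    \<open>p\<close> at \<open>y\<close>.\<close>
  obtain q where q: "sublinear q" "\<And>x. q x \<le> p x" "q (- y) \<le> - p y"
    using sublinear_decrease[OF p] by blast
  obtain f where f: "sublinear f" "f \<le> q" "\<And>g. sublinear g \<Longrightarrow> g \<le> f \<Longrightarrow> g = f"
    using sublinear_minimal_below[OF q(1)] by blast
  \<comment> \<open>Minimality identifies \<open>f\<close> with its own lowering along
    \<open>x\<close>.\<close>
  have odd: "f (- x) = - f x" for x
  proof -
    obtain g where g: "sublinear g" "\<And>z. g z \<le> f z" "g (- x) \<le> - f x"
      using sublinear_decrease[OF f(1)] by blast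
    have "g = f"
      by (rule f(3)) (use g in \<open>auto simp: le_fun_def\<close>)
    then show ?thesis
      using g(3) sublinear_minus_ge[OF f(1), of x] by simp
  qed
  have add: "f (x + z) = f x + f z" for x z
    using sublinear_add[OF f(1), of x z] sublinear_add[OF f(1), of "x + z" "- z"] odd[of z] by simp
  have scale: "f (r *\<^sub>R x) = r * f x" for r x
  proof (cases "r \<ge> 0")
    case False
    then have "f (- (r *\<^sub>R x)) = - r * f x"
      using sublinear_scale[OF f(1), of "- r" x] by simp
    then show ?thesis by (simp add: odd)
  qed (rule sublinear_scale[OF f(1)])
  show thesis
  proof (rule that)
    show "linear f"
      by (rule linearI) (simp_all add: add scale)
    show le: "f x \<le> p x" for x
      using f(2) q(2)[of x] by (meson le_funD order_trans)
    have "f (- y) \<le> - p y"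
      using f(2) q(3) by (meson le_funD order_trans)
    with le[of y] show "f y = p y"
      by (simp add: odd)
  qed
qed

theorem Hahn_Banach_seminorm:
  fixes p :: "'a::complex_vector \<Rightarrow> real"
  assumes add: "\<And>x z. p (x + z) \<le> p x + p z" and scale: "\<And>c x. p (c *\<^sub>C x) \<le> cmod c * p x"
  obtains f where "\<And>x z. f (x + z) = f x + f z" "\<And>c x. f (c *\<^sub>C x) = c * f x"
    "\<And>x. cmod (f x) \<le> p x" "p y \<le> cmod (f y)"
proof -
  have sc: "r *\<^sub>R x = complex_of_real r *\<^sub>C x" for r and x :: 'a
    by (simp add: scaleC_of_real)
  have "p (r *\<^sub>R x) \<le> r * p x" if "r \<ge> 0" for r x
    using scale[of "complex_of_real r" x] that by (simp add: sc)
  then have "sublinear p"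
    by (simp add: sublinear_def add)
  then obtain g where g: "linear g" "\<And>x. g x \<le> p x" "g y = p y"
    using Hahn_Banach_sublinear by blast
  have p0: "p x \<ge> 0" for x
    using add[of x "- x"] scale[of "- 1" x] scale[of 2 0] add[of 0 0] scale[of 0 0]
    by (simp add: cvec_scale_minus1)
  \<comment> \<open>The complex-linear functional with real part \<open>g\<close>, namely g x - i
    g(i x).\<close>
  define f where "f x = Complex (g x) (- g (\<i> *\<^sub>C x))" for x
  have f_add: "f (x + z) = f x + f z" for x z
    by (simp add: f_def complex_eq_iff linear_add[OF g(1)] scaleC_add_right)
  have f_scale: "f (c *\<^sub>C x) = c * f x" for c x
  proof -
    have 1: "c *\<^sub>C x = Re c *\<^sub>R x + Im c *\<^sub>R (\<i> *\<^sub>C x)"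
      unfolding sc cvec.scale_scale cvec.scale_left_distrib[symmetric]
      by (subst complex_eq[of c]) (simp add: mult.commute)
    have 2: "\<i> *\<^sub>C (c *\<^sub>C x) = Re c *\<^sub>R (\<i> *\<^sub>C x) + (- Im c) *\<^sub>R x"
      unfolding sc cvec.scale_scale cvec.scale_left_distrib[symmetric]
      by (rule arg_cong[of _ _ "\<lambda>c. c *\<^sub>C x"]) (simp add: complex_eq_iff)
    show ?thesis
      unfolding f_def 2 unfolding 1
      by (simp add: complex_eq_iff linear_add[OF g(1)] linear_scale[OF g(1)] linear_diff[OF g(1)])
  qed
  have f_le: "cmod (f x) \<le> p x" for x
  proof (cases "f x = 0")
    case True
    then show ?thesis by (simp add: p0)
  next
    case False
    \<comment> \<open>Rotates \<open>f x\<close> onto the positive real axis, where \<open>f\<close>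
      agrees with its real part \<open>g\<close> and the real bound applies.\<close>
    define u where "u = cnj (f x) / complex_of_real (cmod (f x))"
    have "cmod u = 1"
      using False by (simp add: u_def norm_divide)
    have "f (u *\<^sub>C x) = complex_of_real (cmod (f x))"
      using False complex_norm_square[of "f x"]
      by (simp add: f_scale u_def field_simps power2_eq_square)
    then have "cmod (f x) = g (u *\<^sub>C x)"
      by (simp add: f_def complex_eq_iff)
    also have "\<dots> \<le> p (u *\<^sub>C x)"
      by (rule g)
    also have "\<dots> \<le> p x"
      using scale[of u x] \<open>cmod u = 1\<close> by simp
    finally show ?thesis .
  qed
  have "p y \<le> cmod (f y)"
    using g(3) abs_Re_le_cmod[of "f y"] by (simp add: f_def)
  with f_add f_scale f_le show thesis
    using that by blast
qed

section \<open>Complex-linear operators\<close>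

lemma scaleC_blinfun_apply [simp]:
  "blinfun_apply (c *\<^sub>C (f :: 'a::real_normed_vector \<Rightarrow>\<^sub>L 'b::complex_normed_vector)) x = c *\<^sub>C f x"
  by (simp add: scaleC_blinfun.rep_eq)

lemma rank_one_apply [simp]: "blinfun_apply (rank_one x f) y = f y *\<^sub>C x"
  by (simp add: rank_one.rep_eq)

lemma complex_opsD: "A \<in> complex_ops \<Longrightarrow> blinfun_apply A (c *\<^sub>C x) = c *\<^sub>C A x"
  by (simp add: complex_ops_def)

lemma complex_ops_zero [simp]: "0 \<in> complex_ops"
  by (simp add: complex_ops_def)

lemma complex_ops_id [simp]: "id_blinfun \<in> complex_ops"
  by (simp add: complex_ops_def)

lemma complex_ops_add: "A \<in> complex_ops \<Longrightarrow> B \<in> complex_ops \<Longrightarrow> A + B \<in> complex_ops"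
  by (simp add: complex_ops_def blinfun.add_left scaleC_add_right)

lemma complex_ops_diff: "A \<in> complex_ops \<Longrightarrow> B \<in> complex_ops \<Longrightarrow> A - B \<in> complex_ops"
  by (simp add: complex_ops_def blinfun.diff_left cvec.scale_right_diff_distrib)

lemma complex_ops_scale: "A \<in> complex_ops \<Longrightarrow> c *\<^sub>C A \<in> complex_ops"
  by (simp add: complex_ops_def mult.commute)

lemma complex_ops_compose: "A \<in> complex_ops \<Longrightarrow> B \<in> complex_ops \<Longrightarrow> A o\<^sub>L B \<in> complex_ops"
  by (simp add: complex_ops_def)

lemma complex_ops_rank_one: "f \<in> complex_ops \<Longrightarrow> rank_one x f \<in> complex_ops"
  by (simp add: complex_ops_def scaleC_complex_def)

lemma complex_ops_sum: "(\<And>i. i \<in> I \<Longrightarrow> f i \<in> complex_ops) \<Longrightarrow> sum f I \<in> complex_ops"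
  by (induction I rule: infinite_finite_induct) (auto intro: complex_ops_add)

lemma norm_scaleC_blinfun_le:
  fixes f :: "'a::real_normed_vector \<Rightarrow>\<^sub>L 'b::complex_normed_vector"
  shows "norm (c *\<^sub>C f) \<le> cmod c * norm f"
proof (rule norm_blinfun_bound)
  fix x
  have "cmod c * norm (f x) \<le> cmod c * (norm f * norm x)"
    by (intro mult_left_mono norm_blinfun) simp
  then show "norm ((c *\<^sub>C f) x) \<le> cmod c * norm f * norm x"
    by (simp add: norm_scaleC mult.assoc)
qed simp

lemma complex_opE:
  fixes f :: "'a::complex_normed_vector \<Rightarrow> 'b::complex_normed_vector"
  assumes "\<And>x z. f (x + z) = f x + f z" "\<And>c x. f (c *\<^sub>C x) = c *\<^sub>C f x"
    and "\<And>x. norm (f x) \<le> K * norm x" "K \<ge> 0"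
  obtains A where "A \<in> complex_ops" "\<And>x. blinfun_apply A x = f x" "norm A \<le> K"
proof -
  have "bounded_linear f"
    using assms(2)[of "complex_of_real _"] assms(1,3)
    by (intro bounded_linear_intro[where K = K]) (simp_all add: scaleC_of_real mult.commute)
  then have A: "blinfun_apply (Blinfun f) = f"
    by (rule bounded_linear_Blinfun_apply)
  show thesis
    using assms by (intro that[of "Blinfun f"] norm_blinfun_bound) (simp_all add: complex_ops_def A)
qed

text \<open>The functional is dominated by the infimal convolution of the norm with the seminorm that
  \<open>F\<close> transports from \<open>V\<close>.\<close>

lemma separating_functional:
  fixes F :: "'v::complex_vector \<Rightarrow> 'a::complex_normed_vector"
  assumes V: "normed_on V N" and F: "linear_on V UNIV F" and E: "cvec.subspace E" and \<delta>: "\<delta> \<ge> 0"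
    and y: "\<And>v e. v \<in> V \<Longrightarrow> e \<in> E \<Longrightarrow> \<kappa> \<le> \<delta> * N v + norm (y - F v - e)"
  obtains f :: "'a \<Rightarrow>\<^sub>L complex" where "f \<in> complex_ops" "norm f \<le> 1" "\<kappa> \<le> cmod (f y)"
    "\<And>v. v \<in> V \<Longrightarrow> cmod (f (F v)) \<le> \<delta> * N v" "\<And>e. e \<in> E \<Longrightarrow> f e = 0"
proof -
  note F0 = linear_on_0[OF F normed_on_subspace[OF V]] and E0 = cvec.subspace_0[OF E]
  define p where "p x = (INF (v, e)\<in>V \<times> E. \<delta> * N v + norm (x - F v - e))" for x
  have bdd: "bdd_below ((\<lambda>(v, e). \<delta> * N v + norm (x - F v - e)) ` (V \<times> E))" for x
    using \<delta> normed_on_nonneg[OF V] by (intro bdd_belowI[of _ 0]) auto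
  have p_le: "p x \<le> \<delta> * N v + norm (x - F v - e)" if "v \<in> V" "e \<in> E" for x v e
    unfolding p_def using cINF_lower[OF bdd, of "(v, e)"] that by simp
  have p_ge: "a \<le> p x" if "\<And>v e. v \<in> V \<Longrightarrow> e \<in> E \<Longrightarrow> a \<le> \<delta> * N v + norm (x - F v - e)" for a x
    unfolding p_def using that normed_on_0(1)[OF V] E0 by (intro cINF_greatest) auto
  have p_add: "p (x + w) \<le> p x + p w" for x w
  proof -
    have "p (x + w) - p w \<le> p x"
    proof (rule p_ge)
      fix v e assume v: "v \<in> V" "e \<in> E"
      have "p (x + w) - (\<delta> * N v + norm (x - F v - e)) \<le> p w"
      proof (rule p_ge)
        fix u d assume u: "u \<in> V" "d \<in> E"
        have "p (x + w) \<le> \<delta> * N (v + u) + norm (x + w - F (v + u) - (e + d))"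
          by (intro p_le normed_on_add[OF V] cvec.subspace_add[OF E] v u)
        moreover have "norm (x + w - F (v + u) - (e + d)) \<le> norm (x - F v - e) + norm (w - F u - d)"
          using norm_triangle_ineq[of "x - F v - e" "w - F u - d"] linear_onD(2)[OF F v(1) u(1)]
          by (simp add: algebra_simps)
        moreover have "\<delta> * N (v + u) \<le> \<delta> * N v + \<delta> * N u"
          using mult_left_mono[OF normed_on_triangle[OF V v(1) u(1)] \<delta>] by (simp add: distrib_left)
        ultimately show "p (x + w) - (\<delta> * N v + norm (x - F v - e)) \<le> \<delta> * N u + norm (w - F u - d)"
          by linarith
      qed
      then show "p (x + w) - p w \<le> \<delta> * N v + norm (x - F v - e)" by simp
    qed
    then show ?thesis by simp
  qed
  have p_le_norm: "p x \<le> norm x" for x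
    using p_le[OF normed_on_0(1)[OF V] E0, of x] F0 normed_on_0(2)[OF V] by simp
  have p_scale: "p (c *\<^sub>C x) \<le> cmod c * p x" for c x
  proof (cases "c = 0")
    case True
    then show ?thesis
      using p_le_norm[of 0] by simp
  next
    case False
    have "p (c *\<^sub>C x) / cmod c \<le> p x"
    proof (rule p_ge)
      fix v e assume v: "v \<in> V" "e \<in> E"
      have "p (c *\<^sub>C x) \<le> \<delta> * N (c *\<^sub>C v) + norm (c *\<^sub>C x - F (c *\<^sub>C v) - c *\<^sub>C e)"
        by (intro p_le normed_on_scale[OF V] cvec.subspace_scale[OF E] v)
      also have "\<dots> = cmod c * (\<delta> * N v + norm (x - F v - e))"
        using v by (simp add: norm_scaleC distrib_left normed_on_scale_eq[OF V] linear_onD(3)[OF F]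
            flip: cvec.scale_right_diff_distrib)
      finally show "p (c *\<^sub>C x) / cmod c \<le> \<delta> * N v + norm (x - F v - e)"
        using False by (simp add: field_simps)
    qed
    then show ?thesis
      using False by (simp add: field_simps)
  qed
  obtain f where f: "\<And>x z. f (x + z) = f x + f z" "\<And>c x. f (c *\<^sub>C x) = c * f x"
      "\<And>x. cmod (f x) \<le> p x" "p y \<le> cmod (f y)"
    using Hahn_Banach_seminorm[OF p_add p_scale] by blast
  have "cmod (f x) \<le> 1 * norm x" for x
    using f(3)[of x] p_le_norm[of x] by simp
  then obtain A where A: "A \<in> complex_ops" "\<And>x. blinfun_apply A x = f x" "norm A \<le> 1"
    using complex_opE[of f 1] f(1,2) by (auto simp: scaleC_complex_def)
  show thesis
  proof (rule that[OF A(1,3)])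
    show "\<kappa> \<le> cmod (A y)"
      using f(4) p_ge[of \<kappa> y] y by (simp add: A(2))
    show "cmod (A (F v)) \<le> \<delta> * N v" if "v \<in> V" for v
      using f(3)[of "F v"] p_le[OF that E0, of "F v"] by (simp add: A(2))
    show "A e = 0" if "e \<in> E" for e
    proof -
      have "p e \<le> 0"
        using p_le[OF normed_on_0(1)[OF V] that, of e] F0 normed_on_0(2)[OF V] by simp
      with f(3)[of e] have "cmod (f e) \<le> 0" by (rule order_trans)
      then show ?thesis by (simp add: A(2))
    qed
  qed
qed

text \<open>The case F = 0, \<delta> = 0 of the preceding lemma, with an arbitrary normed carrier as
  domain.\<close>

lemma separating_functional_norm:
  fixes y :: "'a::complex_normed_vector"
  assumes E: "cvec.subspace E" and y: "\<And>e. e \<in> E \<Longrightarrow> \<kappa> \<le> norm (y - e)"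
  obtains f :: "'a \<Rightarrow>\<^sub>L complex" where "f \<in> complex_ops" "norm f \<le> 1" "\<kappa> \<le> cmod (f y)"
    "\<And>e. e \<in> E \<Longrightarrow> f e = 0"
  using separating_functional[of "UNIV :: complex set" norm "\<lambda>_. 0" E 0 \<kappa> y]
    banach_on_normed[OF banach_on_UNIV] E y that by (auto simp: linear_on_def)

lemma norming_functional:
  fixes x :: "'a::complex_normed_vector"
  obtains f :: "'a \<Rightarrow>\<^sub>L complex" where "f \<in> complex_ops" "norm f \<le> 1" "blinfun_apply f x = complex_of_real (norm x)"
proof (cases "x = 0")
  case True
  then show thesis
    by (intro that[of 0]) simp_all
next
  case False
  obtain f where f: "f \<in> complex_ops" "norm f \<le> 1" "norm x \<le> cmod (blinfun_apply f x)"
    using separating_functional_norm[of "{0}" "norm x" x] by auto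
  \<comment> \<open>Rotates and shrinks the value \<open>f x\<close> to norm x. The factor has
    modulus at most 1 because \<open>cmod (f x)\<close> is at least norm x.\<close>
  define c where "c = complex_of_real (norm x) / f x"
  have fx: "f x \<noteq> 0" "cmod c \<le> 1"
    using f(3) False by (auto simp: c_def norm_divide divide_le_eq_1)
  show thesis
  proof (rule that[of "c *\<^sub>C f"])
    show "c *\<^sub>C f \<in> complex_ops"
      by (rule complex_ops_scale[OF f(1)])
    have "norm (c *\<^sub>C f) \<le> cmod c * norm f"
      by (rule norm_scaleC_blinfun_le)
    also have "\<dots> \<le> 1"
      using fx f(2) by (intro mult_le_one) auto
    finally show "norm (c *\<^sub>C f) \<le> 1" .
    show "(c *\<^sub>C f) x = complex_of_real (norm x)"
      using fx by (simp add: scaleC_complex_def c_def)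
  qed
qed

lemma functional_vanishing_on_closed:
  fixes R :: "'a::complex_normed_vector set"
  assumes R: "closed R" "cvec.subspace R" and b: "b \<notin> R"
  obtains f :: "'a \<Rightarrow>\<^sub>L complex"
  where "f \<in> complex_ops" "\<And>r. r \<in> R \<Longrightarrow> blinfun_apply f r = 0" "blinfun_apply f b = 1"
proof -
  obtain \<delta> where \<delta>: "\<delta> > 0" "\<And>r. r \<in> R \<Longrightarrow> \<delta> \<le> dist b r"
  proof -
    obtain \<delta> where "\<delta> > 0" "ball b \<delta> \<subseteq> - R"
      using R(1) b by (metis ComplI closed_def openE)
    then show thesis
      using that[of \<delta>] by (force simp: subset_iff not_le)
  qed
  obtain f :: "'a \<Rightarrow>\<^sub>L complex" where f: "f \<in> complex_ops" "\<delta> \<le> cmod (f b)" "\<And>r. r \<in> R \<Longrightarrow> f r = 0"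
    using separating_functional_norm[OF R(2) \<delta>(2)[unfolded dist_norm]] by blast
  show thesis
  proof (rule that[of "inverse (f b) *\<^sub>C f"])
    show "inverse (f b) *\<^sub>C f \<in> complex_ops"
      by (rule complex_ops_scale[OF f(1)])
    have "f b \<noteq> 0"
      using f(2) \<delta>(1) by auto
    then show "(inverse (f b) *\<^sub>C f) b = 1"
      by (simp add: scaleC_complex_def)
    show "(inverse (f b) *\<^sub>C f) r = 0" if "r \<in> R" for r
      using f(3) that by simp
  qed
qed

lemma closed_span_finite:
  fixes B :: "'a::complex_banach set"
  assumes "finite B"
  shows "closed (cvec.span B)"
  using closedin_span_finite[OF banach_on_normed[OF banach_on_UNIV] assms]
  by (simp add: closedin_norm_topology_UNIV)

text \<open>Each \<open>b\<close> lies outside the closed span of the other vectors, so Hahn--Banach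
  yields a functional that is 1 at \<open>b\<close> and 0 at the others: a biorthogonal system of
  bounded functionals.\<close>

lemma finite_span_coordinates:
  fixes B :: "'a::complex_banach set"
  assumes B: "finite B" "cvec.independent B"
  obtains g :: "'a \<Rightarrow> 'a \<Rightarrow>\<^sub>L complex" where "\<And>b. g b \<in> complex_ops"
    "\<And>x. x \<in> cvec.span B \<Longrightarrow> (\<Sum>b\<in>B. g b x *\<^sub>C b) = x"
proof -
  have "\<exists>f :: 'a \<Rightarrow>\<^sub>L complex. f \<in> complex_ops \<and> (b \<in> B \<longrightarrow> f b = 1 \<and> (\<forall>d\<in>B - {b}. f d = 0))" for b
  proof (cases "b \<in> B")
    case True
    then have "b \<notin> cvec.span (B - {b})"
      using B(2) cvec.dependent_def by blast
    then obtain f :: "'a \<Rightarrow>\<^sub>L complex" where f: "f \<in> complex_ops"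
        "\<And>r. r \<in> cvec.span (B - {b}) \<Longrightarrow> f r = 0" "f b = 1"
      using functional_vanishing_on_closed[OF closed_span_finite cvec.subspace_span] B(1)
      by (metis finite_Diff)
    then show ?thesis
      using f(2)[OF cvec.span_base] by (intro exI[of _ f]) simp
  qed (use complex_ops_zero in blast)
  then obtain g :: "'a \<Rightarrow> 'a \<Rightarrow>\<^sub>L complex" where g: "\<And>b. g b \<in> complex_ops"
      "\<And>b d. b \<in> B \<Longrightarrow> d \<in> B \<Longrightarrow> g b d = (if d = b then 1 else 0)"
    by (metis (full_types) DiffI singletonD)
  show thesis
  proof (rule that[OF g(1)])
    fix x assume "x \<in> cvec.span B"
    then obtain u where x: "x = (\<Sum>d\<in>B. u d *\<^sub>C d)"
      unfolding cvec.span_finite[OF B(1)] by blast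
    have "g b x = u b" if "b \<in> B" for b
      using that B(1) by (simp add: x blinfun.sum_right complex_opsD[OF g(1)] scaleC_complex_def g(2) if_distrib cong: if_cong)
    then show "(\<Sum>b\<in>B. g b x *\<^sub>C b) = x"
      by (simp add: x)
  qed
qed

section \<open>Operators between carriers: kernels, ranges and generalized inverses\<close>

lemma bounded_op_blinfun:
  "A \<in> complex_ops \<Longrightarrow> bounded_op UNIV norm UNIV norm (blinfun_apply A)"
  unfolding bounded_op_def linear_on_def
  by (auto simp: blinfun.add_right complex_opsD intro!: exI[of _ "norm A"] norm_blinfun)

lemma bounded_op_id: "bounded_op V N V N (\<lambda>x. x)"
  unfolding bounded_op_def linear_on_def by (auto intro!: exI[of _ 1])

lemma bounded_op_compose:
  assumes F: "bounded_op V N W M F" and G: "bounded_op W M U L G"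
  shows "bounded_op V N U L (\<lambda>x. G (F x))"
proof -
  obtain K where K: "K \<ge> 0" "\<And>x. x \<in> V \<Longrightarrow> M (F x) \<le> K * N x"
    using F by (auto simp: bounded_op_def)
  obtain K' where K': "K' \<ge> 0" "\<And>x. x \<in> W \<Longrightarrow> L (G x) \<le> K' * M x"
    using G by (auto simp: bounded_op_def)
  note lF = linear_onD[OF bounded_op_linear[OF F]] and lG = linear_onD[OF bounded_op_linear[OF G]]
  have "L (G (F x)) \<le> K' * K * N x" if "x \<in> V" for x
    using K'(2)[OF lF(1)[OF that]] mult_left_mono[OF K(2)[OF that] K'(1)] by simp
  then show ?thesis
    unfolding bounded_op_def linear_on_def using K K' lF lG by (auto intro!: exI[of _ "K' * K"])
qed

lemma bounded_op_diff:
  assumes W: "normed_on W M" and F: "bounded_op V N W M F" and G: "bounded_op V N W M G"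
  shows "bounded_op V N W M (\<lambda>x. F x - G x)"
proof -
  obtain K where K: "K \<ge> 0" "\<And>x. x \<in> V \<Longrightarrow> M (F x) \<le> K * N x"
    using F by (auto simp: bounded_op_def)
  obtain K' where K': "K' \<ge> 0" "\<And>x. x \<in> V \<Longrightarrow> M (G x) \<le> K' * N x"
    using G by (auto simp: bounded_op_def)
  note lF = linear_onD[OF bounded_op_linear[OF F]] and lG = linear_onD[OF bounded_op_linear[OF G]]
  have "M (F x - G x) \<le> (K + K') * N x" if "x \<in> V" for x
    using normed_on_triangle_diff[OF W lF(1)[OF that] lG(1)[OF that]] K(2)[OF that] K'(2)[OF that]
    by (simp add: algebra_simps)
  then show ?thesis
    unfolding bounded_op_def linear_on_def using K K' lF lG
    by (auto intro!: exI[of _ "K + K'"] normed_on_diff[OF W] simp: cvec.scale_right_diff_distrib)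
qed

lemma bounded_op_tuple:
  fixes H :: "'n::finite \<Rightarrow> 'a::complex_vector \<Rightarrow> 'b::complex_vector"
  assumes W: "normed_on W M" and H: "\<And>k. bounded_op V N W M (H k)"
  shows "bounded_op V N (power_space W) (power_norm M) (\<lambda>x. \<chi> k. H k x)"
proof -
  have "\<exists>K\<ge>0. \<forall>x\<in>V. M (H k x) \<le> K * N x" for k
    using H[of k] by (auto simp: bounded_op_def)
  then obtain K where K: "\<And>k. K k \<ge> 0" "\<And>k x. x \<in> V \<Longrightarrow> M (H k x) \<le> K k * N x"
    by metis
  note l = linear_onD[OF bounded_op_linear[OF H]]
  have "power_norm M (\<chi> k. H k x) \<le> (\<Sum>k\<in>UNIV. K k) * N x" if x: "x \<in> V" for x
  proof -
    have "power_norm M (\<chi> k. H k x) \<le> (\<Sum>k\<in>UNIV. M ((\<chi> k. H k x) $ k))"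
      using l(1)[OF x] by (intro power_norm_le_sum[OF W]) (simp add: power_space_def)
    also have "\<dots> \<le> (\<Sum>k\<in>UNIV. K k * N x)"
      using K(2)[OF x] by (intro sum_mono) simp
    finally show ?thesis by (simp add: sum_distrib_right)
  qed
  moreover have "0 \<le> (\<Sum>k\<in>UNIV. K k)"
    using K(1) by (intro sum_nonneg)
  ultimately show ?thesis
    unfolding bounded_op_def linear_on_def using l by (auto simp: power_space_def vec_eq_iff)
qed

lemma bounded_op_sum_components:
  fixes H :: "'n::finite \<Rightarrow> 'a::complex_vector \<Rightarrow> 'b::complex_vector"
  assumes W: "normed_on W M" and H: "\<And>k. bounded_op V N W M (H k)"
  shows "bounded_op (power_space V) (power_norm N) W M (\<lambda>v. \<Sum>k\<in>UNIV. H k (v $ k))"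
proof -
  have "\<exists>K\<ge>0. \<forall>x\<in>V. M (H k x) \<le> K * N x" for k
    using H[of k] by (auto simp: bounded_op_def)
  then obtain K where K: "\<And>k. K k \<ge> 0" "\<And>k x. x \<in> V \<Longrightarrow> M (H k x) \<le> K k * N x"
    by metis
  note l = linear_onD[OF bounded_op_linear[OF H]]
  have "M (\<Sum>k\<in>UNIV. H k (v $ k)) \<le> (\<Sum>k\<in>UNIV. K k) * power_norm N v" if v: "v \<in> power_space V" for v
  proof -
    have "M (\<Sum>k\<in>UNIV. H k (v $ k)) \<le> (\<Sum>k\<in>UNIV. M (H k (v $ k)))"
      using l(1)[OF power_spaceD[OF v]] by (intro normed_on_sum_le[OF W])
    also have "\<dots> \<le> (\<Sum>k\<in>UNIV. K k * power_norm N v)"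
    proof (rule sum_mono)
      show "M (H k (v $ k)) \<le> K k * power_norm N v" for k
        using K(2)[OF power_spaceD[OF v], of k k]
          mult_left_mono[OF component_le_power_norm[of N v k] K(1)[of k]] by simp
    qed
    finally show ?thesis by (simp add: sum_distrib_right)
  qed
  moreover have "0 \<le> (\<Sum>k\<in>UNIV. K k)"
    using K(1) by (intro sum_nonneg)
  ultimately show ?thesis
    unfolding bounded_op_def linear_on_def using l
    by (auto simp: power_space_def sum.distrib cvec.scale_sum_right intro!: normed_on_sum[OF W])
qed

lemma bounded_op_tilde:
  assumes "normed_on V N" "\<And>i. bounded_op V N V N (T i)"
  shows "bounded_op V N (power_space V) (power_norm N) (tilde T)"
  using bounded_op_tuple[of V N V N T] assms by (simp add: tilde_def[abs_def])

lemma bounded_op_hat: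
  assumes "normed_on V N" "\<And>i. bounded_op V N V N (T i)"
  shows "bounded_op (power_space V) (power_norm N) V N (hat T)"
  using bounded_op_sum_components[of V N V N T] assms by (simp add: hat_def[abs_def])

section \<open>Closed ranges, projections and semi-Fredholm maps\<close>

lemma closedin_kernel:
  fixes V :: "'a::complex_vector set"
  assumes V: "normed_on V N" and W: "normed_on W M" and F: "bounded_op V N W M F"
  shows "closedin (norm_topology V N) {v \<in> V. F v = 0}"
  unfolding closedin_norm_iff[OF V]
proof (intro conjI allI impI)
  fix \<sigma> :: "nat \<Rightarrow> 'a" and l
  assume \<sigma>: "(\<forall>k. \<sigma> k \<in> {v \<in> V. F v = 0}) \<and> l \<in> V \<and> norm_lim N \<sigma> l"
  then have "(\<lambda>k. M (F (\<sigma> k) - F l)) \<longlonglongrightarrow> 0"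
    by (intro bounded_op_tendsto[OF F V W]) auto
  moreover have Fl: "F l \<in> W"
    using \<sigma> linear_onD(1)[OF bounded_op_linear[OF F]] by blast
  ultimately have "M (F l) = 0"
    using \<sigma> normed_on_minus[OF W Fl] by (simp add: LIMSEQ_const_iff)
  then show "l \<in> {v \<in> V. F v = 0}"
    using \<sigma> normed_on_eq_0[OF W Fl] by simp
qed auto

text \<open>The lower bound makes the preimages of a convergent sequence Cauchy, and the image of
  their limit is the limit of the sequence.\<close>

lemma closedin_range_bounded_below:
  fixes V :: "'a::complex_vector set" and W :: "'b::complex_vector set"
  assumes V: "banach_on V N" and W: "normed_on W M" and F: "bounded_op V N W M F"
    and c: "c > 0" "\<And>x. x \<in> V \<Longrightarrow> c * N x \<le> M (F x)"
  shows "closedin (norm_topology W M) (F ` V)"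
  unfolding closedin_norm_iff[OF W]
proof (intro conjI allI impI)
  note nV = banach_on_normed[OF V]
  note L = bounded_op_linear[OF F]
  note FW = linear_onD(1)[OF L]
  show "F ` V \<subseteq> W" using FW by blast
  fix \<sigma> :: "nat \<Rightarrow> 'b" and l
  assume \<sigma>: "(\<forall>k. \<sigma> k \<in> F ` V) \<and> l \<in> W \<and> norm_lim M \<sigma> l"
  then have "\<forall>k. \<exists>x\<in>V. \<sigma> k = F x" by blast
  then obtain x where x: "\<And>k. x k \<in> V" "\<And>k. \<sigma> k = F (x k)" by metis
  have lW: "l \<in> W" and lim: "(\<lambda>k. M (F (x k) - l)) \<longlonglongrightarrow> 0"
    using \<sigma> x(2) by simp_all
  have le: "M (u - l') \<le> M (v - u) + M (v - l')" if "u \<in> W" "v \<in> W" "l' \<in> W" for u v l'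
    using normed_on_triangle_3[OF W that] normed_on_minus_commute[OF W that(1,2)] by simp
  have "\<exists>K. \<forall>i\<ge>K. \<forall>j\<ge>K. N (x i - x j) < \<epsilon>" if \<epsilon>: "\<epsilon> > 0" for \<epsilon>
  proof -
    have "c * \<epsilon> / 2 > 0" using \<epsilon> c by simp
    then obtain K where K: "\<forall>k\<ge>K. M (F (x k) - l) < c * \<epsilon> / 2"
      using lim norm_tendsto_iff[OF W lW, of "\<lambda>k. F (x k)"] FW[OF x(1)] by blast
    have "N (x i - x j) < \<epsilon>" if "i \<ge> K" "j \<ge> K" for i j
    proof -
      have "c * N (x i - x j) \<le> M (F (x i) - F (x j))"
        using c(2)[OF normed_on_diff[OF nV x(1) x(1)], of i j]
          linear_on_diff[OF L normed_on_subspace[OF nV] x(1) x(1), of i j] by simp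
      also have "\<dots> \<le> M (F (x i) - l) + M (F (x j) - l)"
        using normed_on_triangle_3[OF W FW[OF x(1)] lW FW[OF x(1)], of i j]
          normed_on_minus_commute[OF W lW FW[OF x(1)], of j] by simp
      also have "\<dots> < c * \<epsilon>"
        using K[rule_format, OF that(1)] K[rule_format, OF that(2)] by linarith
      finally show ?thesis using c(1) by simp
    qed
    then show ?thesis by blast
  qed
  then obtain z where z: "z \<in> V" "norm_lim N x z"
    using banach_on_completeE[OF V, of x] x(1) by blast
  have "(\<lambda>k. M (F (x k) - l) + M (F (x k) - F z)) \<longlonglongrightarrow> 0 + 0"
    by (intro tendsto_add lim bounded_op_tendsto[OF F nV W x(1) z])
  then have "M (l - F z) \<le> 0"
    using LIMSEQ_le_const[of "\<lambda>k. M (F (x k) - l) + M (F (x k) - F z)" 0 "M (l - F z)"]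
      le[OF lW FW[OF x(1)] FW[OF z(1)]] by simp
  then have "l = F z"
    using normed_on_eq_0[OF W, of "l - F z"] normed_on_nonneg[OF W, of "l - F z"]
      normed_on_diff[OF W lW FW[OF z(1)]] by auto
  with z(1) show "l \<in> F ` V" by blast
qed

text \<open>F G F = F makes both G F and F G bounded projections: G F has the same kernel as F, and
  F G projects onto the range of F. All claims are then read off from kernels of bounded
  operators.\<close>

lemma generalized_inverse_complements:
  fixes V :: "'a::complex_vector set" and W :: "'b::complex_vector set"
  assumes V: "normed_on V N" and W: "normed_on W M"
    and F: "bounded_op V N W M F" and G: "bounded_op W M V N G"
    and FGF: "\<And>v. v \<in> V \<Longrightarrow> F (G (F v)) = F v"
  shows "has_direct_complement V N {v \<in> V. F v = 0}"
    and "closedin (norm_topology W M) (F ` V)"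
    and "has_direct_complement W M (F ` V)"
proof -
  note lF = bounded_op_linear[OF F] and lG = bounded_op_linear[OF G]
  note sV = normed_on_subspace[OF V] and sW = normed_on_subspace[OF W]
  note FW = linear_onD(1)[OF lF] and GV = linear_onD(1)[OF lG]
  have D: "bounded_op V N V N (\<lambda>v. v - G (F v))"
    by (rule bounded_op_diff[OF V bounded_op_id bounded_op_compose[OF F G]])
  let ?M = "{v \<in> V. v - G (F v) = 0}"
  show "has_direct_complement V N {v \<in> V. F v = 0}"
    unfolding has_direct_complement_def
  proof (intro exI[of _ ?M] conjI)
    show "cvec.subspace ?M"
      by (rule linear_on_kernel[OF bounded_op_linear[OF D] sV])
    show "closedin (norm_topology V N) ?M"
      by (rule closedin_kernel[OF V V D])
    show "{v \<in> V. F v = 0} \<inter> ?M = {0}"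
      using linear_on_0[OF lF sV] linear_on_0[OF lG sW] normed_on_0[OF V] by auto
    show "V = {w + m |w m. w \<in> {v \<in> V. F v = 0} \<and> m \<in> ?M}"
    proof (intro equalityI subsetI)
      fix v assume v: "v \<in> V"
      have "v - G (F v) \<in> {v \<in> V. F v = 0}"
        using v FGF[OF v] linear_on_diff[OF lF sV v GV[OF FW[OF v]]]
        by (simp add: normed_on_diff[OF V] FW GV)
      moreover have "G (F v) \<in> ?M"
        using v FGF[OF v] by (simp add: FW GV)
      moreover have "v = (v - G (F v)) + G (F v)" by simp
      ultimately show "v \<in> {w + m |w m. w \<in> {v \<in> V. F v = 0} \<and> m \<in> ?M}" by blast
    qed (auto simp: normed_on_add[OF V])
  qed auto
  have D': "bounded_op W M W M (\<lambda>w. w - F (G w))"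
    by (rule bounded_op_diff[OF W bounded_op_id bounded_op_compose[OF G F]])
  \<comment> \<open>The range consists of the fixed points of F G, which form a kernel.\<close>
  have im: "F ` V = {w \<in> W. w - F (G w) = 0}"
    using FGF FW GV by (auto intro: image_eqI)
  show "closedin (norm_topology W M) (F ` V)"
    unfolding im by (rule closedin_kernel[OF W W D'])
  have FG: "bounded_op W M W M (\<lambda>w. F (G w))"
    by (rule bounded_op_compose[OF G F])
  let ?K = "{w \<in> W. F (G w) = 0}"
  show "has_direct_complement W M (F ` V)"
    unfolding has_direct_complement_def
  proof (intro exI[of _ ?K] conjI)
    show "cvec.subspace ?K"
      by (rule linear_on_kernel[OF bounded_op_linear[OF FG] sW])
    show "closedin (norm_topology W M) ?K"
      by (rule closedin_kernel[OF W W FG])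
    show "F ` V \<inter> ?K = {0}"
      unfolding im using linear_on_0[OF lF sV] linear_on_0[OF lG sW] normed_on_0[OF W] by auto
    show "W = {w + m |w m. w \<in> F ` V \<and> m \<in> ?K}"
    proof (intro equalityI subsetI)
      fix w assume w: "w \<in> W"
      have "F (G (w - F (G w))) = 0"
        using linear_on_diff[OF bounded_op_linear[OF FG] sW w FW[OF GV[OF w]]] FGF[OF GV[OF w]]
        by simp
      then have "w - F (G w) \<in> ?K"
        using w by (simp add: normed_on_diff[OF W] FW GV)
      moreover have "F (G w) \<in> F ` V"
        using GV[OF w] by blast
      moreover have "w = F (G w) + (w - F (G w))" by simp
      ultimately show "w \<in> {w + m |w m. w \<in> F ` V \<and> m \<in> ?K}" by blast
    qed (auto simp: normed_on_add[OF W] FW)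
  qed auto
qed

text \<open>The open mapping theorem onto the closed range changes each \<open>A k\<close> into a
  kernel element by a correction that tends to 0. A bounded separated sequence would thus survive in
  the finite-dimensional kernel.\<close>

lemma no_separated_almost_kernel:
  fixes V :: "'a::complex_vector set" and W :: "'b::complex_vector set"
  assumes V: "banach_on V N" and W: "banach_on W M" and F: "bounded_op V N W M F"
    and ker: "finite_dim {v \<in> V. F v = 0}" and ran: "closedin (norm_topology W M) (F ` V)"
    and A: "\<And>k. A k \<in> V" "\<And>k. N (A k) \<le> C" "(\<lambda>k. M (F (A k))) \<longlonglongrightarrow> 0"
    and \<eta>: "\<eta> > 0" "\<And>j k. j < k \<Longrightarrow> \<eta> \<le> N (A k - A j)"
  shows False
proof -
  note nV = banach_on_normed[OF V] and nW = banach_on_normed[OF W]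
  note L = bounded_op_linear[OF F]
  note sV = normed_on_subspace[OF nV]
  have sR: "cvec.subspace (F ` V)"
    by (rule linear_on_image[OF L sV])
  have R: "banach_on (F ` V) M"
    by (rule banach_on_closed_subspace[OF W ran sR])
  note nR = banach_on_normed[OF R]
  have FR: "bounded_op V N (F ` V) M F"
    using F by (auto simp: bounded_op_def linear_on_def)
  obtain D where D: "D \<ge> 0" "\<And>w. w \<in> F ` V \<Longrightarrow> \<exists>v\<in>V. N v \<le> D * M w \<and> w - F v \<in> {0}"
    using open_mapping_modulo[OF V R FR cvec.subspace_single_0 closedin_zero[OF nR]] by auto
  have "\<exists>v\<in>V. N v \<le> D * M (F (A k)) \<and> F (A k) = F v" for k
    using D(2)[of "F (A k)"] A(1)[of k] by simp
  then obtain b where b: "\<And>k. b k \<in> V" "\<And>k. N (b k) \<le> D * M (F (A k))" "\<And>k. F (A k) = F (b k)"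
    by metis
  obtain B where B: "finite B" "B \<subseteq> {v \<in> V. F v = 0}" "{v \<in> V. F v = 0} \<subseteq> cvec.span B"
      "cvec.independent B"
    by (rule finite_dimE[OF ker])
  have nb: "0 \<le> N (b k)" for k by (rule normed_on_nonneg[OF nV b(1)])
  have "(\<lambda>k. N (b k)) \<longlonglongrightarrow> 0"
    by (rule tendsto_sandwich[OF _ _ tendsto_const tendsto_mult_right_zero[OF A(3), of D]])
      (simp_all add: nb b(2))
  then have "\<forall>\<^sub>F k in sequentially. N (b k) < \<eta> / 4"
    by (rule order_tendstoD(2)) (use \<eta>(1) in simp)
  then obtain K where K: "\<And>k. k \<ge> K \<Longrightarrow> N (b k) < \<eta> / 4"
    unfolding eventually_sequentially by blast
  \<comment> \<open>The corrections are now below \<eta>/4, so two terms lose at most half of their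
    separation \<eta>.\<close>
  define n where "n k = A (K + k) - b (K + k)" for k
  have n1: "n k \<in> cvec.span B" for k
  proof -
    have "n k \<in> {v \<in> V. F v = 0}"
      using linear_on_diff[OF L sV A(1) b(1), of "K + k" "K + k"]
      by (simp add: n_def normed_on_diff[OF nV A(1) b(1)] b(3))
    then show ?thesis using B(3) by blast
  qed
  have n2: "N (n k) \<le> C + \<eta>" for k
    using normed_on_triangle_diff[OF nV A(1) b(1), of "K + k" "K + k"] A(2)[of "K + k"] K[of "K + k"] \<eta>(1)
    by (simp add: n_def)
  show False
  proof (rule span_finite_no_separated_sequence[OF nV B(1) _ n1 n2])
    show "B \<subseteq> V" using B(2) by blast
    show "\<eta> / 2 > 0" using \<eta>(1) by simp
    show "\<eta> / 2 \<le> N (n k - n j)" if "j < k" for j k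
    proof -
      have "A (K + k) - A (K + j) = (n k - n j) + (b (K + k) - b (K + j))"
        by (simp add: n_def)
      moreover have "n k - n j \<in> V" "b (K + k) - b (K + j) \<in> V"
        using A(1) b(1) by (simp_all add: n_def normed_on_diff[OF nV])
      ultimately have "N (A (K + k) - A (K + j)) \<le> N (n k - n j) + N (b (K + k) - b (K + j))"
        by (metis normed_on_triangle[OF nV])
      moreover have "N (b (K + k) - b (K + j)) \<le> N (b (K + k)) + N (b (K + j))"
        by (rule normed_on_triangle_diff[OF nV b(1) b(1)])
      ultimately show ?thesis
        using K[of "K + k"] K[of "K + j"] \<eta>(2)[of "K + j" "K + k"] that by simp
    qed
  qed
qed

text \<open>The zero space of \<open>g\<close> has codimension at most one in \<open>V\<close>, so
  restoring the missing direction enlarges kernel and range by at most one dimension, and a closed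
  subspace stays closed when one vector is added.\<close>

lemma semi_Fredholm_extend:
  fixes V :: "'a::complex_vector set" and W :: "'b::complex_vector set" and g :: "'a \<Rightarrow> complex"
  assumes V: "cvec.subspace V" and W: "normed_on W M" and F: "linear_on V W F"
    and g: "linear_on V UNIV g"
    and ker: "finite_dim {x \<in> V. g x = 0 \<and> F x = 0}"
    and ran: "closedin (norm_topology W M) (F ` {x \<in> V. g x = 0})"
  shows "finite_dim {x \<in> V. F x = 0}" "closedin (norm_topology W M) (F ` V)"
proof -
  have V0: "cvec.subspace {x \<in> V. g x = 0}"
    by (rule linear_on_kernel[OF g V])
  \<comment> \<open>Projection along \<open>v\<close> onto the zero space of
    \<open>g\<close>.\<close>
  have red: "x - (g x / g v) *\<^sub>C v \<in> {x \<in> V. g x = 0}" if "x \<in> V" "v \<in> V" "g v \<noteq> 0" for x v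
    using that linear_on_diff[OF g V that(1) cvec.subspace_scale[OF V that(2), of "g x / g v"]]
    by (simp add: cvec.subspace_diff[OF V] cvec.subspace_scale[OF V] linear_onD(3)[OF g]
        scaleC_complex_def)
  obtain B where B: "finite B" "{x \<in> V. g x = 0 \<and> F x = 0} \<subseteq> cvec.span B"
    using ker by (auto simp: finite_dim_def)
  show "finite_dim {x \<in> V. F x = 0}"
  proof (cases "\<forall>x\<in>V. F x = 0 \<longrightarrow> g x = 0")
    case True
    then have "{x \<in> V. F x = 0} \<subseteq> cvec.span B"
      using B(2) by blast
    with B(1) show ?thesis
      by (auto simp: finite_dim_def)
  next
    case False
    then obtain v where v: "v \<in> V" "F v = 0" "g v \<noteq> 0" by blast
    have "x \<in> cvec.span (insert v B)" if x: "x \<in> V" "F x = 0" for x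
    proof -
      have "F (x - (g x / g v) *\<^sub>C v) = 0"
        using x v linear_on_diff[OF F V x(1) cvec.subspace_scale[OF V v(1), of "g x / g v"]]
        by (simp add: linear_onD(3)[OF F])
      then have "x - (g x / g v) *\<^sub>C v \<in> cvec.span B"
        using red[OF x(1) v(1,3)] B(2) by blast
      then show ?thesis
        unfolding cvec.span_breakdown_eq by blast
    qed
    then have "{x \<in> V. F x = 0} \<subseteq> cvec.span (insert v B)" by blast
    with B(1) show ?thesis
      unfolding finite_dim_def by (meson finite.insertI)
  qed
  show "closedin (norm_topology W M) (F ` V)"
  proof (cases "\<forall>x\<in>V. g x = 0")
    case True
    then have "{x \<in> V. g x = 0} = V" by blast
    with ran show ?thesis by simp
  next
    case False
    then obtain v where v: "v \<in> V" "g v \<noteq> 0" by blast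
    let ?R = "F ` {x \<in> V. g x = 0}"
    have "linear_on {x \<in> V. g x = 0} W F"
      using F by (auto simp: linear_on_def)
    then have sR: "cvec.subspace ?R"
      by (rule linear_on_image[OF _ V0])
    have "F ` V = cvec.span (insert (F v) ?R)"
    proof (intro equalityI subsetI)
      fix y assume "y \<in> F ` V"
      then obtain x where x: "x \<in> V" "y = F x" by blast
      have "y - (g x / g v) *\<^sub>C F v = F (x - (g x / g v) *\<^sub>C v)"
        using x v linear_on_diff[OF F V x(1) cvec.subspace_scale[OF V v(1), of "g x / g v"]]
        by (simp add: linear_onD(3)[OF F])
      also have "\<dots> \<in> ?R"
        using red[OF x(1) v] by blast
      finally have "y - (g x / g v) *\<^sub>C F v \<in> cvec.span ?R"
        by (rule cvec.span_base)
      then show "y \<in> cvec.span (insert (F v) ?R)"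
        unfolding cvec.span_breakdown_eq by blast
    next
      have "cvec.span (insert (F v) ?R) \<subseteq> F ` V"
        using v by (intro cvec.span_minimal linear_on_image[OF F V]) auto
      then show "y \<in> F ` V" if "y \<in> cvec.span (insert (F v) ?R)" for y
        using that by blast
    qed
    then show ?thesis
      using closedin_span_insert[OF W ran sR linear_onD(1)[OF F v(1)]] by simp
  qed
qed

section \<open>Tuples of operators on a Banach space\<close>

lemma bounded_op_tilde_ops:
  assumes "\<And>i. T i \<in> complex_ops"
  shows "bounded_op UNIV norm (UNIV :: ('a::complex_banach ^ 'n::finite) set) norm (tilde (op_tuple T))"
  using bounded_op_tilde[OF banach_on_normed[OF banach_on_UNIV] bounded_op_blinfun[OF assms]]
  by (simp add: power_norm_norm)

lemma bounded_op_hat_ops: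
  assumes "\<And>i. T i \<in> complex_ops"
  shows "bounded_op (UNIV :: ('a::complex_banach ^ 'n::finite) set) norm UNIV norm (hat (op_tuple T))"
  using bounded_op_hat[OF banach_on_normed[OF banach_on_UNIV] bounded_op_blinfun[OF assms]]
  by (simp add: power_norm_norm)

abbreviation "hat_ran T \<equiv> hat_range UNIV (op_tuple T)"
abbreviation "hat_ker T \<equiv> hat_kernel UNIV (op_tuple T)"
abbreviation "tilde_ran T \<equiv> tilde_range UNIV (op_tuple T)"
abbreviation "tilde_ker T \<equiv> tilde_kernel UNIV (op_tuple T)"
abbreviation "closed_ran T \<equiv> closedin (norm_topology UNIV norm) (tilde_ran T)"
abbreviation "complemented W \<equiv> has_direct_complement UNIV norm W"

text \<open>If no such \<open>x\<close> existed, the tuple would be bounded below by \<epsilon> on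
  the common zero space of \<open>G\<close>, hence injective with closed range there. Finitely many
  one-dimensional extensions would carry finite kernel and closed range to the whole space.\<close>

lemma not_semi_Fredholm_almost_ker:
  fixes T :: "'m::finite \<Rightarrow> ('a::complex_banach \<Rightarrow>\<^sub>L 'a)" and G :: "('a \<Rightarrow>\<^sub>L complex) set"
  assumes T: "\<And>i. T i \<in> complex_ops"
    and not: "\<not> (finite_dim (tilde_ker T) \<and>
      closed_ran T)"
    and G: "finite G" "G \<subseteq> complex_ops" and \<epsilon>: "\<epsilon> > 0"
  obtains x where "norm x = 1" "\<And>g. g \<in> G \<Longrightarrow> blinfun_apply g x = 0" "\<And>i. norm (T i x) \<le> \<epsilon>"
proof (rule ccontr)
  assume "\<not> thesis"
  with that have none: "\<exists>i. \<epsilon> < norm (T i x)" if "norm x = 1" "\<forall>g\<in>G. blinfun_apply g x = 0" for x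
    using that by (meson not_le_imp_less)
  let ?F = "tilde (op_tuple T)"
  define X where "X H = {x::'a. \<forall>g\<in>H. blinfun_apply g x = 0}" for H :: "('a \<Rightarrow>\<^sub>L complex) set"
  note nU = banach_on_normed[OF banach_on_powerI[where 'a='a and 'n='m]]
  have X_sub: "cvec.subspace (X H)" if "H \<subseteq> complex_ops" for H
    using that by (auto simp: X_def cvec.subspace_def blinfun.add_right complex_opsD scaleC_complex_def
        subset_iff)
  have F: "bounded_op (X H) norm UNIV norm ?F" for H
    using bounded_op_tilde_ops[of T] T by (auto simp: bounded_op_def linear_on_def)
  have X_closed: "closed (X H)" for H
  proof -
    have "X H = (\<Inter>g\<in>H. {x. blinfun_apply g x = 0})" by (auto simp: X_def)
    then show ?thesis
      by (auto intro!: closed_INT closed_Collect_eq continuous_intros)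
  qed
  have BX: "banach_on (X H) norm" if "H \<subseteq> complex_ops" for H
    using X_closed X_sub[OF that]
    by (intro banach_on_closed_subspace[OF banach_on_UNIV]) (simp_all add: closedin_norm_topology_UNIV)
  have below: "\<epsilon> * norm x \<le> norm (?F x)" if x: "x \<in> X G" for x
  proof (cases "x = 0")
    case False
    let ?c = "complex_of_real (1 / norm x)"
    have "\<forall>g\<in>G. blinfun_apply g (?c *\<^sub>C x) = 0"
    proof
      fix g assume "g \<in> G"
      then have "g \<in> complex_ops" "blinfun_apply g x = 0"
        using x G(2) by (auto simp: X_def)
      then show "blinfun_apply g (?c *\<^sub>C x) = 0"
        by (simp add: complex_opsD)
    qed
    then obtain i where "\<epsilon> < norm (T i (?c *\<^sub>C x))"
      using none[of "?c *\<^sub>C x"] False by (auto simp: norm_scaleC norm_divide)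
    then have "\<epsilon> * norm x < norm (T i x)"
      using False by (simp add: complex_opsD[OF T] norm_scaleC norm_divide field_simps)
    also have "\<dots> \<le> norm (?F x)"
      using component_le_power_norm[of norm "?F x" i] by (simp add: power_norm_norm tilde_def)
    finally show ?thesis by simp
  qed simp
  have "finite_dim {x \<in> X G. ?F x = 0} \<and> closedin (norm_topology UNIV norm) (?F ` X G)"
  proof
    have "{x \<in> X G. ?F x = 0} \<subseteq> {0}"
    proof
      fix x assume "x \<in> {x \<in> X G. ?F x = 0}"
      then have "\<epsilon> * norm x \<le> 0"
        using below[of x] by simp
      then show "x \<in> {0}"
        using \<epsilon> by (simp add: mult_le_0_iff)
    qed
    then show "finite_dim {x \<in> X G. ?F x = 0}"
      unfolding finite_dim_def by (intro exI[of _ "{}"]) simp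
    show "closedin (norm_topology UNIV norm) (?F ` X G)"
      by (rule closedin_range_bounded_below[OF BX[OF G(2)] nU F \<epsilon> below])
  qed
  \<comment> \<open>Induction drops one functional at a time until none is left and
    \<open>X {}\<close> is the whole space.\<close>
  moreover have "finite_dim {x \<in> X H. ?F x = 0} \<and> closedin (norm_topology UNIV norm) (?F ` X H) \<Longrightarrow>
      finite_dim {x \<in> X {}. ?F x = 0} \<and> closedin (norm_topology UNIV norm) (?F ` X {})"
    if "finite H" "H \<subseteq> complex_ops" for H
    using that
  proof (induction H rule: finite_induct)
    case (insert g H)
    have "X (insert g H) = {x \<in> X H. g x = 0}"
      by (auto simp: X_def)
    moreover have "linear_on (X H) UNIV (blinfun_apply g)"
      using insert.prems(2) by (auto simp: linear_on_def blinfun.add_right complex_opsD)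
    moreover have "{x. (x \<in> X H \<and> g x = 0) \<and> ?F x = 0} = {x \<in> X H. g x = 0 \<and> ?F x = 0}" by auto
    ultimately have "finite_dim {x \<in> X H. ?F x = 0}" "closedin (norm_topology UNIV norm) (?F ` X H)"
      using semi_Fredholm_extend[OF X_sub nU bounded_op_linear[OF F], of H "blinfun_apply g"] insert.prems
      by simp_all
    with insert show ?case by simp
  qed simp
  ultimately have "finite_dim {x \<in> X {}. ?F x = 0} \<and> closedin (norm_topology UNIV norm) (?F ` X {})"
    using G by blast
  then show False
    using not by (simp add: X_def tilde_kernel_def tilde_range_def)
qed

text \<open>Either a kernel vector can be normalised, or the range is not closed and the preceding
  lemma applies with the empty set of functionals.\<close>

lemma not_bounded_below_almost_kernel:
  fixes T :: "'m::finite \<Rightarrow> ('a::complex_banach \<Rightarrow>\<^sub>L 'a)"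
  assumes T: "\<And>i. T i \<in> complex_ops"
    and not: "tilde_ker T \<noteq> {0} \<or>
      \<not> closed_ran T"
    and \<epsilon>: "\<epsilon> > 0"
  obtains x where "norm x = 1" "\<And>i. norm (T i x) \<le> \<epsilon>"
proof (cases "tilde_ker T \<subseteq> {0}")
  case True
  have "0 \<in> tilde_ker T"
    by (simp add: tilde_kernel_def tilde_def vec_eq_iff)
  with True not have "\<not> closed_ran T"
    by blast
  then show thesis
    using not_semi_Fredholm_almost_ker[of T "{}" \<epsilon>, OF T _ _ _ \<epsilon>] that by auto
next
  case False
  then obtain x where x: "x \<noteq> 0" "tilde (op_tuple T) x = 0"
    by (auto simp: tilde_kernel_def)
  have "norm (complex_of_real (1 / norm x) *\<^sub>C x) = 1"
    using x(1) by (simp add: norm_scaleC norm_divide)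
  moreover have "T i (complex_of_real (1 / norm x) *\<^sub>C x) = 0" for i
    using x(2) by (simp add: complex_opsD[OF T] tilde_def vec_eq_iff)
  ultimately show thesis
    using \<epsilon> that by simp
qed

lemma hat_axis:
  assumes "\<And>i. T i 0 = 0"
  shows "hat T (axis i x) = T i x"
proof -
  have "hat T (axis i x) = (\<Sum>j\<in>UNIV. if j = i then T j x else 0)"
    unfolding hat_def by (rule sum.cong) (simp_all add: axis_def assms)
  then show ?thesis by simp
qed

lemma norm_axis_le: "norm (axis i x :: 'a::complex_banach ^ 'n) \<le> norm x"
proof -
  have "norm (axis i x :: 'a ^ 'n) \<le> (\<Sum>j\<in>UNIV. norm (axis i x $ j))"
    using power_norm_le_sum[OF banach_on_normed[OF banach_on_UNIV], of "axis i x"]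
    by (simp add: power_norm_norm)
  also have "\<dots> = (\<Sum>j\<in>UNIV. if j = i then norm x else 0)"
    by (rule sum.cong) (simp_all add: axis_def)
  finally show ?thesis by simp
qed

text \<open>\<open>approximate_surjection\<close> read backwards: as the tuple is not onto modulo
  \<open>E\<close>, some \<open>w\<close> cannot be approximated to within half its norm by images
  of vectors of norm at most norm w / (2 \<delta>). The separating functional then measures this
  failure: it is large at \<open>w\<close>, zero on \<open>E\<close>, and of norm at most \<delta>
  after composition with each \<open>T i\<close>.\<close>

lemma not_onto_almost_annihilator:
  fixes T :: "'m::finite \<Rightarrow> ('a::complex_banach \<Rightarrow>\<^sub>L 'a)"
  assumes T: "\<And>i. T i \<in> complex_ops"
    and E: "cvec.subspace E" "closed E"
    and not: "\<not> (\<forall>w. \<exists>v. w - hat (op_tuple T) v \<in> E)" and \<delta>: "\<delta> > 0"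
  obtains y and f :: "'a \<Rightarrow>\<^sub>L complex" where "norm y = 1" "f \<in> complex_ops" "norm f \<le> 1"
    "1/2 \<le> cmod (f y)" "\<And>i. norm (f o\<^sub>L T i) \<le> \<delta>" "\<And>e. e \<in> E \<Longrightarrow> f e = 0"
proof -
  let ?F = "hat (op_tuple T)"
  note F = bounded_op_hat_ops[of T, OF T]
  have F0: "?F 0 = 0" by (simp add: hat_def)
  have Ec: "closedin (norm_topology UNIV norm) E"
    using E(2) by (simp add: closedin_norm_topology_UNIV)
  \<comment> \<open>The radius norm w / (2 \<delta>) is the point from which on \<delta> norm v
    alone reaches norm w / 2. Inside it the residual does, so the lower bound for the separating
    functional holds for every \<open>v\<close>.\<close>
  have "\<exists>w. \<forall>v e. e \<in> E \<longrightarrow> norm v \<le> 1 / (2 * \<delta>) * norm w \<longrightarrow> norm w / 2 < norm (w - ?F v - e)"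
  proof (rule ccontr)
    assume "\<not> ?thesis"
    then have step: "\<exists>v\<in>UNIV. \<exists>e\<in>E. norm v \<le> 1 / (2 * \<delta>) * norm w \<and> norm (w - ?F v - e) \<le> norm w / 2" for w
      by (meson not_less UNIV_I)
    have "\<exists>v\<in>UNIV. norm v \<le> 2 * (1 / (2 * \<delta>)) * norm w \<and> w - ?F v \<in> E" for w
      by (rule approximate_surjection[OF banach_on_powerI banach_on_UNIV F E(1) Ec step])
        (use \<delta> in auto)
    with not show False by blast
  qed
  then obtain w where w: "\<And>v e. e \<in> E \<Longrightarrow> norm v \<le> 1 / (2 * \<delta>) * norm w \<Longrightarrow>
      norm w / 2 < norm (w - ?F v - e)" by blast
  have w0: "w \<noteq> 0"
    using w[of 0 0] cvec.subspace_0[OF E(1)] F0 by auto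
  have "norm w / 2 \<le> \<delta> * norm v + norm (w - ?F v - e)" if "e \<in> E" for v e
  proof (cases "norm v \<le> 1 / (2 * \<delta>) * norm w")
    case True
    have "0 \<le> \<delta> * norm v" using \<delta> by simp
    with w[OF that True] show ?thesis by linarith
  next
    case False
    then have "norm w / 2 \<le> \<delta> * norm v"
      using \<delta> by (simp add: field_simps)
    then show ?thesis
      by (rule order_trans) simp
  qed
  then obtain f :: "'a \<Rightarrow>\<^sub>L complex" where f: "f \<in> complex_ops" "norm f \<le> 1" "norm w / 2 \<le> cmod (f w)"
      "\<And>v. cmod (f (?F v)) \<le> \<delta> * norm v" "\<And>e. e \<in> E \<Longrightarrow> f e = 0"
    using separating_functional[OF banach_on_normed[OF banach_on_powerI]
        bounded_op_linear[OF F] E(1), of \<delta> "norm w / 2" w] \<delta> by auto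
  show thesis
  proof (rule that[OF _ f(1,2)])
    let ?y = "complex_of_real (1 / norm w) *\<^sub>C w"
    show "norm ?y = 1"
      using w0 by (simp add: norm_scaleC norm_divide)
    show "1/2 \<le> cmod (f ?y)"
      using f(3) w0 by (simp add: complex_opsD[OF f(1)] scaleC_complex_def norm_mult norm_divide field_simps)
    show "norm (f o\<^sub>L T i) \<le> \<delta>" for i
    proof (rule norm_blinfun_bound)
      fix x
      have "?F (axis i x) = T i x"
        by (rule hat_axis) simp
      then have "cmod (f (T i x)) \<le> \<delta> * norm (axis i x :: 'a ^ 'm)"
        using f(4)[of "axis i x"] by simp
      also have "\<dots> \<le> \<delta> * norm x"
        using \<delta> by (intro mult_left_mono norm_axis_le) simp
      finally show "norm ((f o\<^sub>L T i) x) \<le> \<delta> * norm x" by simp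
    qed (use \<delta> in simp)
  qed (rule f(5))
qed

lemma span_Un_diffI: "r \<in> R \<Longrightarrow> w - r \<in> cvec.span B \<Longrightarrow> w \<in> cvec.span (R \<union> B)"
  using cvec.span_add[of r "R \<union> B" "w - r"] cvec.span_base[of r "R \<union> B"] cvec.span_mono[of B "R \<union> B"]
  by auto

lemma finite_codim_if_onto_modulo:
  assumes Y: "finite Y" and onto: "\<And>w. \<exists>v. w - hat (op_tuple T) v \<in> cvec.span Y"
  shows "finite_codim UNIV (hat_ran T)"
proof -
  have "w \<in> cvec.span (hat_ran T \<union> Y)" for w
  proof -
    obtain v where "w - hat (op_tuple T) v \<in> cvec.span Y" using onto by blast
    then show ?thesis
      by (rule span_Un_diffI[rotated]) (simp add: hat_range_def)
  qed
  with Y show ?thesis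
    unfolding finite_codim_def by blast
qed

text \<open>Greedy choice: \<open>b\<close> is kept only if it lies outside the span of
  \<open>R\<close> and the vectors kept so far. This keeps them independent and their span
  transversal to \<open>R\<close>.\<close>

lemma finite_complement_basis:
  fixes R :: "'a::complex_vector set"
  assumes R: "cvec.subspace R" and B: "finite B"
  obtains B' where "finite B'" "B' \<subseteq> B" "cvec.span (R \<union> B') = cvec.span (R \<union> B)"
    "R \<inter> cvec.span B' = {0}" "cvec.independent B'"
proof -
  have "\<exists>B'\<subseteq>B. cvec.span (R \<union> B') = cvec.span (R \<union> B) \<and> R \<inter> cvec.span B' = {0} \<and> cvec.independent B'"
    using B
  proof (induction B rule: finite_induct)
    case empty
    then show ?case
      using cvec.subspace_0[OF R] cvec.independent_empty by auto
  next
    case (insert b B)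
    from insert.IH obtain B' where
      "B' \<subseteq> B \<and> cvec.span (R \<union> B') = cvec.span (R \<union> B) \<and> R \<inter> cvec.span B' = {0} \<and> cvec.independent B'" ..
    then have B': "B' \<subseteq> B" "cvec.span (R \<union> B') = cvec.span (R \<union> B)" "R \<inter> cvec.span B' = {0}"
        "cvec.independent B'"
      by simp_all
    have eq: "cvec.span (R \<union> insert b B') = cvec.span (R \<union> insert b B)"
      using B'(2) by (simp add: set_eq_iff cvec.span_breakdown_eq)
    show ?case
    proof (cases "b \<in> cvec.span (R \<union> B')")
      case True
      then have "cvec.span (R \<union> insert b B') = cvec.span (R \<union> B')"
        by (simp add: cvec.span_redundant)
      with eq B' show ?thesis
        by (intro exI[of _ B'] conjI) auto
    next
      case False
      have "x = 0" if x: "x \<in> R" "x \<in> cvec.span (insert b B')" for x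
      proof -
        obtain c where c: "x - c *\<^sub>C b \<in> cvec.span B'"
          using x(2) by (auto simp: cvec.span_breakdown_eq)
        show ?thesis
        proof (cases "c = 0")
          case True
          then show ?thesis
            using c x(1) B'(3) by auto
        next
          case cn: False
          have "x \<in> cvec.span (R \<union> B')" "x - c *\<^sub>C b \<in> cvec.span (R \<union> B')"
            using x(1) c cvec.span_mono[of B' "R \<union> B'"] by (auto intro: cvec.span_base)
          then have "x - (x - c *\<^sub>C b) \<in> cvec.span (R \<union> B')"
            by (rule cvec.span_diff)
          then have "c *\<^sub>C b \<in> cvec.span (R \<union> B')" by simp
          from cvec.span_scale[OF this, of "inverse c"] cn False show ?thesis by simp
        qed
      qed
      then have "R \<inter> cvec.span (insert b B') = {0}"
        using cvec.subspace_0[OF R] cvec.span_zero[of "insert b B'"] by auto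
      moreover have "cvec.independent (insert b B')"
        using False cvec.span_mono[of B' "R \<union> B'"] by (intro cvec.independent_insertI B'(4)) auto
      ultimately show ?thesis
        using eq B'(1) by (intro exI[of _ "insert b B'"]) auto
    qed
  qed
  then obtain B' where B': "B' \<subseteq> B \<and> cvec.span (R \<union> B') = cvec.span (R \<union> B) \<and> R \<inter> cvec.span B' = {0} \<and>
      cvec.independent B'" ..
  show thesis
    by (rule that[of B']) (use B' finite_subset[OF _ B] in auto)
qed

text \<open>The selection \<open>h\<close> need not be linear; its users recover linearity from the
  uniqueness of the solution, if necessary after a projection.\<close>

lemma open_mapping_section:
  fixes V :: "'a::complex_vector set" and W :: "'b::complex_vector set"
  assumes "banach_on V N" "banach_on W M" "bounded_op V N W M F"
    and "cvec.subspace E" "closedin (norm_topology W M) E"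
    and "\<And>w. w \<in> W \<Longrightarrow> \<exists>v\<in>V. w - F v \<in> E"
  obtains C h where "C \<ge> 0" "\<And>w. w \<in> W \<Longrightarrow> h w \<in> V" "\<And>w. w \<in> W \<Longrightarrow> N (h w) \<le> C * M w"
    "\<And>w. w \<in> W \<Longrightarrow> w - F (h w) \<in> E"
proof (rule open_mapping_modulo[OF assms])
  fix C :: real
  assume C: "C \<ge> 0" "\<And>w. w \<in> W \<Longrightarrow> \<exists>v\<in>V. N v \<le> C * M w \<and> w - F v \<in> E"
  define h where "h w = (SOME v. v \<in> V \<and> N v \<le> C * M w \<and> w - F v \<in> E)" for w
  have "h w \<in> V \<and> N (h w) \<le> C * M w \<and> w - F (h w) \<in> E" if "w \<in> W" for w
    unfolding h_def by (rule someI_ex) (use C(2)[OF that] in blast)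
  with C(1) show thesis
    by (intro that[of C h]) simp_all
qed

text \<open>Encoded as a sum of rank one operators because two-sided compressions by such sums
  visibly lie in a fixed finite span.\<close>

definition finite_rank :: "('a::complex_normed_vector \<Rightarrow>\<^sub>L 'a) \<Rightarrow> bool"
  where "finite_rank K \<longleftrightarrow>
    (\<exists>B c. finite B \<and> (\<forall>b. c b \<in> complex_ops) \<and> K = (\<Sum>b\<in>B. rank_one b (c b)))"

text \<open>Let F be the map \<open>hat\<close>, \<open>M\<close> a complement of its kernel and
  \<open>E\<close> a finite-dimensional complement of its range. \<open>P w\<close> is the unique
  \<open>v\<close> in \<open>M\<close> with w - F v in \<open>E\<close>: uniqueness makes
  \<open>P\<close> linear, the open mapping theorem makes it bounded, and \<open>K\<close> is the
  projection onto \<open>E\<close> along the range.\<close>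

lemma tuple_right_inverse:
  fixes T :: "'m::finite \<Rightarrow> ('a::complex_banach \<Rightarrow>\<^sub>L 'a)"
  assumes T: "\<And>i. T i \<in> complex_ops"
    and compl: "complemented (hat_ker T)"
    and fin: "finite_codim UNIV (hat_ran T)"
  obtains P :: "'m \<Rightarrow> 'a \<Rightarrow>\<^sub>L 'a" and K
  where "\<And>i. P i \<in> complex_ops" "K \<in> complex_ops" "finite_rank K"
    "\<And>y. (\<Sum>i\<in>UNIV. T i (P i y)) + K y = y" "\<And>i x. K (T i x) = 0"
proof -
  let ?F = "hat (op_tuple T)"
  note F = bounded_op_hat_ops[of T, OF T]
  note LF = bounded_op_linear[OF F]
  note L = linear_onD[OF LF]
  note sU = normed_on_subspace[OF banach_on_normed[OF banach_on_powerI]]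
  define R where "R = range ?F"
  have R: "cvec.subspace R"
    unfolding R_def by (rule linear_on_image[OF LF sU])
  obtain B where B: "finite B" "cvec.span (R \<union> B) = UNIV"
    using fin by (auto simp: finite_codim_def hat_range_def R_def)
  obtain B' where B': "finite B'" "B' \<subseteq> B" "cvec.span (R \<union> B') = UNIV" "R \<inter> cvec.span B' = {0}"
      "cvec.independent B'"
    by (rule finite_complement_basis[OF R B(1), unfolded B(2)])
  obtain M where M: "cvec.subspace M" "closedin (norm_topology UNIV norm) M"
      "{v. ?F v = 0} \<inter> M = {0}" "UNIV = {w + m |w m. ?F w = 0 \<and> m \<in> M}"
    using compl by (auto simp: has_direct_complement_def hat_kernel_def)
  define E where "E = cvec.span B'"
  have E: "cvec.subspace E" "closedin (norm_topology UNIV norm) E"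
    using closed_span_finite[OF B'(1)] by (simp_all add: E_def closedin_norm_topology_UNIV)
  have BM: "banach_on M norm"
    by (rule banach_on_closed_subspace[OF banach_on_powerI M(2,1)])
  have FM: "bounded_op M norm UNIV norm ?F"
    using F by (auto simp: bounded_op_def linear_on_def)
  have surj: "\<exists>v\<in>M. w - ?F v \<in> E" for w
  proof -
    have "w \<in> cvec.span (R \<union> B')" using B'(3) by simp
    then obtain r e where re: "w = r + e" "r \<in> R" "e \<in> E"
      using R by (auto simp: cvec.span_Un E_def cvec.span_eq_iff[THEN iffD2])
    then obtain u where u: "r = ?F u" by (auto simp: R_def)
    obtain k m where "u = k + m" "?F k = 0" "m \<in> M"
      using M(4) by blast
    then have "?F m = r" using L(2)[of k m] u by simp
    then show ?thesis using re \<open>m \<in> M\<close> by (intro bexI[of _ m]) simp_all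
  qed
  obtain C P where C: "C \<ge> 0" and P': "\<And>w. w \<in> UNIV \<Longrightarrow> P w \<in> M"
      "\<And>w. w \<in> UNIV \<Longrightarrow> norm (P w) \<le> C * norm w" "\<And>w. w \<in> UNIV \<Longrightarrow> w - ?F (P w) \<in> E"
  proof (rule open_mapping_section[OF BM banach_on_UNIV FM E surj])
    fix C :: real and h
    assume "C \<ge> 0" "\<And>w. w \<in> UNIV \<Longrightarrow> h w \<in> M" "\<And>w. w \<in> UNIV \<Longrightarrow> norm (h w) \<le> C * norm w"
      "\<And>w. w \<in> UNIV \<Longrightarrow> w - ?F (h w) \<in> E"
    then show thesis by (rule that)
  qed
  note P = P'[OF UNIV_I]
  have ER: "E \<inter> R = {0}" using B'(4) by (auto simp: E_def)
  \<comment> \<open>The difference of two solutions is mapped into \<open>E\<close> and into the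
    range, so it lies in the kernel and in \<open>M\<close>.\<close>
  have uniq: "P w = v" if v: "v \<in> M" "w - ?F v \<in> E" for v w
  proof -
    have "(w - ?F v) - (w - ?F (P w)) \<in> E"
      by (rule cvec.subspace_diff[OF E(1) v(2) P(3)])
    moreover have "(w - ?F v) - (w - ?F (P w)) = ?F (P w - v)"
      using linear_on_diff[OF LF sU, of "P w" v] by simp
    ultimately have "?F (P w - v) \<in> E \<inter> R"
      by (simp add: R_def)
    then have "?F (P w - v) = 0"
      using ER by simp
    moreover have "P w - v \<in> M"
      by (rule cvec.subspace_diff[OF M(1) P(1) v(1)])
    ultimately have "P w - v \<in> {v. ?F v = 0} \<inter> M" by simp
    then show ?thesis unfolding M(3) by simp
  qed
  have P_add: "P (x + z) = P x + P z" for x z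
  proof (rule uniq)
    show "P x + P z \<in> M" by (rule cvec.subspace_add[OF M(1) P(1) P(1)])
    have "x + z - ?F (P x + P z) = (x - ?F (P x)) + (z - ?F (P z))"
      using L(2)[of "P x" "P z"] by simp
    also have "\<dots> \<in> E" by (rule cvec.subspace_add[OF E(1) P(3) P(3)])
    finally show "x + z - ?F (P x + P z) \<in> E" .
  qed
  have P_scale: "P (c *\<^sub>C x) = c *\<^sub>C P x" for c x
  proof (rule uniq)
    show "c *\<^sub>C P x \<in> M" by (rule cvec.subspace_scale[OF M(1) P(1)])
    have "c *\<^sub>C x - ?F (c *\<^sub>C P x) = c *\<^sub>C (x - ?F (P x))"
      using L(3)[of "P x" c] by (simp add: cvec.scale_right_diff_distrib)
    also have "\<dots> \<in> E" by (rule cvec.subspace_scale[OF E(1) P(3)])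
    finally show "c *\<^sub>C x - ?F (c *\<^sub>C P x) \<in> E" .
  qed
  have "\<exists>A. A \<in> complex_ops \<and> (\<forall>x. blinfun_apply A x = P x $ i)" for i
  proof -
    have P_le: "norm (P x $ i) \<le> C * norm x" for x
      using component_le_power_norm[of norm "P x" i] P(2)[of x] by (simp add: power_norm_norm)
    show ?thesis
      by (rule complex_opE[of "\<lambda>x. P x $ i" C])
        (use C in \<open>auto simp: P_add P_scale intro: P_le\<close>)
  qed
  then obtain Pi where Pi: "\<And>i. Pi i \<in> complex_ops" "\<And>i x. blinfun_apply (Pi i) x = P x $ i"
    by metis
  define K where "K = id_blinfun - (\<Sum>i\<in>UNIV. T i o\<^sub>L Pi i)"
  have K: "K \<in> complex_ops"
    unfolding K_def by (intro complex_ops_diff complex_ops_sum complex_ops_compose complex_ops_id T Pi)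
  have K_apply: "K y = y - ?F (P y)" for y
    by (simp add: K_def blinfun.diff_left blinfun.sum_left Pi(2) hat_def)
  obtain h :: "'a \<Rightarrow> 'a \<Rightarrow>\<^sub>L complex" where h: "\<And>b. h b \<in> complex_ops"
      "\<And>x. x \<in> cvec.span B' \<Longrightarrow> (\<Sum>b\<in>B'. h b x *\<^sub>C b) = x"
    using finite_span_coordinates[OF B'(1,5)] by blast
  show thesis
  proof (rule that[OF Pi(1) K])
    have "K = (\<Sum>b\<in>B'. rank_one b (h b o\<^sub>L K))"
    proof (rule blinfun_eqI)
      fix y
      have "K y \<in> cvec.span B'"
        using P(3)[of y] by (simp add: K_apply E_def)
      then show "K y = (\<Sum>b\<in>B'. rank_one b (h b o\<^sub>L K)) y"
        using h(2) by (simp add: blinfun.sum_left)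
    qed
    then show "finite_rank K"
      unfolding finite_rank_def
      by (intro exI[of _ B'] exI[of _ "\<lambda>b. h b o\<^sub>L K"] conjI allI B'(1) complex_ops_compose[OF h(1) K])
    show "(\<Sum>i\<in>UNIV. T i (Pi i y)) + K y = y" for y
      by (simp add: K_apply hat_def Pi(2))
    \<comment> \<open>\<open>T i x\<close> is in the range, so its remainder lies in the range as
      well as in \<open>E\<close>.\<close>
    show "K (T i x) = 0" for i x
    proof -
      have "?F (axis i x) = T i x" by (rule hat_axis) simp
      then have "K (T i x) = ?F (axis i x - P (T i x))"
        using linear_on_diff[OF LF sU, of "axis i x" "P (T i x)"] by (simp add: K_apply)
      then have "K (T i x) \<in> R" by (simp add: R_def)
      moreover have "K (T i x) \<in> E" using P(3) by (simp add: K_apply)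
      ultimately have "K (T i x) \<in> E \<inter> R" by blast
      then show ?thesis unfolding ER by simp
    qed
  qed
qed

text \<open>A solution \<open>h z\<close> of z - F x in the complement \<open>M\<close> of the range
  is unique only up to the kernel. With \<open>K\<close> a finite rank projection onto the kernel,
  \<rho> = I - K removes this ambiguity, so \<rho> (h z) is linear in z; its restrictions to the
  coordinate axes are the \<open>Q i\<close>.\<close>

lemma tuple_left_inverse:
  fixes T :: "'m::finite \<Rightarrow> ('a::complex_banach \<Rightarrow>\<^sub>L 'a)"
  assumes T: "\<And>i. T i \<in> complex_ops"
    and compl: "complemented (tilde_ran T)"
    and fin: "finite_dim (tilde_ker T)"
  obtains Q :: "'m \<Rightarrow> 'a \<Rightarrow>\<^sub>L 'a" and K
  where "\<And>i. Q i \<in> complex_ops" "K \<in> complex_ops" "finite_rank K"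
    "\<And>x. (\<Sum>i\<in>UNIV. Q i (T i x)) + K x = x" "\<And>i x. T i (K x) = 0"
proof -
  let ?F = "tilde (op_tuple T)"
  note F = bounded_op_tilde_ops[of T, OF T]
  note LF = bounded_op_linear[OF F]
  note L = linear_onD[OF LF]
  note sX = normed_on_subspace[OF banach_on_normed[OF banach_on_UNIV]]
  obtain B where B: "finite B" "B \<subseteq> tilde_ker T"
      "tilde_ker T \<subseteq> cvec.span B" "cvec.independent B"
    by (rule finite_dimE[OF fin])
  obtain M where M: "cvec.subspace M" "closedin (norm_topology UNIV norm) M"
      "range ?F \<inter> M = {0}" "UNIV = {w + m |w m. w \<in> range ?F \<and> m \<in> M}"
    using compl by (auto simp: has_direct_complement_def tilde_range_def)
  have surj: "\<exists>x\<in>UNIV. z - ?F x \<in> M" for z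
  proof -
    obtain x m where "z = ?F x + m" "m \<in> M" using M(4) by blast
    then show ?thesis by (intro bexI[of _ x]) simp_all
  qed
  obtain C h where C: "C \<ge> 0" and h': "\<And>z. z \<in> UNIV \<Longrightarrow> h z \<in> UNIV"
      "\<And>z. z \<in> UNIV \<Longrightarrow> norm (h z) \<le> C * norm z" "\<And>z. z \<in> UNIV \<Longrightarrow> z - ?F (h z) \<in> M"
  proof (rule open_mapping_section[OF banach_on_UNIV banach_on_powerI F M(1,2) surj])
    fix C :: real and h
    assume "C \<ge> 0" "\<And>z. z \<in> UNIV \<Longrightarrow> h z \<in> UNIV" "\<And>z. z \<in> UNIV \<Longrightarrow> norm (h z) \<le> C * norm z"
      "\<And>z. z \<in> UNIV \<Longrightarrow> z - ?F (h z) \<in> M"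
    then show thesis by (rule that)
  qed
  note h = h'(2,3)[OF UNIV_I]
  obtain g :: "'a \<Rightarrow> 'a \<Rightarrow>\<^sub>L complex" where g: "\<And>b. g b \<in> complex_ops"
      "\<And>x. x \<in> cvec.span B \<Longrightarrow> (\<Sum>b\<in>B. g b x *\<^sub>C b) = x"
    using finite_span_coordinates[OF B(1,4)] by blast
  define K where "K = (\<Sum>b\<in>B. rank_one b (g b))"
  have K: "K \<in> complex_ops" "finite_rank K"
    unfolding K_def finite_rank_def using B(1) g(1) by (auto intro: complex_ops_sum complex_ops_rank_one)
  have K_apply: "K x = (\<Sum>b\<in>B. g b x *\<^sub>C b)" for x
    by (simp add: K_def blinfun.sum_left)
  define \<rho> where "\<rho> = id_blinfun - K"
  have \<rho>: "\<rho> \<in> complex_ops"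
    unfolding \<rho>_def by (intro complex_ops_diff complex_ops_id K)
  have \<rho>_apply: "\<rho> x = x - K x" for x
    by (simp add: \<rho>_def blinfun.diff_left)
  have uniq: "\<rho> (h z) = \<rho> x" if zx: "z - ?F x \<in> M" for z x
  proof -
    have "(z - ?F x) - (z - ?F (h z)) \<in> M"
      by (rule cvec.subspace_diff[OF M(1) zx h(2)])
    moreover have "(z - ?F x) - (z - ?F (h z)) = ?F (h z - x)"
      using linear_on_diff[OF LF sX, of "h z" x] by simp
    ultimately have "?F (h z - x) \<in> range ?F \<inter> M" by simp
    then have "?F (h z - x) = 0" unfolding M(3) by simp
    then have "h z - x \<in> cvec.span B"
      using B(3) by (auto simp: tilde_kernel_def)
    then have "\<rho> (h z - x) = 0"
      using g(2) by (simp add: \<rho>_apply K_apply)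
    then show ?thesis by (simp add: blinfun.diff_right)
  qed
  define q where "q z = \<rho> (h z)" for z
  have q_add: "q (z + w) = q z + q w" for z w
  proof -
    have "z + w - ?F (h z + h w) = (z - ?F (h z)) + (w - ?F (h w))"
      using L(2)[of "h z" "h w"] by simp
    also have "\<dots> \<in> M" by (rule cvec.subspace_add[OF M(1) h(2) h(2)])
    finally have "\<rho> (h (z + w)) = \<rho> (h z + h w)" by (rule uniq)
    then show ?thesis by (simp add: q_def blinfun.add_right)
  qed
  have q_scale: "q (c *\<^sub>C z) = c *\<^sub>C q z" for c z
  proof -
    have "c *\<^sub>C z - ?F (c *\<^sub>C h z) = c *\<^sub>C (z - ?F (h z))"
      using L(3)[of "h z" c] by (simp add: cvec.scale_right_diff_distrib)
    also have "\<dots> \<in> M" by (rule cvec.subspace_scale[OF M(1) h(2)])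
    finally have "\<rho> (h (c *\<^sub>C z)) = \<rho> (c *\<^sub>C h z)" by (rule uniq)
    then show ?thesis by (simp add: q_def complex_opsD[OF \<rho>])
  qed
  have q_lin: "linear_on UNIV UNIV q"
    by (simp add: linear_on_def q_add q_scale)
  have q_le: "norm (q z) \<le> norm \<rho> * C * norm z" for z
    using norm_blinfun[of \<rho> "h z"] mult_left_mono[OF h(1)[of z], of "norm \<rho>"] by (simp add: q_def)
  have "\<exists>A. A \<in> complex_ops \<and> (\<forall>x. blinfun_apply A x = q (axis i x))" for i
  proof -
    have ax: "axis i (x + y) = axis i x + axis i y" "axis i (c *\<^sub>C x) = c *\<^sub>C axis i x" for c and x y :: 'a
      by (simp_all add: vec_eq_iff axis_def)
    have q_ax: "norm (q (axis i x)) \<le> norm \<rho> * C * norm x" for x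
      using q_le[of "axis i x"] mult_left_mono[OF norm_axis_le[of i x], of "norm \<rho> * C"] C(1) by simp
    show ?thesis
      by (rule complex_opE[of "\<lambda>x. q (axis i x)" "norm \<rho> * C"])
        (use C in \<open>auto simp: ax q_add q_scale intro: q_ax\<close>)
  qed
  then obtain Q where Q: "\<And>i. Q i \<in> complex_ops" "\<And>i x. blinfun_apply (Q i) x = q (axis i x)"
    by metis
  show thesis
  proof (rule that[OF Q(1) K])
    fix x
    have "?F x = (\<Sum>i\<in>UNIV. axis i (T i x))"
      by (simp add: vec_eq_iff tilde_def axis_def)
    then have "q (?F x) = (\<Sum>i\<in>UNIV. Q i (T i x))"
      using linear_on_sum[OF q_lin cvec.subspace_UNIV, of UNIV "\<lambda>i. axis i (T i x)"] by (simp add: Q(2))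
    moreover have "q (?F x) = \<rho> x"
      unfolding q_def by (rule uniq) (simp add: cvec.subspace_0[OF M(1)])
    ultimately have "(\<Sum>i\<in>UNIV. Q i (T i x)) = x - K x"
      by (simp only: \<rho>_apply)
    then show "(\<Sum>i\<in>UNIV. Q i (T i x)) + K x = x"
      by simp
  next
    fix i x
    have "T i b = 0" if "b \<in> B" for b
      using that B(2) by (auto simp: tilde_kernel_def tilde_def vec_eq_iff)
    then show "T i (K x) = 0"
      by (simp add: K_apply blinfun.sum_right complex_opsD[OF T])
  qed
qed

section \<open>Closed subspaces of Hilbert spaces\<close>

lemma closedin_vec_iff_closed:
  "closedin (norm_topology UNIV norm) W \<longleftrightarrow> closed (W :: ('a::complex_banach ^ 'n) set)"
proof -
  have "norm_dist UNIV norm = (dist :: 'a ^ 'n \<Rightarrow> _)"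
    by (simp add: fun_eq_iff norm_dist_def dist_norm)
  then show ?thesis by simp
qed

text \<open>The parallelogram law makes a distance-minimising sequence in \<open>W\<close> Cauchy,
  so nearest points exist; the residual of a nearest point is orthogonal to \<open>W\<close> and
  gives the decomposition.\<close>

lemma closed_subspace_inner_product_complement:
  fixes ip :: "'a::complex_banach ^ 'n \<Rightarrow> 'a ^ 'n \<Rightarrow> complex" and W :: "('a ^ 'n) set"
  assumes ip_add: "\<And>x y z. ip (x + y) z = ip x z + ip y z"
    and ip_scale: "\<And>c x y. ip (c *\<^sub>C x) y = c * ip x y"
    and ip_cnj: "\<And>x y. ip y x = cnj (ip x y)"
    and ip_norm: "\<And>x. ip x x = complex_of_real ((norm x)\<^sup>2)"
    and W: "cvec.subspace W" "closedin (norm_topology UNIV norm) W"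
  shows "has_direct_complement UNIV norm W"
proof -
  have norm_scale: "norm (c *\<^sub>C v) = cmod c * norm v" for c and v :: "'a ^ 'n"
    by (rule normed_on_scale_eq[OF banach_on_normed[OF banach_on_powerI]]) simp
  have W0: "0 \<in> W" by (rule cvec.subspace_0[OF W(1)])
  have ip_add2: "ip z (x + y) = ip z x + ip z y" for x y z
    by (subst (1 2 3) ip_cnj) (simp add: ip_add)
  have ip_scale2: "ip y (c *\<^sub>C x) = cnj c * ip y x" for c x y
    by (subst (1 2) ip_cnj) (simp add: ip_scale)
  have N_add: "(norm (u + v))\<^sup>2 = (norm u)\<^sup>2 + (norm v)\<^sup>2 + 2 * Re (ip u v)" for u v
  proof -
    have "Re (ip (u + v) (u + v)) = Re (ip u u) + Re (ip v v) + Re (ip u v) + Re (ip v u)"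
      by (simp add: ip_add ip_add2)
    moreover have "Re (ip v u) = Re (ip u v)"
      by (subst ip_cnj) simp
    ultimately show ?thesis by (simp add: ip_norm)
  qed
  have parallelogram: "(norm (u + v))\<^sup>2 + (norm (u - v))\<^sup>2 = 2 * (norm u)\<^sup>2 + 2 * (norm v)\<^sup>2"
    for u v :: "'a ^ 'n"
    using N_add[of u v] N_add[of u "- v"] ip_scale2[of u "- 1" v]
    by (simp add: cvec_scale_minus1)
  have nearest: "\<exists>w\<in>W. \<forall>w'\<in>W. norm (x - w) \<le> norm (x - w')" for x
  proof -
    define d where "d = (INF w\<in>W. norm (x - w))"
    have d_le: "d \<le> norm (x - w)" if "w \<in> W" for w
      unfolding d_def by (rule cINF_lower[OF bdd_belowI[of _ 0] that]) auto
    have d0: "0 \<le> d"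
      unfolding d_def using W0 by (intro cINF_greatest) auto
    have ex: "\<exists>w\<in>W. norm (x - w) < d + e" if "e > 0" for e
    proof (rule ccontr)
      assume "\<not> ?thesis"
      then have "d + e \<le> (INF w\<in>W. norm (x - w))"
        using W0 by (intro cINF_greatest) (auto simp: not_less)
      with that show False by (simp add: d_def)
    qed
    define r where "r k = d + inverse (real (Suc k))" for k
    have r: "r \<longlonglongrightarrow> d"
      using tendsto_add[OF tendsto_const LIMSEQ_inverse_real_of_nat, of d] by (simp add: r_def[abs_def])
    define s where "s k = (SOME w. w \<in> W \<and> norm (x - w) < r k)" for k
    have s: "s k \<in> W \<and> norm (x - s k) < r k" for k
      unfolding s_def r_def by (rule someI_ex) (use ex[of "inverse (real (Suc k))"] in auto)
    have diff: "(norm (s i - s j))\<^sup>2 \<le> 2 * (norm (x - s i))\<^sup>2 + 2 * (norm (x - s j))\<^sup>2 - 4 * d\<^sup>2" for i j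
    proof -
      \<comment> \<open>The midpoint of \<open>s i\<close> and \<open>s j\<close> is in
        \<open>W\<close>, hence at distance at least \<open>d\<close> from \<open>x\<close>. In the
        parallelogram law this bounds the distance of the two points.\<close>
      let ?m = "complex_of_real (1/2) *\<^sub>C (s i + s j)"
      have "?m \<in> W"
        using s by (intro cvec.subspace_scale[OF W(1)] cvec.subspace_add[OF W(1)]) auto
      then have "d\<^sup>2 \<le> (norm (x - ?m))\<^sup>2"
        using d_le d0 by (intro power_mono) auto
      moreover have "(x - s i) + (x - s j) = 2 *\<^sub>C (x - ?m)"
        using scaleC_add_left[of 1 1 x] by (simp add: cvec.scale_right_diff_distrib)
      then have "norm ((x - s i) + (x - s j)) = 2 * norm (x - ?m)"
        by (simp add: norm_scale)
      moreover have "norm ((x - s i) - (x - s j)) = norm (s i - s j)"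
        by (simp add: norm_minus_commute)
      ultimately show ?thesis
        using parallelogram[of "x - s i" "x - s j"] by (simp add: power_mult_distrib)
    qed
    have "Cauchy s"
    proof (rule CauchyI)
      fix \<epsilon> :: real assume \<epsilon>: "\<epsilon> > 0"
      have "(\<lambda>k. 4 * (r k)\<^sup>2 - 4 * d\<^sup>2) \<longlonglongrightarrow> 4 * d\<^sup>2 - 4 * d\<^sup>2"
        by (intro tendsto_intros r)
      then have "\<forall>\<^sub>F k in sequentially. 4 * (r k)\<^sup>2 - 4 * d\<^sup>2 < \<epsilon>\<^sup>2"
        by (rule order_tendstoD(2)) (use \<epsilon> in simp)
      then obtain K where K: "4 * (r K)\<^sup>2 - 4 * d\<^sup>2 < \<epsilon>\<^sup>2"
        by (auto simp: eventually_sequentially)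
      have "norm (s i - s j) < \<epsilon>" if "i \<ge> K" "j \<ge> K" for i j
      proof -
        have *: "(norm (x - s k))\<^sup>2 \<le> (r K)\<^sup>2" if "k \<ge> K" for k
        proof (rule power_mono)
          have "r k \<le> r K"
            using that unfolding r_def by (intro add_mono le_imp_inverse_le) auto
          then show "norm (x - s k) \<le> r K"
            using s[of k] by linarith
        qed simp
        have "(norm (s i - s j))\<^sup>2 < \<epsilon>\<^sup>2"
          using diff[of i j] *[OF that(1)] *[OF that(2)] K by linarith
        then show ?thesis
          using \<epsilon> by (simp add: power2_less_imp_less)
      qed
      then show "\<exists>K. \<forall>i\<ge>K. \<forall>j\<ge>K. norm (s i - s j) < \<epsilon>" by blast
    qed
    then obtain l where l: "s \<longlonglongrightarrow> l"
      using Cauchy_convergent_iff convergent_def by blast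
    have "l \<in> W"
      using W(2) s l unfolding closedin_vec_iff_closed by (meson closed_sequentially)
    moreover have "norm (x - l) \<le> d"
      by (rule LIMSEQ_le[OF tendsto_norm[OF tendsto_diff[OF tendsto_const l]] r])
        (use s less_imp_le in blast)
    ultimately show ?thesis
      using d_le by (meson order_trans)
  qed
  \<comment> \<open>The norm condition gives closedness by continuity and holds for residuals of
    nearest points by their choice. \<open>M_iff\<close> supplies the orthogonality that makes
    \<open>M\<close> a subspace.\<close>
  define M where "M = {m. \<forall>w\<in>W. norm m \<le> norm (m + w)}"
  have M_iff: "m \<in> M \<longleftrightarrow> (\<forall>w\<in>W. ip m w = 0)" for m
  proof
    assume m: "m \<in> M"
    show "\<forall>w\<in>W. ip m w = 0"
    proof
      fix w assume w: "w \<in> W"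
      show "ip m w = 0"
      proof (cases "w = 0")
        case True
        then show ?thesis using ip_scale2[of m 0 w] by simp
      next
        case False
        then have Nw: "norm w > 0"
          by simp
        \<comment> \<open>The coefficient that minimises norm (m + t w); a nonzero inner product
          would make that minimum smaller than norm m.\<close>
        define t where "t = - ip m w / complex_of_real ((norm w)\<^sup>2)"
        have "Re (ip m (t *\<^sub>C w)) = - (cmod (ip m w))\<^sup>2 / (norm w)\<^sup>2"
        proof -
          have "ip m (t *\<^sub>C w) = - (ip m w * cnj (ip m w)) / complex_of_real ((norm w)\<^sup>2)"
            by (subst ip_scale2) (simp add: t_def mult.commute)
          also have "\<dots> = complex_of_real (- (cmod (ip m w))\<^sup>2 / (norm w)\<^sup>2)"
            by (simp add: complex_norm_square[symmetric])
          finally show ?thesis by simp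
        qed
        moreover have "(norm (t *\<^sub>C w))\<^sup>2 = (cmod (ip m w))\<^sup>2 / (norm w)\<^sup>2"
        proof -
          have "cmod t = cmod (ip m w) / (norm w)\<^sup>2"
            by (simp add: t_def norm_divide norm_power)
          then have "norm (t *\<^sub>C w) = cmod (ip m w) / norm w"
            using Nw by (simp add: norm_scale power2_eq_square)
          then show ?thesis by (simp add: power_divide)
        qed
        moreover have "(norm m)\<^sup>2 \<le> (norm (m + t *\<^sub>C w))\<^sup>2"
          using m w cvec.subspace_scale[OF W(1)] by (intro power_mono) (auto simp: M_def)
        ultimately have "(cmod (ip m w))\<^sup>2 / (norm w)\<^sup>2 \<le> 0"
          using N_add[of m "t *\<^sub>C w"] by simp
        then have "(cmod (ip m w))\<^sup>2 \<le> 0"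
          using Nw by (simp add: divide_le_0_iff)
        then show ?thesis by simp
      qed
    qed
  next
    assume m: "\<forall>w\<in>W. ip m w = 0"
    show "m \<in> M"
      unfolding M_def
    proof (intro CollectI ballI)
      fix w assume "w \<in> W"
      then have "(norm m)\<^sup>2 \<le> (norm (m + w))\<^sup>2"
        using N_add[of m w] m by simp
      then show "norm m \<le> norm (m + w)"
        using power2_le_imp_le norm_ge_zero by blast
    qed
  qed
  show ?thesis
    unfolding has_direct_complement_def
  proof (intro exI[of _ M] conjI)
    show "cvec.subspace M"
    proof -
      have "ip 0 w = 0" for w using ip_scale[of 0 0 w] by simp
      then show ?thesis
        by (auto simp: cvec.subspace_def M_iff ip_add ip_scale)
    qed
    show "closedin (norm_topology UNIV norm) M"
      unfolding closedin_vec_iff_closed M_def Ball_def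
      by (intro closed_Collect_all closed_Collect_imp closed_Collect_le continuous_intros) simp
    show "W \<inter> M = {0}"
    proof -
      have "x = 0" if "x \<in> W" "x \<in> M" for x
        using that ip_norm[of x] by (simp add: M_iff)
      moreover have "0 \<in> M"
        using ip_scale[of 0 0] by (simp add: M_iff)
      ultimately show ?thesis
        using cvec.subspace_0[OF W(1)] by blast
    qed
    show "UNIV = {w + m |w m. w \<in> W \<and> m \<in> M}"
    proof (intro equalityI subsetI)
      fix x
      obtain w where w: "w \<in> W" "\<And>w'. w' \<in> W \<Longrightarrow> norm (x - w) \<le> norm (x - w')"
        using nearest[of x] by blast
      have "x - w \<in> M"
        unfolding M_def
      proof (intro CollectI ballI)
        fix v assume "v \<in> W"
        then show "norm (x - w) \<le> norm (x - w + v)"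
          using w(2)[of "w - v"] cvec.subspace_diff[OF W(1) w(1)] by (simp add: algebra_simps)
      qed
      moreover have "x = w + (x - w)" by simp
      ultimately show "x \<in> {w + m |w m. w \<in> W \<and> m \<in> M}"
        using w(1) by blast
    qed simp
  qed simp
qed

text \<open>The Euclidean norm of the power is the one induced by the sum of the coordinate inner
  products.\<close>

lemma hilbert_space_complement:
  fixes W :: "('a::complex_banach ^ 'n::finite) set"
  assumes H: "hilbert_space TYPE('a)"
    and W: "cvec.subspace W" "closedin (norm_topology UNIV norm) W"
  shows "has_direct_complement UNIV norm W"
proof -
  obtain ip :: "'a \<Rightarrow> 'a \<Rightarrow> complex" where ip:
    "\<And>x y z. ip (x + y) z = ip x z + ip y z" "\<And>c x y. ip (c *\<^sub>C x) y = c * ip x y"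
    "\<And>x y. ip y x = cnj (ip x y)" "\<And>x. ip x x = complex_of_real ((norm x)\<^sup>2)"
    using H unfolding hilbert_space_def by metis
  define ip' :: "'a ^ 'n \<Rightarrow> 'a ^ 'n \<Rightarrow> complex" where "ip' u v = (\<Sum>i\<in>UNIV. ip (u $ i) (v $ i))" for u v
  show ?thesis
  proof (rule closed_subspace_inner_product_complement[OF _ _ _ _ W])
    show "ip' (x + y) z = ip' x z + ip' y z" for x y z
      by (simp add: ip'_def ip(1) sum.distrib)
    show "ip' (c *\<^sub>C x) y = c * ip' x y" for c x y
      by (simp add: ip'_def ip(2) sum_distrib_left)
    show "ip' y x = cnj (ip' x y)" for x y
      unfolding ip'_def cnj_sum by (rule sum.cong) (simp_all flip: ip(3))
    show "ip' x x = complex_of_real ((norm x)\<^sup>2)" for x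
      by (simp add: ip'_def ip(4) norm_vec_def L2_set_def sum_nonneg)
  qed
qed

section \<open>Multiplication operators on an operator ideal\<close>

lemma sum_UNIV_Plus:
  fixes f :: "'n::finite + 'm::finite \<Rightarrow> 'c::comm_monoid_add"
  shows "(\<Sum>k\<in>UNIV. f k) = (\<Sum>i\<in>UNIV. f (Inl i)) + (\<Sum>j\<in>UNIV. f (Inr j))"
  by (simp flip: UNIV_Plus_UNIV add: sum.Plus)

lemma compose_rank_one: "S \<in> complex_ops \<Longrightarrow> S o\<^sub>L rank_one x f = rank_one (S x) f"
  by (rule blinfun_eqI) (simp add: complex_opsD)

lemma rank_one_compose: "rank_one x f o\<^sub>L T = rank_one x (f o\<^sub>L T)"
  by (rule blinfun_eqI) simp

lemma blinfun_compose_id: "S o\<^sub>L id_blinfun = S" "id_blinfun o\<^sub>L S = S"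
  by (auto intro: blinfun_eqI)

lemma hat_mult_tuple:
  "hat (mult_tuple S T) v = (\<Sum>i\<in>UNIV. S i o\<^sub>L v $ Inl i) + (\<Sum>j\<in>UNIV. v $ Inr j o\<^sub>L T j)"
  by (simp add: hat_def sum_UNIV_Plus mult_tuple_def)

text \<open>For sums of rank one operators, K A K' depends on \<open>A\<close> only through the
  scalars \<open>c b (A b')\<close>; the rank one operators they multiply are fixed.\<close>

lemma finite_dim_compression:
  assumes K: "finite_rank K" and K': "finite_rank K'" and J: "J \<subseteq> complex_ops"
  shows "finite_dim {K o\<^sub>L A o\<^sub>L K' | A. A \<in> J}"
proof -
  obtain B c where c: "finite B" "\<And>b. c b \<in> complex_ops" "K = (\<Sum>b\<in>B. rank_one b (c b))"
    using K unfolding finite_rank_def by metis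
  obtain B' g where g: "finite B'" "\<And>b. g b \<in> complex_ops" "K' = (\<Sum>b\<in>B'. rank_one b (g b))"
    using K' unfolding finite_rank_def by metis
  have "K o\<^sub>L A o\<^sub>L K' \<in> cvec.span ((\<lambda>(b, b'). rank_one b (g b')) ` (B \<times> B'))" if A: "A \<in> J" for A
  proof -
    have "K o\<^sub>L A o\<^sub>L K' = (\<Sum>b\<in>B. \<Sum>b'\<in>B'. c b (A b') *\<^sub>C rank_one b (g b'))"
    proof (rule blinfun_eqI)
      fix x
      have "c b (A (\<Sum>b'\<in>B'. g b' x *\<^sub>C b')) *\<^sub>C b = (\<Sum>b'\<in>B'. c b (A b') *\<^sub>C g b' x *\<^sub>C b)" for b
        using A J by (simp add: blinfun.sum_right complex_opsD subset_iff complex_opsD[OF c(2)]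
            cvec.scale_sum_left scaleC_complex_def mult.commute)
      then show "(K o\<^sub>L A o\<^sub>L K') x = (\<Sum>b\<in>B. \<Sum>b'\<in>B'. c b (A b') *\<^sub>C rank_one b (g b')) x"
        by (simp add: c(3) g(3) blinfun.sum_left)
    qed
    also have "\<dots> \<in> cvec.span ((\<lambda>(b, b'). rank_one b (g b')) ` (B \<times> B'))"
      by (intro cvec.span_sum cvec.span_scale cvec.span_base) auto
    finally show ?thesis .
  qed
  with c(1) g(1) show ?thesis
    unfolding finite_dim_def by (intro exI[of _ "(\<lambda>(b, b'). rank_one b (g b')) ` (B \<times> B')"]) auto
qed

lemma finite_dim_zero: "finite_dim {0}"
  unfolding finite_dim_def by (intro exI[of _ "{}"]) simp

lemma finite_codim_UNIV: "finite_codim UNIV UNIV"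
  unfolding finite_codim_def by (intro exI[of _ "{}"]) (auto intro: cvec.span_base)

text \<open>Makes the remainder of \<open>tuple_right_inverse\<close> disappear when the tuple is
  onto and not merely of finite codimension.\<close>

lemma op_zero_if_onto:
  assumes onto: "hat_ran T = UNIV" and K: "\<And>i x. blinfun_apply K (T i x) = 0"
  shows "K = 0"
proof (rule blinfun_eqI)
  fix y
  have "y \<in> hat_ran T" using onto by simp
  then show "K y = blinfun_apply 0 y"
    by (auto simp: hat_range_def hat_def blinfun.sum_right K)
qed

text \<open>The counterpart for the remainder of \<open>tuple_left_inverse\<close> when the joint
  kernel is trivial.\<close>

lemma op_zero_if_inj:
  assumes inj: "tilde_ker T = {0}" and K: "\<And>i x. T i (blinfun_apply K x) = 0"
  shows "K = 0"
proof (rule blinfun_eqI)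
  fix x
  have "K x \<in> tilde_ker T"
    by (simp add: tilde_kernel_def tilde_def vec_eq_iff K)
  with inj show "K x = blinfun_apply 0 x" by simp
qed

context
  fixes J :: "('b::complex_banach \<Rightarrow>\<^sub>L 'a::complex_banach) set"
    and \<alpha> :: "('b \<Rightarrow>\<^sub>L 'a) \<Rightarrow> real"
  assumes ideal: "operator_ideal J \<alpha>"
begin

lemma ideal_banach: "banach_on J \<alpha>"
  using ideal by (simp add: operator_ideal_def)

lemma ideal_normed: "normed_on J \<alpha>"
  by (rule banach_on_normed[OF ideal_banach])

lemma ideal_complex_ops: "A \<in> J \<Longrightarrow> A \<in> complex_ops"
  using ideal by (auto simp: operator_ideal_def)

lemma ideal_rank_one: "f \<in> complex_ops \<Longrightarrow> rank_one x f \<in> J"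
  and ideal_rank_one_norm: "f \<in> complex_ops \<Longrightarrow> \<alpha> (rank_one x f) = norm x * norm f"
  using ideal by (auto simp: operator_ideal_def)

lemma ideal_compose_both: "A \<in> J \<Longrightarrow> S \<in> complex_ops \<Longrightarrow> T \<in> complex_ops \<Longrightarrow> S o\<^sub>L A o\<^sub>L T \<in> J"
  and ideal_compose_both_norm: "A \<in> J \<Longrightarrow> S \<in> complex_ops \<Longrightarrow> T \<in> complex_ops \<Longrightarrow>
    \<alpha> (S o\<^sub>L A o\<^sub>L T) \<le> norm S * \<alpha> A * norm T"
  using ideal by (auto simp: operator_ideal_def)

lemma bounded_op_compose_both:
  assumes S: "S \<in> complex_ops" and T: "T \<in> complex_ops"
  shows "bounded_op J \<alpha> J \<alpha> (\<lambda>A. S o\<^sub>L A o\<^sub>L T)"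
proof -
  have "\<alpha> (S o\<^sub>L A o\<^sub>L T) \<le> (norm S * norm T) * \<alpha> A" if "A \<in> J" for A
    using ideal_compose_both_norm[OF that S T] by (simp add: mult_ac)
  moreover have "S o\<^sub>L (A + B) o\<^sub>L T = (S o\<^sub>L A o\<^sub>L T) + (S o\<^sub>L B o\<^sub>L T)" for A B :: "'b \<Rightarrow>\<^sub>L 'a"
    by (rule blinfun_eqI) (simp add: blinfun.add_left blinfun.add_right)
  moreover have "S o\<^sub>L (c *\<^sub>C A) o\<^sub>L T = c *\<^sub>C (S o\<^sub>L A o\<^sub>L T)" for c and A :: "'b \<Rightarrow>\<^sub>L 'a"
    by (rule blinfun_eqI) (simp add: complex_opsD[OF S])
  ultimately show ?thesis
    unfolding bounded_op_def linear_on_def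
    using ideal_compose_both[OF _ S T] by (auto intro!: exI[of _ "norm S * norm T"])
qed

lemma bounded_op_left: "S \<in> complex_ops \<Longrightarrow> bounded_op J \<alpha> J \<alpha> (\<lambda>A. S o\<^sub>L A)"
  using bounded_op_compose_both[of S id_blinfun] by (simp add: blinfun_compose_id)

lemma bounded_op_right: "T \<in> complex_ops \<Longrightarrow> bounded_op J \<alpha> J \<alpha> (\<lambda>A. A o\<^sub>L T)"
  using bounded_op_compose_both[of id_blinfun T] by (simp add: blinfun_compose_id)

text \<open>Compressing \<open>A\<close> by rank one operators to \<open>f (A x)\<close> times a rank one operator
  recovers the operator norm from \<open>\<alpha>\<close>.\<close>

lemma ideal_norm_le:
  assumes A: "A \<in> J"
  shows "norm A \<le> \<alpha> A"
proof (rule norm_blinfun_bound)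
  show "0 \<le> \<alpha> A" by (rule normed_on_nonneg[OF ideal_normed A])
  fix x
  show "norm (A x) \<le> \<alpha> A * norm x"
  proof (cases "A x = 0")
    case True
    then show ?thesis
      using normed_on_nonneg[OF ideal_normed A] by simp
  next
    case False
    then have x: "x \<noteq> 0" by auto
    obtain f :: "'a \<Rightarrow>\<^sub>L complex" where f: "f \<in> complex_ops" "norm f \<le> 1" "f (A x) = complex_of_real (norm (A x))"
      by (rule norming_functional)
    obtain g :: "'b \<Rightarrow>\<^sub>L complex" where g: "g \<in> complex_ops" "norm g \<le> 1" "g x = complex_of_real (norm x)"
      by (rule norming_functional)
    have g0: "norm g > 0"
      using g(3) x by auto
    define z where "z = A x"
    have "rank_one z f o\<^sub>L A o\<^sub>L rank_one x g = rank_one (norm z *\<^sub>R z) g"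
    proof (rule blinfun_eqI)
      fix y
      have "A (g y *\<^sub>C x) = g y *\<^sub>C z"
        by (simp add: z_def complex_opsD[OF ideal_complex_ops[OF A]])
      then show "(rank_one z f o\<^sub>L A o\<^sub>L rank_one x g) y = rank_one (norm z *\<^sub>R z) g y"
        using f(3) by (simp add: complex_opsD[OF f(1)] z_def scaleC_complex_def flip: scaleC_of_real)
    qed
    then have "norm (norm z *\<^sub>R z) * norm g \<le> norm (rank_one z f) * \<alpha> A * norm (rank_one x g)"
      using ideal_compose_both_norm[OF A complex_ops_rank_one[OF f(1), of z] complex_ops_rank_one[OF g(1), of x]]
        ideal_rank_one_norm[OF g(1), of "norm z *\<^sub>R z"] by simp
    also have "\<dots> \<le> norm z * \<alpha> A * (norm x * norm g)"
    proof (intro mult_mono)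
      show "norm (rank_one z f) \<le> norm z"
      proof (rule norm_blinfun_bound)
        fix y
        have "norm (f y) \<le> 1 * norm y"
          using norm_blinfun[of f y] mult_right_mono[OF f(2) norm_ge_zero[of y]] by linarith
        then show "norm (rank_one z f y) \<le> norm z * norm y"
          using mult_right_mono[OF _ norm_ge_zero[of z], of "norm (f y)" "norm y"]
          by (simp add: norm_scaleC mult.commute)
      qed simp
      show "norm (rank_one x g) \<le> norm x * norm g"
      proof (rule norm_blinfun_bound)
        fix y
        have "norm (g y) * norm x \<le> (norm g * norm y) * norm x"
          by (intro mult_right_mono norm_blinfun) simp
        then show "norm (rank_one x g y) \<le> norm x * norm g * norm y"
          by (simp add: norm_scaleC mult_ac)
      qed simp
    qed (use normed_on_nonneg[OF ideal_normed A] in auto)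
    finally have "norm z * norm g * norm z \<le> norm z * norm g * (\<alpha> A * norm x)"
      by (simp add: mult_ac)
    moreover have "norm z * norm g > 0"
      using g0 False by (simp add: z_def)
    ultimately show ?thesis
      by (simp only: mult_le_cancel_left_pos z_def)
  qed
qed

context
  fixes S :: "'n::finite \<Rightarrow> ('a \<Rightarrow>\<^sub>L 'a)" and T :: "'m::finite \<Rightarrow> ('b \<Rightarrow>\<^sub>L 'b)"
  assumes S: "\<And>i. S i \<in> complex_ops" and T: "\<And>j. T j \<in> complex_ops"
begin

abbreviation "LR \<equiv> mult_tuple S T"

lemma bounded_op_mult_tuple: "bounded_op J \<alpha> J \<alpha> (LR k)"
  using bounded_op_left[OF S] bounded_op_right[OF T]
  by (cases k) (simp_all add: mult_tuple_def[abs_def])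

lemma bounded_op_hat_LR:
  "bounded_op (power_space J) (power_norm \<alpha>) J \<alpha> (hat LR)"
  by (rule bounded_op_hat[OF ideal_normed bounded_op_mult_tuple])

lemma bounded_op_tilde_LR:
  "bounded_op J \<alpha> (power_space J) (power_norm \<alpha>) (tilde LR)"
  by (rule bounded_op_tilde[OF ideal_normed bounded_op_mult_tuple])

section \<open>Lower bounds: almost annihilating vectors and functionals\<close>

text \<open>\<open>C\<close> is the open mapping constant, \<open>B\<close> spans the defect of the
  range, and \<epsilon> is so small that n + m error terms of size C \<epsilon> total at most 1/4,
  safely below the value 1/2 of the functional at its test vector.\<close>

definition controlled_lifts :: "real \<Rightarrow> ('b \<Rightarrow>\<^sub>L 'a) set \<Rightarrow> real \<Rightarrow> bool"
  where "controlled_lifts C B \<epsilon> \<longleftrightarrow> C \<ge> 0 \<and> \<epsilon> > 0 \<and> (real CARD('n) + real CARD('m)) * C * \<epsilon> \<le> 1/4 \<and>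
    (\<forall>A\<in>J. \<exists>v\<in>power_space J. power_norm \<alpha> v \<le> C * \<alpha> A \<and> A - hat LR v \<in> cvec.span B)"

lemma finite_codim_lifts:
  assumes "finite_codim J (hat_range J LR)"
  obtains B C \<epsilon> where "finite B" "B \<subseteq> J" "controlled_lifts C B \<epsilon>"
proof -
  let ?F = "hat LR"
  note F = bounded_op_hat_LR
  obtain B where B: "finite B" "B \<subseteq> J" "J \<subseteq> cvec.span (?F ` power_space J \<union> B)"
    using assms by (auto simp: finite_codim_def hat_range_def)
  have sub: "cvec.subspace (?F ` power_space J)"
    by (rule linear_on_image[OF bounded_op_linear[OF F]
          normed_on_subspace[OF normed_on_power[OF ideal_normed]]])
  have surj: "\<exists>v\<in>power_space J. A - ?F v \<in> cvec.span B" if A: "A \<in> J" for A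
  proof -
    have "A \<in> cvec.span (?F ` power_space J \<union> B)"
      using A B(3) by blast
    then obtain r e where re: "A = r + e" "r \<in> ?F ` power_space J" "e \<in> cvec.span B"
      unfolding cvec.span_Un using cvec.span_eq_iff[THEN iffD2, OF sub] by auto
    then obtain v where "v \<in> power_space J" "r = ?F v" by blast
    with re show ?thesis
      by (intro bexI[of _ v]) simp_all
  qed
  show thesis
  proof (rule open_mapping_modulo[OF banach_on_power[OF ideal_banach] ideal_banach F cvec.subspace_span
        closedin_span_finite[OF ideal_normed B(1,2)] surj])
    fix C
    assume C: "C \<ge> 0" "\<And>A. A \<in> J \<Longrightarrow> \<exists>v\<in>power_space J. power_norm \<alpha> v \<le> C * \<alpha> A \<and> A - ?F v \<in> cvec.span B"
    \<comment> \<open>The added 1 keeps \<epsilon> positive even if \<open>D\<close> is 0.\<close>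
    define D \<epsilon> where "D = (real CARD('n) + real CARD('m)) * C" and "\<epsilon> = 1 / (4 * (D + 1))"
    have "D \<ge> 0" using C(1) by (simp add: D_def)
    then have "\<epsilon> > 0" "D * \<epsilon> \<le> 1/4"
      by (simp_all add: \<epsilon>_def field_simps)
    with B(1,2) C show thesis
      by (intro that[of B C \<epsilon>]) (simp_all add: controlled_lifts_def D_def)
  qed
qed

text \<open>Transfers the \<alpha>-control of a lift to vectors, as \<alpha> dominates the operator
  norm.\<close>

lemma component_bound:
  assumes v: "v \<in> power_space J" and A: "power_norm \<alpha> v \<le> D"
  shows "norm (blinfun_apply (v $ k) x) \<le> D * norm x"
proof -
  have "norm (v $ k) \<le> D"
    using ideal_norm_le[OF power_spaceD[OF v], of k] component_le_power_norm[of \<alpha> v k] A by simp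
  then show ?thesis
    using norm_blinfun[of "v $ k" x] mult_right_mono[of "norm (v $ k)" D "norm x"] by simp
qed

text \<open>The operator \<open>rank_one y g\<close> with g x = 1 is lifted to \<open>v\<close>
  modulo the span of \<open>B\<close>. Evaluation at \<open>x\<close> followed by \<open>f\<close>
  returns f y and kills the defect; each component of \<open>v\<close> then meets some
  \<open>f o\<^sub>L S i\<close> or some \<open>T j x\<close>, both of norm at most \<epsilon>. So f
  y would be at most 1/4.\<close>

lemma no_almost_annihilating_pair:
  assumes lifts: "controlled_lifts C B \<epsilon>"
    and f: "norm y = 1" "f \<in> complex_ops" "norm f \<le> 1" "1/2 \<le> cmod (f y)" "\<And>i. norm (f o\<^sub>L S i) \<le> \<epsilon>"
    and x: "norm x = 1" "\<And>j. norm (T j x) \<le> \<epsilon>"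
    and fB: "\<And>b. b \<in> B \<Longrightarrow> f (blinfun_apply b x) = 0"
  shows False
proof -
  have C: "C \<ge> 0" "\<And>A. A \<in> J \<Longrightarrow>
      \<exists>v\<in>power_space J. power_norm \<alpha> v \<le> C * \<alpha> A \<and> A - hat LR v \<in> cvec.span B"
    and \<epsilon>: "\<epsilon> > 0" "(real CARD('n) + real CARD('m)) * C * \<epsilon> \<le> 1/4"
    using lifts by (auto simp: controlled_lifts_def)
  obtain g :: "'b \<Rightarrow>\<^sub>L complex" where g: "g \<in> complex_ops" "norm g \<le> 1" "g x = complex_of_real (norm x)"
    by (rule norming_functional)
  let ?A = "rank_one y g"
  have "\<alpha> ?A \<le> 1"
    using g(2) f(1) by (simp add: ideal_rank_one_norm[OF g(1)])
  then have CA: "C * \<alpha> ?A \<le> C"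
    using mult_left_mono[OF _ C(1), of "\<alpha> ?A" 1] by simp
  obtain v where v: "v \<in> power_space J" "power_norm \<alpha> v \<le> C * \<alpha> ?A"
      "?A - hat LR v \<in> cvec.span B"
    using C(2)[OF ideal_rank_one[OF g(1)], of y] by blast
  have vle: "power_norm \<alpha> v \<le> C" using v(2) CA by simp
  have "cvec.span B \<subseteq> {\<kappa>. f (blinfun_apply \<kappa> x) = 0}"
  proof (rule cvec.span_minimal)
    show "B \<subseteq> {\<kappa>. f (blinfun_apply \<kappa> x) = 0}"
      using fB by blast
    show "cvec.subspace {\<kappa>. f (blinfun_apply \<kappa> x) = 0}"
      by (auto simp: cvec.subspace_def blinfun.add_left blinfun.add_right complex_opsD[OF f(2)])
  qed
  then have "f ((?A - hat LR v) x) = 0"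
    using v(3) by blast
  moreover have "?A x = y"
    using g(3) x(1) cvec.scale_one[of y] by simp
  ultimately have "f y = f (hat LR v x)"
    by (simp add: blinfun.diff_left blinfun.diff_right)
  also have "\<dots> = (\<Sum>i\<in>UNIV. (f o\<^sub>L S i) ((v $ Inl i) x)) + (\<Sum>j\<in>UNIV. f ((v $ Inr j) (T j x)))"
    by (simp add: hat_mult_tuple blinfun.add_left blinfun.sum_left blinfun.add_right blinfun.sum_right)
  finally have "cmod (f y) \<le> cmod (\<Sum>i\<in>UNIV. (f o\<^sub>L S i) ((v $ Inl i) x)) +
      cmod (\<Sum>j\<in>UNIV. f ((v $ Inr j) (T j x)))"
    by (simp add: norm_triangle_ineq)
  also have "\<dots> \<le> (\<Sum>i\<in>(UNIV :: 'n set). C * \<epsilon>) + (\<Sum>j\<in>(UNIV :: 'm set). C * \<epsilon>)"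
  proof (intro add_mono order_trans[OF norm_sum sum_mono])
    fix i
    have "norm ((f o\<^sub>L S i) ((v $ Inl i) x)) \<le> norm (f o\<^sub>L S i) * norm ((v $ Inl i) x)"
      by (rule norm_blinfun)
    also have "\<dots> \<le> \<epsilon> * (C * norm x)"
      using \<epsilon>(1) by (intro mult_mono f component_bound[OF v(1) vle]) simp_all
    finally show "norm ((f o\<^sub>L S i) ((v $ Inl i) x)) \<le> C * \<epsilon>"
      using x(1) by (simp add: mult.commute)
  next
    fix j
    have "norm (f ((v $ Inr j) (T j x))) \<le> norm f * norm ((v $ Inr j) (T j x))"
      by (rule norm_blinfun)
    also have "\<dots> \<le> 1 * (C * norm (T j x))"
      by (intro mult_mono f component_bound[OF v(1) vle]) simp_all
    also have "\<dots> \<le> C * \<epsilon>"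
      using mult_left_mono[OF x(2) C(1)] by simp
    finally show "norm (f ((v $ Inr j) (T j x))) \<le> C * \<epsilon>" .
  qed
  also have "\<dots> \<le> 1/4"
    using \<epsilon>(2) by (simp add: algebra_simps)
  finally show False
    using f(4) by simp
qed

text \<open>Here \<open>x\<close> is chosen first. The vectors b x are finitely many, so by infinite
  codimension the tuple \<open>S\<close> is not onto even modulo their span, and the functional can
  be made to vanish on them.\<close>

lemma finite_codim_left_factor:
  assumes fin: "finite_codim J (hat_range J LR)"
    and not: "tilde_ker T \<noteq> {0} \<or> \<not> closed_ran T"
  shows "finite_codim UNIV (hat_ran S)"
proof (rule ccontr)
  assume inf: "\<not> finite_codim UNIV (hat_ran S)"
  obtain B C \<epsilon> where B: "finite B" "B \<subseteq> J" and lifts: "controlled_lifts C B \<epsilon>"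
    using finite_codim_lifts[OF fin] by blast
  then have \<epsilon>: "\<epsilon> > 0" by (simp add: controlled_lifts_def)
  obtain x where x: "norm x = 1" "\<And>j. norm (T j x) \<le> \<epsilon>"
    using not_bounded_below_almost_kernel[of T, OF T not \<epsilon>] by blast
  let ?Y = "(\<lambda>b. blinfun_apply b x) ` B"
  have Y: "finite ?Y" using B(1) by simp
  have ns: "\<not> (\<forall>w. \<exists>v. w - hat (op_tuple S) v \<in> cvec.span ?Y)"
    using inf finite_codim_if_onto_modulo[OF Y, of S] by blast
  show False
  proof (rule not_onto_almost_annihilator[of S "cvec.span ?Y" \<epsilon>,
        OF S cvec.subspace_span closed_span_finite[OF Y] ns \<epsilon>])
    fix y and f :: "'a \<Rightarrow>\<^sub>L complex"
    assume f: "norm y = 1" "f \<in> complex_ops" "norm f \<le> 1" "1/2 \<le> cmod (f y)" "\<And>i. norm (f o\<^sub>L S i) \<le> \<epsilon>"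
      and f0: "\<And>e. e \<in> cvec.span ?Y \<Longrightarrow> f e = 0"
    show False
      by (rule no_almost_annihilating_pair[OF lifts f x]) (auto intro!: f0 cvec.span_base)
  qed
qed

text \<open>Here \<open>f\<close> is chosen first. The defect is then killed by placing
  \<open>x\<close> in the kernels of the finitely many functionals \<open>f o\<^sub>L b\<close>,
  which is possible as \<open>T\<close> is not upper semi-Fredholm.\<close>

lemma surjective_left_factor:
  assumes fin: "finite_codim J (hat_range J LR)"
    and not: "\<not> (finite_dim (tilde_ker T) \<and> closed_ran T)"
  shows "hat_ran S = UNIV"
proof (rule ccontr)
  assume "hat_ran S \<noteq> UNIV"
  then have ns: "\<not> (\<forall>w. \<exists>v. w - hat (op_tuple S) v \<in> {0})"
    by (auto simp: hat_range_def)
  obtain B C \<epsilon> where B: "finite B" "B \<subseteq> J" and lifts: "controlled_lifts C B \<epsilon>"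
    using finite_codim_lifts[OF fin] by blast
  then have \<epsilon>: "\<epsilon> > 0" by (simp add: controlled_lifts_def)
  show False
  proof (rule not_onto_almost_annihilator[of S "{0}" \<epsilon>,
        OF S cvec.subspace_single_0 closed_singleton ns \<epsilon>])
    fix y and f :: "'a \<Rightarrow>\<^sub>L complex"
    assume f: "norm y = 1" "f \<in> complex_ops" "norm f \<le> 1" "1/2 \<le> cmod (f y)" "\<And>i. norm (f o\<^sub>L S i) \<le> \<epsilon>"
    have G: "finite ((\<lambda>b. f o\<^sub>L b) ` B)" "(\<lambda>b. f o\<^sub>L b) ` B \<subseteq> complex_ops"
      using B f(2) ideal_complex_ops by (auto intro: complex_ops_compose)
    obtain x where x: "norm x = 1" "\<And>g. g \<in> (\<lambda>b. f o\<^sub>L b) ` B \<Longrightarrow> blinfun_apply g x = 0"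
        "\<And>j. norm (T j x) \<le> \<epsilon>"
      by (rule not_semi_Fredholm_almost_ker[of T, OF T not G \<epsilon>]) (rule that; blast)
    have fB: "f (blinfun_apply b x) = 0" if "b \<in> B" for b
      using x(2)[of "f o\<^sub>L b"] that by simp
    show False
      by (rule no_almost_annihilating_pair[OF lifts f x(1,3) fB])
  qed
qed

text \<open>The image of \<open>rank_one (x k) (f k)\<close> has the components
  \<open>rank_one (S i (x k)) (f k)\<close> and \<open>rank_one (x k) (f k o\<^sub>L T j)\<close>,
  whose \<alpha>-norms are products of norms and tend to 0. Separation in operator norm gives
  separation in \<alpha>, which finite kernel and closed range exclude.\<close>

lemma no_separated_rank_one_sequence:
  assumes fin: "finite_dim (tilde_kernel J LR)"
    and closed: "closedin (norm_topology (power_space J) (power_norm \<alpha>)) (tilde_range J LR)"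
    and x: "\<And>k. norm (x k) = 1" "\<And>k i. norm (S i (x k)) \<le> inverse (real (Suc k))"
    and f: "\<And>k. f k \<in> complex_ops" "\<And>k. norm (f k) \<le> 1"
      "\<And>k j. norm (f k o\<^sub>L T j) \<le> inverse (real (Suc k))"
    and sep: "\<And>j k. j < k \<Longrightarrow> 1/4 \<le> norm (rank_one (x k) (f k) - rank_one (x j) (f j))"
  shows False
proof -
  let ?F = "tilde LR"
  define A where "A k = rank_one (x k) (f k)" for k
  have A: "A k \<in> J" "\<alpha> (A k) \<le> 1" for k
    using f x by (simp_all add: A_def ideal_rank_one ideal_rank_one_norm)
  note F = bounded_op_tilde_LR
  have le: "power_norm \<alpha> (?F (A k)) \<le> (real CARD('n) + real CARD('m)) * inverse (real (Suc k))" for k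
  proof -
    have "power_norm \<alpha> (?F (A k)) \<le> (\<Sum>c\<in>UNIV. \<alpha> (?F (A k) $ c))"
      by (rule power_norm_le_sum[OF ideal_normed linear_onD(1)[OF bounded_op_linear[OF F] A(1)]])
    also have "\<dots> = (\<Sum>i\<in>UNIV. norm (S i (x k)) * norm (f k)) + (\<Sum>j\<in>UNIV. norm (f k o\<^sub>L T j))"
      using f(1) T x(1) by (simp add: sum_UNIV_Plus tilde_def mult_tuple_def A_def compose_rank_one[OF S]
          rank_one_compose ideal_rank_one_norm complex_ops_compose)
    also have "\<dots> \<le> (\<Sum>i\<in>(UNIV :: 'n set). inverse (real (Suc k)) * 1) + (\<Sum>j\<in>(UNIV :: 'm set). inverse (real (Suc k)))"
      using x f by (intro add_mono sum_mono mult_mono) auto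
    also have "\<dots> = (real CARD('n) + real CARD('m)) * inverse (real (Suc k))"
      by (simp add: distrib_right)
    finally show ?thesis .
  qed
  have lim: "(\<lambda>k. power_norm \<alpha> (?F (A k))) \<longlonglongrightarrow> 0"
  proof (rule tendsto_sandwich[OF _ _ tendsto_const tendsto_mult_right_zero[OF LIMSEQ_inverse_real_of_nat]])
    show "\<forall>\<^sub>F k in sequentially. power_norm \<alpha> (?F (A k)) \<le>
        (real CARD('n) + real CARD('m)) * inverse (real (Suc k))"
      by (intro always_eventually allI le)
  qed (simp add: power_norm_def L2_set_nonneg)
  have sep': "1/4 \<le> \<alpha> (A k - A j)" if "j < k" for j k
    using sep[OF that] ideal_norm_le[OF normed_on_diff[OF ideal_normed A(1) A(1)], of k j]
    by (simp add: A_def)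
  show False
    by (rule no_separated_almost_kernel[OF ideal_banach banach_on_power[OF ideal_banach] F
          fin[unfolded tilde_kernel_def] closed[unfolded tilde_range_def] A lim _ sep']) simp
qed

text \<open>The functionals \<open>f k\<close> come from mere failure of surjectivity and need not
  be separated. The separation has to come from the vectors: each \<open>x k\<close> is chosen in
  the kernels of functionals that norm the earlier ones.\<close>

lemma semi_Fredholm_left_factor:
  assumes fin: "finite_dim (tilde_kernel J LR)"
    and closed: "closedin (norm_topology (power_space J) (power_norm \<alpha>)) (tilde_range J LR)"
    and not: "\<not> (finite_dim (tilde_ker S) \<and>
      closed_ran S)"
  shows "hat_ran T = UNIV"
proof (rule ccontr)
  assume "hat_ran T \<noteq> UNIV"
  then have ns: "\<not> (\<forall>w. \<exists>v. w - hat (op_tuple T) v \<in> {0})"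
    by (auto simp: hat_range_def)
  have "\<exists>y (f :: 'b \<Rightarrow>\<^sub>L complex). f \<in> complex_ops \<and> norm f \<le> 1 \<and>
      (\<forall>j. norm (f o\<^sub>L T j) \<le> inverse (real (Suc k))) \<and> norm y = 1 \<and> 1/2 \<le> cmod (f y)" for k
    by (rule not_onto_almost_annihilator[of T "{0}" "inverse (real (Suc k))",
          OF T cvec.subspace_single_0 closed_singleton ns]) auto
  then obtain y and f :: "nat \<Rightarrow> 'b \<Rightarrow>\<^sub>L complex" where f': "\<And>k. f k \<in> complex_ops \<and> norm (f k) \<le> 1 \<and>
      (\<forall>j. norm (f k o\<^sub>L T j) \<le> inverse (real (Suc k))) \<and> norm (y k) = 1 \<and> 1/2 \<le> cmod (f k (y k))"
    by metis
  \<comment> \<open>A pair consists of a vector and a functional norming it; each new vector is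
    annihilated by all earlier functionals.\<close>
  define Q where "Q q k r \<longleftrightarrow> norm (fst r) = 1 \<and> (\<forall>i. norm (S i (fst r)) \<le> inverse (real (Suc k))) \<and>
      snd r \<in> complex_ops \<and> norm (snd r) \<le> 1 \<and> snd r (fst r) = 1 \<and>
      (\<forall>j<k. (snd (q j)) (fst r) = 0)"
    for q :: "nat \<Rightarrow> 'a \<times> ('a \<Rightarrow>\<^sub>L complex)" and k :: nat and r :: "'a \<times> ('a \<Rightarrow>\<^sub>L complex)"
  have "\<exists>q. \<forall>k. Q q k (q k)"
  proof (rule dependent_wellorder_choice)
    show "Q q k r = Q q' k r" if "\<And>j. j < k \<Longrightarrow> q j = q' j" for q q' k r
      using that by (simp add: Q_def)
    fix k q
    assume IH: "\<And>j. j < k \<Longrightarrow> Q q j (q j)"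
    have G: "finite ((\<lambda>j. snd (q j)) ` {..<k})" "(\<lambda>j. snd (q j)) ` {..<k} \<subseteq> complex_ops"
      using IH by (auto simp: Q_def)
    have pos: "inverse (real (Suc k)) > 0" by simp
    obtain x where x: "norm x = 1" "\<And>g. g \<in> (\<lambda>j. snd (q j)) ` {..<k} \<Longrightarrow> blinfun_apply g x = 0"
        "\<And>i. norm (S i x) \<le> inverse (real (Suc k))"
      by (rule not_semi_Fredholm_almost_ker[of S, OF S not G pos]) (rule that; blast)
    obtain g :: "'a \<Rightarrow>\<^sub>L complex" where g: "g \<in> complex_ops" "norm g \<le> 1" "g x = complex_of_real (norm x)"
      by (rule norming_functional)
    show "\<exists>r. Q q k r"
      using x g by (intro exI[of _ "(x, g)"]) (auto simp: Q_def)
  qed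
  then obtain q where q: "\<And>k. Q q k (q k)" by blast
  define x g where "x k = fst (q k)" and "g k = snd (q k)" for k
  have x: "norm (x k) = 1" "norm (S i (x k)) \<le> inverse (real (Suc k))" for k i
    using q[of k] by (simp_all add: Q_def x_def)
  have g: "g k \<in> complex_ops" "norm (g k) \<le> 1" "g k (x k) = 1" for k
    using q[of k] by (simp_all add: Q_def x_def g_def)
  have gx: "g j (x k) = 0" if "j < k" for j k
    using q[of k] that by (simp add: Q_def x_def g_def)
  have f: "f k \<in> complex_ops" "norm (f k) \<le> 1" "norm (f k o\<^sub>L T j) \<le> inverse (real (Suc k))"
      "norm (y k) = 1" "1/2 \<le> cmod (f k (y k))" for k j
    using f'[of k] by simp_all
  have "1/4 \<le> norm (rank_one (x k) (f k) - rank_one (x j) (f j))" if "j < k" for j k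
  proof -
    \<comment> \<open>norm z is at least \<open>cmod (f j (y k))\<close>, as \<open>g j\<close>
      shows, and at least \<open>cmod (f k (y k))\<close> minus that number. Adding both bounds
      gives 2 norm z >= 1/2.\<close>
    define z where "z = f k (y k) *\<^sub>C x k - f j (y k) *\<^sub>C x j"
    have "norm z \<le> norm (rank_one (x k) (f k) - rank_one (x j) (f j)) * norm (y k)"
      using norm_blinfun[of "rank_one (x k) (f k) - rank_one (x j) (f j)" "y k"]
      by (simp add: z_def blinfun.diff_left)
    moreover have "cmod (f j (y k)) \<le> norm z"
    proof -
      have "g j z = - f j (y k)"
        using gx[OF that] g(3)[of j] by (simp add: z_def blinfun.diff_right complex_opsD[OF g(1)] scaleC_complex_def)
      then show ?thesis
        using norm_blinfun[of "g j" z] mult_right_mono[OF g(2)[of j], of "norm z"] by simp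
    qed
    moreover have "cmod (f k (y k)) - cmod (f j (y k)) \<le> norm z"
      using norm_triangle_ineq2[of "f k (y k) *\<^sub>C x k" "f j (y k) *\<^sub>C x j"] x(1)
      by (simp add: z_def norm_scaleC)
    ultimately show ?thesis
      using f(5)[of k] f(4)[of k] by simp
  qed
  then show False
    by (rule no_separated_rank_one_sequence[OF fin closed x f(1-3)])
qed

text \<open>The roles are exchanged: the \<open>x k\<close> are any almost kernel vectors of
  \<open>S\<close>, and the functionals are kept apart by vanishing at all earlier test vectors,
  which infinite codimension of the range for \<open>T\<close> allows.\<close>

lemma finite_codim_right_factor:
  assumes fin: "finite_dim (tilde_kernel J LR)"
    and closed: "closedin (norm_topology (power_space J) (power_norm \<alpha>)) (tilde_range J LR)"
    and not: "tilde_ker S \<noteq> {0} \<or>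
      \<not> closed_ran S"
  shows "finite_codim UNIV (hat_ran T)"
proof (rule ccontr)
  assume inf: "\<not> finite_codim UNIV (hat_ran T)"
  have "\<exists>x. norm x = 1 \<and> (\<forall>i. norm (S i x) \<le> inverse (real (Suc k)))" for k
    by (rule not_bounded_below_almost_kernel[of S "inverse (real (Suc k))", OF S not]) auto
  then obtain x where x': "\<And>k. norm (x k) = 1 \<and> (\<forall>i. norm (S i (x k)) \<le> inverse (real (Suc k)))"
    by metis
  have x: "norm (x k) = 1" "norm (S i (x k)) \<le> inverse (real (Suc k))" for k i
    using x' by simp_all
  define Q where "Q q k r \<longleftrightarrow> norm (fst r) = 1 \<and> snd r \<in> complex_ops \<and> norm (snd r) \<le> 1 \<and>
      1/2 \<le> cmod (snd r (fst r)) \<and> (\<forall>j. norm (snd r o\<^sub>L T j) \<le> inverse (real (Suc k))) \<and>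
      (\<forall>j<k. snd r (fst (q j)) = 0)"
    for q :: "nat \<Rightarrow> 'b \<times> ('b \<Rightarrow>\<^sub>L complex)" and k :: nat and r :: "'b \<times> ('b \<Rightarrow>\<^sub>L complex)"
  have "\<exists>q. \<forall>k. Q q k (q k)"
  proof (rule dependent_wellorder_choice)
    show "Q q k r = Q q' k r" if "\<And>j. j < k \<Longrightarrow> q j = q' j" for q q' k r
      using that by (simp add: Q_def)
    fix k :: nat and q :: "nat \<Rightarrow> 'b \<times> ('b \<Rightarrow>\<^sub>L complex)"
    define Y where "Y = (\<lambda>j. fst (q j)) ` {..<k}"
    have Y: "finite Y" by (simp add: Y_def)
    have ns: "\<not> (\<forall>w. \<exists>v. w - hat (op_tuple T) v \<in> cvec.span Y)"
      using inf finite_codim_if_onto_modulo[OF Y, of T] by blast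
    show "\<exists>r. Q q k r"
    proof (rule not_onto_almost_annihilator[of T "cvec.span Y" "inverse (real (Suc k))",
          OF T cvec.subspace_span closed_span_finite[OF Y] ns])
      fix y and f :: "'b \<Rightarrow>\<^sub>L complex"
      assume f: "norm y = 1" "f \<in> complex_ops" "norm f \<le> 1" "1/2 \<le> cmod (f y)"
        "\<And>i. norm (f o\<^sub>L T i) \<le> inverse (real (Suc k))" "\<And>e. e \<in> cvec.span Y \<Longrightarrow> f e = 0"
      have "f (fst (q j)) = 0" if "j < k" for j
        by (rule f(6), rule cvec.span_base) (use that in \<open>auto simp: Y_def\<close>)
      with f(1-5) show ?thesis
        by (intro exI[of _ "(y, f)"]) (simp add: Q_def)
    qed simp
  qed
  then obtain q where q: "\<And>k. Q q k (q k)" by blast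
  define f y where "f k = snd (q k)" and "y k = fst (q k)" for k
  have f: "f k \<in> complex_ops" "norm (f k) \<le> 1" "norm (f k o\<^sub>L T j) \<le> inverse (real (Suc k))"
      "norm (y k) = 1" "1/2 \<le> cmod (f k (y k))" for k j
    using q[of k] by (simp_all add: Q_def f_def y_def)
  have fy: "f k (y j) = 0" if "j < k" for j k
    using q[of k] that by (simp add: Q_def f_def y_def)
  have "1/4 \<le> norm (rank_one (x k) (f k) - rank_one (x j) (f j))" if "j < k" for j k
  proof -
    \<comment> \<open>At the earlier test vector \<open>y j\<close> the later operator
      vanishes.\<close>
    have "norm ((rank_one (x k) (f k) - rank_one (x j) (f j)) (y j)) = cmod (f j (y j))"
      using fy[OF that] x(1) by (simp add: blinfun.diff_left norm_scaleC)
    then show ?thesis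
      using norm_blinfun[of "rank_one (x k) (f k) - rank_one (x j) (f j)" "y j"] f(4,5)[of j] by simp
  qed
  then show False
    by (rule no_separated_rank_one_sequence[OF fin closed x f(1-3)])
qed

section \<open>Upper bounds: generalized inverses of the multiplication tuple\<close>

text \<open>The annihilation hypotheses concern the compressions and not K S_i or T_j K' alone, so
  that they also hold if one remainder is 0 and the other is the identity with zero
  coefficients.\<close>

lemma hat_mult_tuple_complemented:
  assumes ops: "\<And>i. P i \<in> complex_ops" "\<And>j. Q j \<in> complex_ops" "K \<in> complex_ops" "K' \<in> complex_ops"
    and SP: "\<And>y. (\<Sum>i\<in>UNIV. S i (P i y)) + K y = y"
    and QT: "\<And>x. (\<Sum>j\<in>UNIV. Q j (T j x)) + K' x = x"
    and KS: "\<And>i A. A \<in> J \<Longrightarrow> K o\<^sub>L (S i o\<^sub>L A) o\<^sub>L K' = 0"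
    and TK: "\<And>j A. A \<in> J \<Longrightarrow> K o\<^sub>L (A o\<^sub>L T j) o\<^sub>L K' = 0"
    and fin: "finite_dim {K o\<^sub>L A o\<^sub>L K' | A. A \<in> J}"
  shows "finite_codim J (hat_range J LR)"
    and "has_direct_complement (power_space J) (power_norm \<alpha>) (hat_kernel J LR)"
proof -
  note nJ = ideal_normed
  let ?F = "hat LR"
  define G where "G A = (\<chi> k. case k of Inl i \<Rightarrow> P i o\<^sub>L A | Inr j \<Rightarrow> K o\<^sub>L A o\<^sub>L Q j)" for A :: "'b \<Rightarrow>\<^sub>L 'a"
  have "bounded_op J \<alpha> J \<alpha> (\<lambda>A. case k of Inl i \<Rightarrow> P i o\<^sub>L A | Inr j \<Rightarrow> K o\<^sub>L A o\<^sub>L Q j)" for k :: "'n + 'm"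
    using bounded_op_left[OF ops(1)] bounded_op_compose_both[OF ops(3) ops(2)]
    by (cases k) simp_all
  then have G: "bounded_op J \<alpha> (power_space J) (power_norm \<alpha>) G"
    unfolding G_def[abs_def] by (rule bounded_op_tuple[OF nJ])
  \<comment> \<open>The left multiplications contribute A - K A, the right ones K A - K A
    K'.\<close>
  have FG: "?F (G A) = A - (K o\<^sub>L A o\<^sub>L K')" for A
  proof (rule blinfun_eqI)
    fix x
    have "(\<Sum>i\<in>UNIV. S i (P i (A x))) = A x - K (A x)"
      using SP[of "A x"] by (simp add: eq_diff_eq)
    moreover have "(\<Sum>j\<in>UNIV. K (A (Q j (T j x)))) = K (A (\<Sum>j\<in>UNIV. Q j (T j x)))"
      by (simp add: blinfun.sum_right)
    moreover have "(\<Sum>j\<in>UNIV. Q j (T j x)) = x - K' x"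
      using QT[of x] by (simp add: eq_diff_eq)
    ultimately show "?F (G A) x = (A - (K o\<^sub>L A o\<^sub>L K')) x"
      by (simp add: hat_mult_tuple G_def blinfun.add_left blinfun.diff_left blinfun.sum_left blinfun.diff_right)
  qed
  \<comment> \<open>The compression by K and K' vanishes on the range of F, so G is an exact
    generalized inverse although F G is the identity only up to a finite-dimensional term.\<close>
  have FGF: "?F (G (?F v)) = ?F v" if v: "v \<in> power_space J" for v
  proof -
    have "K o\<^sub>L ?F v o\<^sub>L K' = (\<Sum>i\<in>UNIV. K o\<^sub>L (S i o\<^sub>L v $ Inl i) o\<^sub>L K') + (\<Sum>j\<in>UNIV. K o\<^sub>L (v $ Inr j o\<^sub>L T j) o\<^sub>L K')"
      by (rule blinfun_eqI) (simp add: hat_mult_tuple blinfun.add_left blinfun.add_right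
          blinfun.sum_left blinfun.sum_right)
    also have "\<dots> = 0"
      using KS[OF power_spaceD[OF v]] TK[OF power_spaceD[OF v]] by simp
    finally show ?thesis by (simp add: FG)
  qed
  show "has_direct_complement (power_space J) (power_norm \<alpha>) (hat_kernel J LR)"
    unfolding hat_kernel_def
    by (rule generalized_inverse_complements(1)[of "power_space J" "power_norm \<alpha>" J \<alpha> ?F G,
          OF normed_on_power[OF nJ] nJ bounded_op_hat_LR G FGF])
  obtain B where B: "finite B" "B \<subseteq> {K o\<^sub>L A o\<^sub>L K' | A. A \<in> J}" "{K o\<^sub>L A o\<^sub>L K' | A. A \<in> J} \<subseteq> cvec.span B"
      "cvec.independent B"
    by (rule finite_dimE[OF fin])
  have "A \<in> cvec.span (hat_range J LR \<union> B)" if A: "A \<in> J" for A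
  proof (rule span_Un_diffI)
    show "?F (G A) \<in> hat_range J LR"
      using linear_onD(1)[OF bounded_op_linear[OF G] A] by (simp add: hat_range_def)
    show "A - ?F (G A) \<in> cvec.span B"
      using B(3) A by (auto simp: FG)
  qed
  moreover have "B \<subseteq> J"
    using B(2) ideal_compose_both[OF _ ops(3,4)] by blast
  ultimately show "finite_codim J (hat_range J LR)"
    unfolding finite_codim_def using B(1) by blast
qed

text \<open>Transposed construction: G adds up Q_i A_i and K B_j P_j, and G F A = A - K A K'. Now
  the compression K A K' is annihilated by F from the outside, which again yields F G F = F.\<close>

lemma tilde_mult_tuple_complemented:
  assumes ops: "\<And>i. Q i \<in> complex_ops" "\<And>j. P j \<in> complex_ops" "K \<in> complex_ops" "K' \<in> complex_ops"
    and QS: "\<And>y. (\<Sum>i\<in>UNIV. Q i (S i y)) + K y = y"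
    and TP: "\<And>x. (\<Sum>j\<in>UNIV. T j (P j x)) + K' x = x"
    and SK: "\<And>i A. A \<in> J \<Longrightarrow> S i o\<^sub>L (K o\<^sub>L A o\<^sub>L K') = 0"
    and KT: "\<And>j A. A \<in> J \<Longrightarrow> (K o\<^sub>L A o\<^sub>L K') o\<^sub>L T j = 0"
    and fin: "finite_dim {K o\<^sub>L A o\<^sub>L K' | A. A \<in> J}"
  shows "finite_dim (tilde_kernel J LR)"
    and "closedin (norm_topology (power_space J) (power_norm \<alpha>)) (tilde_range J LR)"
    and "has_direct_complement (power_space J) (power_norm \<alpha>) (tilde_range J LR)"
proof -
  note nJ = ideal_normed
  let ?F = "tilde LR"
  define H where "H k A = (case k of Inl i \<Rightarrow> Q i o\<^sub>L A | Inr j \<Rightarrow> K o\<^sub>L A o\<^sub>L P j)"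
    for k :: "'n + 'm" and A :: "'b \<Rightarrow>\<^sub>L 'a"
  define G where "G v = (\<Sum>k\<in>UNIV. H k (v $ k))" for v :: "('b \<Rightarrow>\<^sub>L 'a) ^ ('n + 'm)"
  have "bounded_op J \<alpha> J \<alpha> (H k)" for k
    unfolding H_def[abs_def]
    using bounded_op_left[OF ops(1)] bounded_op_compose_both[OF ops(3) ops(2)]
    by (cases k) simp_all
  then have G: "bounded_op (power_space J) (power_norm \<alpha>) J \<alpha> G"
    unfolding G_def[abs_def] by (rule bounded_op_sum_components[OF nJ])
  have GF: "G (?F A) = A - (K o\<^sub>L A o\<^sub>L K')" for A
  proof (rule blinfun_eqI)
    fix x
    have "(\<Sum>i\<in>UNIV. Q i (S i (A x))) = A x - K (A x)"
      using QS[of "A x"] by (simp add: eq_diff_eq)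
    moreover have "(\<Sum>j\<in>UNIV. K (A (T j (P j x)))) = K (A (\<Sum>j\<in>UNIV. T j (P j x)))"
      by (simp add: blinfun.sum_right)
    moreover have "(\<Sum>j\<in>UNIV. T j (P j x)) = x - K' x"
      using TP[of x] by (simp add: eq_diff_eq)
    ultimately show "G (?F A) x = (A - (K o\<^sub>L A o\<^sub>L K')) x"
      by (simp add: G_def H_def sum_UNIV_Plus tilde_def mult_tuple_def blinfun.add_left
          blinfun.diff_left blinfun.sum_left blinfun.diff_right)
  qed
  have FGF: "?F (G (?F A)) = ?F A" if A: "A \<in> J" for A
  proof -
    have "?F (K o\<^sub>L A o\<^sub>L K') = 0"
      using SK[OF A] KT[OF A] by (simp add: vec_eq_iff tilde_def mult_tuple_def split: sum.split)
    then show ?thesis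
      using linear_on_diff[OF bounded_op_linear[OF bounded_op_tilde_LR] normed_on_subspace[OF nJ] A
          ideal_compose_both[OF A ops(3,4)]] by (simp add: GF)
  qed
  note compl = generalized_inverse_complements[of J \<alpha> "power_space J" "power_norm \<alpha>" ?F G,
      OF nJ normed_on_power[OF nJ] bounded_op_tilde_LR G FGF]
  show "closedin (norm_topology (power_space J) (power_norm \<alpha>)) (tilde_range J LR)"
    unfolding tilde_range_def by (rule compl(2))
  show "has_direct_complement (power_space J) (power_norm \<alpha>) (tilde_range J LR)"
    unfolding tilde_range_def by (rule compl(3))
  have G0: "G 0 = 0"
    by (rule linear_on_0[OF bounded_op_linear[OF G] normed_on_subspace[OF normed_on_power[OF nJ]]])
  \<comment> \<open>F A = 0 turns the formula for G F into A = K A K', so the kernel lies in the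
    finite-dimensional set of compressions.\<close>
  have "tilde_kernel J LR \<subseteq> {K o\<^sub>L A o\<^sub>L K' | A. A \<in> J}"
  proof
    fix A assume "A \<in> tilde_kernel J LR"
    then have A: "A \<in> J" "?F A = 0" by (simp_all add: tilde_kernel_def)
    then have "A = K o\<^sub>L A o\<^sub>L K'"
      using GF[of A] G0 by simp
    with A(1) show "A \<in> {K o\<^sub>L A o\<^sub>L K' | A. A \<in> J}" by blast
  qed
  then show "finite_dim (tilde_kernel J LR)"
    using fin unfolding finite_dim_def by (meson order_trans)
qed

lemma finite_dim_zero_compression:
  "finite_dim {(0 :: 'a \<Rightarrow>\<^sub>L 'a) o\<^sub>L A o\<^sub>L (K' :: 'b \<Rightarrow>\<^sub>L 'b) | A. A \<in> J}"
  "finite_dim {(K :: 'a \<Rightarrow>\<^sub>L 'a) o\<^sub>L A o\<^sub>L (0 :: 'b \<Rightarrow>\<^sub>L 'b) | A. A \<in> J}"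
  unfolding finite_dim_def by (auto intro!: exI[of _ "{}"] blinfun_eqI simp: blinfun.zero_right)

lemma ideal_subset: "J \<subseteq> complex_ops"
  using ideal by (simp add: operator_ideal_def)

text \<open>The three alternatives describe the complement of the upper bound in (i). If
  \<open>S\<close> is onto, its remainder is 0 and \<open>T\<close> is represented by zero
  coefficients and the identity as remainder; the case of injective \<open>T\<close> is symmetric.
  Only the third case has a genuine finite-dimensional defect.\<close>

lemma hat_mult_tuple_split:
  assumes "hat_ran S = UNIV \<and> complemented (hat_ker S) \<or>
    tilde_ker T = {0} \<and> complemented (tilde_ran T) \<or>
    finite_codim UNIV (hat_ran S) \<and> complemented (hat_ker S) \<and>
    finite_dim (tilde_ker T) \<and> complemented (tilde_ran T)"
  shows "finite_codim J (hat_range J LR) \<and>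
    has_direct_complement (power_space J) (power_norm \<alpha>) (hat_kernel J LR)"
  using assms
proof (elim disjE conjE)
  assume onto: "hat_ran S = UNIV" and compl: "complemented (hat_ker S)"
  show ?thesis
  proof (rule tuple_right_inverse[of S, OF S compl])
    fix P :: "'n \<Rightarrow> 'a \<Rightarrow>\<^sub>L 'a" and K :: "'a \<Rightarrow>\<^sub>L 'a"
    assume P: "\<And>i. P i \<in> complex_ops" "\<And>y. (\<Sum>i\<in>UNIV. S i (P i y)) + K y = y" "\<And>i x. K (S i x) = 0"
    have "K = 0"
      by (rule op_zero_if_onto[OF onto P(3)])
    then show ?thesis
      using hat_mult_tuple_complemented[of P "\<lambda>_. 0" 0 id_blinfun] P(1,2) finite_dim_zero_compression by simp
  qed (simp add: onto finite_codim_UNIV)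
next
  assume inj: "tilde_ker T = {0}" and compl: "complemented (tilde_ran T)"
  show ?thesis
  proof (rule tuple_left_inverse[of T, OF T compl])
    fix Q :: "'m \<Rightarrow> 'b \<Rightarrow>\<^sub>L 'b" and K :: "'b \<Rightarrow>\<^sub>L 'b"
    assume Q: "\<And>i. Q i \<in> complex_ops" "\<And>x. (\<Sum>i\<in>UNIV. Q i (T i x)) + K x = x" "\<And>i x. T i (K x) = 0"
    have "K = 0"
      by (rule op_zero_if_inj[OF inj Q(3)])
    then show ?thesis
      using hat_mult_tuple_complemented[of "\<lambda>_. 0" Q id_blinfun 0] Q(1,2) finite_dim_zero_compression by simp
  qed (simp add: inj finite_dim_zero)
next
  assume S': "finite_codim UNIV (hat_ran S)" "complemented (hat_ker S)"
    and T': "finite_dim (tilde_ker T)" "complemented (tilde_ran T)"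
  show ?thesis
  proof (rule tuple_right_inverse[of S, OF S S'(2,1)], rule tuple_left_inverse[of T, OF T T'(2,1)])
    fix P :: "'n \<Rightarrow> 'a \<Rightarrow>\<^sub>L 'a" and K :: "'a \<Rightarrow>\<^sub>L 'a" and Q :: "'m \<Rightarrow> 'b \<Rightarrow>\<^sub>L 'b" and K' :: "'b \<Rightarrow>\<^sub>L 'b"
    assume P: "\<And>i. P i \<in> complex_ops" "K \<in> complex_ops" "finite_rank K"
        "\<And>y. (\<Sum>i\<in>UNIV. S i (P i y)) + K y = y" "\<And>i x. K (S i x) = 0"
      and Q: "\<And>j. Q j \<in> complex_ops" "K' \<in> complex_ops" "finite_rank K'"
        "\<And>x. (\<Sum>j\<in>UNIV. Q j (T j x)) + K' x = x" "\<And>j x. T j (K' x) = 0"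
    have "K o\<^sub>L (S i o\<^sub>L A) o\<^sub>L K' = 0" "K o\<^sub>L (A o\<^sub>L T j) o\<^sub>L K' = 0" for i j and A :: "'b \<Rightarrow>\<^sub>L 'a"
      by (rule blinfun_eqI, simp add: P(5) Q(5) blinfun.zero_right)+
    then show ?thesis
      using hat_mult_tuple_complemented[of P Q K K', OF P(1) Q(1) P(2) Q(2) P(4) Q(4)]
        finite_dim_compression[OF P(3) Q(3) ideal_subset] by simp
  qed
qed

text \<open>The same three alternatives for the upper bound in (ii): left inverses now belong to
  \<open>S\<close> and right inverses to \<open>T\<close>.\<close>

lemma tilde_mult_tuple_split:
  assumes "tilde_ker S = {0} \<and> complemented (tilde_ran S) \<or>
    hat_ran T = UNIV \<and> complemented (hat_ker T) \<or>
    finite_dim (tilde_ker S) \<and> complemented (tilde_ran S) \<and>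
    finite_codim UNIV (hat_ran T) \<and> complemented (hat_ker T)"
  shows "finite_dim (tilde_kernel J LR) \<and>
    closedin (norm_topology (power_space J) (power_norm \<alpha>)) (tilde_range J LR) \<and>
    has_direct_complement (power_space J) (power_norm \<alpha>) (tilde_range J LR)"
  using assms
proof (elim disjE conjE)
  assume inj: "tilde_ker S = {0}" and compl: "complemented (tilde_ran S)"
  show ?thesis
  proof (rule tuple_left_inverse[of S, OF S compl])
    fix Q :: "'n \<Rightarrow> 'a \<Rightarrow>\<^sub>L 'a" and K :: "'a \<Rightarrow>\<^sub>L 'a"
    assume Q: "\<And>i. Q i \<in> complex_ops" "\<And>x. (\<Sum>i\<in>UNIV. Q i (S i x)) + K x = x" "\<And>i x. S i (K x) = 0"
    have "K = 0"
      by (rule op_zero_if_inj[OF inj Q(3)])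
    then show ?thesis
      using tilde_mult_tuple_complemented[of Q "\<lambda>_. 0" 0 id_blinfun] Q(1,2) finite_dim_zero_compression by simp
  qed (simp add: inj finite_dim_zero)
next
  assume onto: "hat_ran T = UNIV" and compl: "complemented (hat_ker T)"
  show ?thesis
  proof (rule tuple_right_inverse[of T, OF T compl])
    fix P :: "'m \<Rightarrow> 'b \<Rightarrow>\<^sub>L 'b" and K :: "'b \<Rightarrow>\<^sub>L 'b"
    assume P: "\<And>i. P i \<in> complex_ops" "\<And>y. (\<Sum>i\<in>UNIV. T i (P i y)) + K y = y" "\<And>i x. K (T i x) = 0"
    have "K = 0"
      by (rule op_zero_if_onto[OF onto P(3)])
    then show ?thesis
      using tilde_mult_tuple_complemented[of "\<lambda>_. 0" P id_blinfun 0] P(1,2) finite_dim_zero_compression by simp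
  qed (simp add: onto finite_codim_UNIV)
next
  assume S': "finite_dim (tilde_ker S)" "complemented (tilde_ran S)"
    and T': "finite_codim UNIV (hat_ran T)" "complemented (hat_ker T)"
  show ?thesis
  proof (rule tuple_left_inverse[of S, OF S S'(2,1)], rule tuple_right_inverse[of T, OF T T'(2,1)])
    fix Q :: "'n \<Rightarrow> 'a \<Rightarrow>\<^sub>L 'a" and K :: "'a \<Rightarrow>\<^sub>L 'a" and P :: "'m \<Rightarrow> 'b \<Rightarrow>\<^sub>L 'b" and K' :: "'b \<Rightarrow>\<^sub>L 'b"
    assume Q: "\<And>i. Q i \<in> complex_ops" "K \<in> complex_ops" "finite_rank K"
        "\<And>x. (\<Sum>i\<in>UNIV. Q i (S i x)) + K x = x" "\<And>i x. S i (K x) = 0"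
      and P: "\<And>j. P j \<in> complex_ops" "K' \<in> complex_ops" "finite_rank K'"
        "\<And>y. (\<Sum>j\<in>UNIV. T j (P j y)) + K' y = y" "\<And>j x. K' (T j x) = 0"
    have "S i o\<^sub>L (K o\<^sub>L A o\<^sub>L K') = 0" "(K o\<^sub>L A o\<^sub>L K') o\<^sub>L T j = 0" for i j and A :: "'b \<Rightarrow>\<^sub>L 'a"
      by (rule blinfun_eqI, simp add: Q(5) P(5) blinfun.zero_right)+
    then show ?thesis
      using tilde_mult_tuple_complemented[of Q P K K', OF Q(1) P(1) Q(2) P(2) Q(4) P(4)]
        finite_dim_compression[OF Q(3) P(3) ideal_subset] by simp
  qed
qed

end

end

section \<open>The joint spectra of the multiplication tuple\<close>

definition shift_ops :: "('n \<Rightarrow> ('a::complex_banach \<Rightarrow>\<^sub>L 'a)) \<Rightarrow> complex ^ 'n \<Rightarrow> 'n \<Rightarrow> ('a \<Rightarrow>\<^sub>L 'a)"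
  where "shift_ops T l i = T i - (l $ i) *\<^sub>C id_blinfun"

lemma shift_op_tuple: "shift (op_tuple T) l = op_tuple (shift_ops T l)"
  by (simp add: fun_eq_iff shift_def shift_ops_def blinfun.diff_left)

lemma shift_ops_complex_ops: "(\<And>i. T i \<in> complex_ops) \<Longrightarrow> shift_ops T l i \<in> complex_ops"
  by (simp add: shift_ops_def complex_ops_diff complex_ops_scale)

text \<open>Complex linearity of \<open>A\<close> moves the scalar of a right shift past
  \<open>A\<close>. So the reduction to the point 0 is available on \<open>J\<close>, whose elements
  are complex-linear.\<close>

lemma shift_mult_tuple:
  assumes "A \<in> complex_ops"
  shows "shift (mult_tuple S T) (append_vec a b) k A = mult_tuple (shift_ops S a) (shift_ops T b) k A"
  using assms
  by (auto intro!: blinfun_eqI simp: shift_def mult_tuple_def append_vec_def shift_ops_def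
      blinfun.diff_left blinfun.diff_right complex_opsD split: sum.split)

lemma append_vec_cases:
  obtains a b where "l = append_vec a b"
proof
  show "l = append_vec (\<chi> i. l $ Inl i) (\<chi> j. l $ Inr j)"
    by (simp add: vec_eq_iff append_vec_def split: sum.split)
qed

lemma append_vec_subsetI: "(\<And>a b. append_vec a b \<in> A \<Longrightarrow> append_vec a b \<in> B) \<Longrightarrow> A \<subseteq> B"
  by (metis append_vec_cases subsetI)

lemma append_vec_in_vec_Times [simp]: "append_vec a b \<in> A \<times>\<^sub>v B \<longleftrightarrow> a \<in> A \<and> b \<in> B"
proof -
  have "append_vec a b = append_vec a' b' \<longleftrightarrow> a = a' \<and> b = b'" for a' b'
  proof
    assume eq: "append_vec a b = append_vec a' b'"
    have "a $ i = a' $ i" "b $ j = b' $ j" for i j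
      using arg_cong[OF eq, of "\<lambda>v. v $ Inl i"] arg_cong[OF eq, of "\<lambda>v. v $ Inr j"]
      by (simp_all add: append_vec_def)
    then show "a = a' \<and> b = b'" by (simp add: vec_eq_iff)
  qed simp
  then show ?thesis by (auto simp: vec_Times_def)
qed

text \<open>Kernels are closed, so \<open>C_minus\<close> is empty. Ranges may fail to be closed,
  but such a point already belongs to \<open>sigma_pi\<close> and \<open>sigma_Phi_plus\<close>, so
  \<open>C_plus\<close> adds nothing to either.\<close>

lemma hilbert_space_sp_eq:
  fixes T :: "'n::finite \<Rightarrow> ('a::complex_banach \<Rightarrow>\<^sub>L 'a)"
  assumes H: "hilbert_space TYPE('a)" and T: "\<And>i. T i \<in> complex_ops"
  shows "sp_delta UNIV norm (op_tuple T) = sigma_delta UNIV (op_tuple T)"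
    and "sp_delta_e UNIV norm (op_tuple T) = sigma_Phi_minus UNIV (op_tuple T)"
    and "sp_pi UNIV norm (op_tuple T) = sigma_pi UNIV norm (op_tuple T)"
    and "sp_pi_e UNIV norm (op_tuple T) = sigma_Phi_plus UNIV norm (op_tuple T)"
proof -
  note nX = banach_on_normed[OF banach_on_UNIV[where 'a='a]]
  note nP = banach_on_normed[OF banach_on_powerI[where 'a='a and 'n='n]]
  have minus: "C_minus UNIV norm (op_tuple T) = {}"
  proof -
    have "has_direct_complement UNIV norm (hat_kernel UNIV (shift (op_tuple T) l))" for l
    proof -
      note F = bounded_op_hat_ops[of "shift_ops T l", OF shift_ops_complex_ops[OF T]]
      show ?thesis
        unfolding shift_op_tuple hat_kernel_def power_space_UNIV
        by (intro hilbert_space_complement[OF H] closedin_kernel[OF nP nX F]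
            linear_on_kernel[OF bounded_op_linear[OF F] normed_on_subspace[OF nP]])
    qed
    then show ?thesis by (simp add: C_minus_def power_norm_norm)
  qed
  have plus: "has_direct_complement UNIV norm (tilde_range UNIV (shift (op_tuple T) l))"
    if "closedin (norm_topology UNIV norm) (tilde_range UNIV (shift (op_tuple T) l))" for l
  proof -
    note F = bounded_op_tilde_ops[of "shift_ops T l", OF shift_ops_complex_ops[OF T]]
    show ?thesis
      using that unfolding shift_op_tuple tilde_range_def
      by (intro hilbert_space_complement[OF H]
          linear_on_image[OF bounded_op_linear[OF F] normed_on_subspace[OF nX]])
  qed
  show "sp_delta UNIV norm (op_tuple T) = sigma_delta UNIV (op_tuple T)"
    "sp_delta_e UNIV norm (op_tuple T) = sigma_Phi_minus UNIV (op_tuple T)"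
    by (simp_all add: sp_delta_def sp_delta_e_def minus)
  show "sp_pi UNIV norm (op_tuple T) = sigma_pi UNIV norm (op_tuple T)"
    "sp_pi_e UNIV norm (op_tuple T) = sigma_Phi_plus UNIV norm (op_tuple T)"
    using plus by (auto simp: sp_pi_def sp_pi_e_def sigma_pi_def sigma_Phi_plus_def C_plus_def power_norm_norm)
qed

theorem proposition6p2:
  fixes J :: "('b::complex_banach \<Rightarrow>\<^sub>L 'a::complex_banach) set"
    and \<alpha> :: "('b \<Rightarrow>\<^sub>L 'a) \<Rightarrow> real"
    and S :: "'n::finite \<Rightarrow> ('a \<Rightarrow>\<^sub>L 'a)"
    and T :: "'m::finite \<Rightarrow> ('b \<Rightarrow>\<^sub>L 'b)"
  assumes "operator_ideal J \<alpha>" and "commuting_tuple S" and "commuting_tuple T"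
  shows
    "let
       s = op_tuple S; t = op_tuple T; LR = mult_tuple S T;
       lower1 = sigma_Phi_minus UNIV s \<times>\<^sub>v sigma_pi UNIV norm t
                \<union> sigma_delta UNIV s \<times>\<^sub>v sigma_Phi_plus UNIV norm t;
       upper1 = sp_delta_e UNIV norm s \<times>\<^sub>v sp_pi UNIV norm t
                \<union> sp_delta UNIV norm s \<times>\<^sub>v sp_pi_e UNIV norm t;
       lower2 = sigma_Phi_plus UNIV norm s \<times>\<^sub>v sigma_delta UNIV t
                \<union> sigma_pi UNIV norm s \<times>\<^sub>v sigma_Phi_minus UNIV t;
       upper2 = sp_pi_e UNIV norm s \<times>\<^sub>v sp_delta UNIV norm t
                \<union> sp_pi UNIV norm s \<times>\<^sub>v sp_delta_e UNIV norm t
     in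
       (lower1 \<subseteq> sigma_Phi_minus J LR \<and>
        sigma_Phi_minus J LR \<subseteq> sp_delta_e J \<alpha> LR \<and>
        sp_delta_e J \<alpha> LR \<subseteq> upper1) \<and>
       (lower2 \<subseteq> sigma_Phi_plus J \<alpha> LR \<and>
        sigma_Phi_plus J \<alpha> LR \<subseteq> sp_pi_e J \<alpha> LR \<and>
        sp_pi_e J \<alpha> LR \<subseteq> upper2) \<and>
       (hilbert_space TYPE('a) \<and> hilbert_space TYPE('b) \<longrightarrow>
         (lower1 = sigma_Phi_minus J LR \<and>
          sigma_Phi_minus J LR = sp_delta_e J \<alpha> LR \<and>
          sp_delta_e J \<alpha> LR = upper1) \<and>
         (lower2 = sigma_Phi_plus J \<alpha> LR \<and>
          sigma_Phi_plus J \<alpha> LR = sp_pi_e J \<alpha> LR \<and>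
          sp_pi_e J \<alpha> LR = upper2))"
proof -
  note ideal = assms(1)
  have S: "S i \<in> complex_ops" for i
    using assms(2) by (simp add: commuting_tuple_def)
  have T: "T j \<in> complex_ops" for j
    using assms(3) by (simp add: commuting_tuple_def)
  note S' = shift_ops_complex_ops[OF S] and T' = shift_ops_complex_ops[OF T]
  have JV: "v $ k \<in> complex_ops" if "v \<in> power_space J" for v :: "('b \<Rightarrow>\<^sub>L 'a) ^ ('n + 'm)" and k
    using ideal_complex_ops[OF ideal power_spaceD[OF that]] .
  let ?X = "\<lambda>a b. shift (mult_tuple S T) (append_vec a b)"
  let ?Y = "\<lambda>a b. mult_tuple (shift_ops S a) (shift_ops T b)"
  have hat_eq: "hat (?X a b) v = hat (?Y a b) v"
    if "v \<in> power_space J" for a b v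
    by (simp add: hat_def shift_mult_tuple[OF JV[OF that]])
  have tilde_eq: "tilde (?X a b) A = tilde (?Y a b) A"
    if "A \<in> J" for a b A
    by (simp add: tilde_def shift_mult_tuple[OF ideal_complex_ops[OF ideal that]])
  have shift_eqs:
    "hat_range J (?X a b) = hat_range J (?Y a b)"
    "hat_kernel J (?X a b) = hat_kernel J (?Y a b)"
    "tilde_range J (?X a b) = tilde_range J (?Y a b)"
    "tilde_kernel J (?X a b) = tilde_kernel J (?Y a b)"
    for a b
    using hat_eq tilde_eq
    by (auto simp: hat_range_def hat_kernel_def tilde_range_def tilde_kernel_def cong: conj_cong image_cong_simp)
  let ?s = "op_tuple S" and ?t = "op_tuple T" and ?LR = "mult_tuple S T"
  let ?lower1 = "sigma_Phi_minus UNIV ?s \<times>\<^sub>v sigma_pi UNIV norm ?t \<union> sigma_delta UNIV ?s \<times>\<^sub>v sigma_Phi_plus UNIV norm ?t"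
  let ?upper1 = "sp_delta_e UNIV norm ?s \<times>\<^sub>v sp_pi UNIV norm ?t \<union> sp_delta UNIV norm ?s \<times>\<^sub>v sp_pi_e UNIV norm ?t"
  let ?lower2 = "sigma_Phi_plus UNIV norm ?s \<times>\<^sub>v sigma_delta UNIV ?t \<union> sigma_pi UNIV norm ?s \<times>\<^sub>v sigma_Phi_minus UNIV ?t"
  let ?upper2 = "sp_pi_e UNIV norm ?s \<times>\<^sub>v sp_delta UNIV norm ?t \<union> sp_pi UNIV norm ?s \<times>\<^sub>v sp_delta_e UNIV norm ?t"
  note sp_defs = sigma_Phi_minus_def sigma_Phi_plus_def sigma_delta_def sigma_pi_def C_minus_def C_plus_def
    sp_delta_def sp_delta_e_def sp_pi_def sp_pi_e_def shift_op_tuple shift_eqs power_norm_norm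
  have 1: "?lower1 \<subseteq> sigma_Phi_minus J ?LR"
  proof (rule append_vec_subsetI)
    show "append_vec a b \<in> sigma_Phi_minus J ?LR" if "append_vec a b \<in> ?lower1" for a b
      using that finite_codim_left_factor[of J \<alpha> "shift_ops S a" "shift_ops T b", OF ideal S' T']
        surjective_left_factor[of J \<alpha> "shift_ops S a" "shift_ops T b", OF ideal S' T']
      by (auto simp: sp_defs)
  qed
  have 2: "?lower2 \<subseteq> sigma_Phi_plus J \<alpha> ?LR"
  proof (rule append_vec_subsetI)
    show "append_vec a b \<in> sigma_Phi_plus J \<alpha> ?LR" if "append_vec a b \<in> ?lower2" for a b
      using that semi_Fredholm_left_factor[of J \<alpha> "shift_ops S a" "shift_ops T b", OF ideal S' T']
        finite_codim_right_factor[of J \<alpha> "shift_ops S a" "shift_ops T b", OF ideal S' T']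
      by (auto simp: sp_defs)
  qed
  \<comment> \<open>By contraposition: a point outside both products satisfies one of the three
    alternatives of \<open>hat_mult_tuple_split\<close>. The facts \<open>finite_codim_UNIV\<close>
    and \<open>finite_dim_zero\<close> express that the essential spectra lie in the full
    ones.\<close>
  have 3: "sp_delta_e J \<alpha> ?LR \<subseteq> ?upper1"
  proof (rule append_vec_subsetI)
    show "append_vec a b \<in> ?upper1" if "append_vec a b \<in> sp_delta_e J \<alpha> ?LR" for a b
      using that hat_mult_tuple_split[of J \<alpha> "shift_ops S a" "shift_ops T b", OF ideal S' T']
        finite_codim_UNIV finite_dim_zero
      by (auto simp: sp_defs)
  qed
  have 4: "sp_pi_e J \<alpha> ?LR \<subseteq> ?upper2"
  proof (rule append_vec_subsetI)
    show "append_vec a b \<in> ?upper2" if "append_vec a b \<in> sp_pi_e J \<alpha> ?LR" for a b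
      using that tilde_mult_tuple_split[of J \<alpha> "shift_ops S a" "shift_ops T b", OF ideal S' T']
        finite_codim_UNIV finite_dim_zero
      by (auto simp: sp_defs)
  qed
  have 5: "sigma_Phi_minus J ?LR \<subseteq> sp_delta_e J \<alpha> ?LR" "sigma_Phi_plus J \<alpha> ?LR \<subseteq> sp_pi_e J \<alpha> ?LR"
    by (simp_all add: sp_delta_e_def sp_pi_e_def)
  \<comment> \<open>With split and unsplit spectra equal, the two ends of each chain of inclusions
    coincide, which collapses everything between.\<close>
  have 6: "?upper1 = ?lower1" "?upper2 = ?lower2"
    if "hilbert_space TYPE('a)" "hilbert_space TYPE('b)"
    by (simp_all add: hilbert_space_sp_eq[OF that(1) S] hilbert_space_sp_eq[OF that(2) T])
  have "?lower1 = sigma_Phi_minus J ?LR \<and> sigma_Phi_minus J ?LR = sp_delta_e J \<alpha> ?LR \<and> sp_delta_e J \<alpha> ?LR = ?upper1"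
    "?lower2 = sigma_Phi_plus J \<alpha> ?LR \<and> sigma_Phi_plus J \<alpha> ?LR = sp_pi_e J \<alpha> ?LR \<and> sp_pi_e J \<alpha> ?LR = ?upper2"
    if "hilbert_space TYPE('a) \<and> hilbert_space TYPE('b)"
    using 1 2 3 4 5 unfolding 6[OF conjunct1[OF that] conjunct2[OF that]] by blast+
  with 1 2 3 4 5 show ?thesis
    unfolding Let_def by blast
qed

end
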